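(* A bounded linear operator $S$ on $\mathcal{F}(\mathbb{C}^n)$ commutes with $\rho(a)$ for all $a\in\mathbb{R}^n$ if and only if there exists $m\in L^\infty(\mathbb{R}^n)$ such that for all $F\in\mathcal{F}(\mathbb{C}^n)$ and $z\in\mathbb{C}^n$ $$SF(z)=e^{\frac14 z^2}\int_{\mathbb{R}^n}m(\xi)\,G^*F(\xi)\,e^{iz\cdot\xi}\,d\gamma(\xi).$$
   Context: For $z,w\in\mathbb{C}^n$ write $z\cdot w=\sum_j z_jw_j$ and $z^2=z\cdot z$. Let $d\nu(z)=c_ne^{-\frac12|z|^2}dz$ on $\mathbb{C}^n$ with $c_n=(2\pi)^{-n}$; the Fock space $\mathcal{F}(\mathbb{C}^n)$ is the Hilbert space of entire functions on $\mathbb{C}^n$ square integrable with respect to $\nu$. For $a\in\mathbb{R}^n$, $\rho(a)$ is the unitary operator on $\mathcal{F}(\mathbb{C}^n)$ given by $\rho(a)F(z)=F(z+a)\,e^{-\frac12 a\cdot z}\,e^{-\frac14|a|^2}$. Let $d\gamma(x)=e^{-|x|^2}dx$ on $\mathbb{R}^n$. The Gauss-Bargmann transform $G:L^2(\mathbb{R}^n,d\gamma)\to\mathcal{F}(\mathbb{C}^n)$ is $$Gf(z)=\int_{\mathbb{R}^n}f(\xi)e^{-(\xi-\frac i2 z)^2}d\xi=e^{\frac14z^2}\int_{\mathbb{R}^n}f(\xi)e^{iz\cdot\xi}\,d\gamma(\xi);$$ up to a positive constant factor it is unitary onto $\mathcal{F}(\mathbb{C}^n)$, and $G^*:\mathcal{F}(\mathbb{C}^n)\to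 L^2(\mathbb{R}^n,d\gamma)$ denotes its Hilbert space adjoint. *)

theory Defs
  imports "HOL-Analysis.Analysis"
begin

text \<open>
  The dimension \<open>n\<close> is \<open>CARD('n)\<close>, so \<open>\<complex>\<^sup>n\<close> is \<open>complex ^ 'n\<close> and \<open>\<real>\<^sup>n\<close> is \<open>real ^ 'n\<close>.
  The library norm of \<open>complex ^ 'n\<close> is the Hermitian one, and its \<open>lborel\<close> is
  Lebesgue measure on \<open>\<real>\<^sup>2\<^sup>n\<close>.
\<close>

text \<open>The bilinear (not sesquilinear) dot product.\<close>

definition cdot :: "complex ^ 'n \<Rightarrow> complex ^ 'n \<Rightarrow> complex"  (infixl "\<bullet>\<^sub>c" 70)
  where "z \<bullet>\<^sub>c w = (\<Sum>j\<in>UNIV. z $ j * w $ j)"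

definition cvec :: "real ^ 'n \<Rightarrow> complex ^ 'n"
  where "cvec a = (\<chi> j. of_real (a $ j))"


subsection \<open>The Fock space\<close>

definition fock_measure :: "(complex ^ 'n) measure"
  where "fock_measure =
    density lborel (\<lambda>z. ennreal ((1 / (2 * pi) ^ CARD('n)) * exp (- (1/2) * (norm z)\<^sup>2)))"

text \<open>Entire means Frechet differentiable everywhere with complex linear derivative.\<close>

definition entire :: "(complex ^ 'n \<Rightarrow> complex) \<Rightarrow> bool"
  where "entire F \<longleftrightarrow> (\<forall>z. \<exists>c. (F has_derivative (\<lambda>h. c \<bullet>\<^sub>c h)) (at z))"

definition fock_space :: "(complex ^ 'n \<Rightarrow> complex) set"
  where "fock_space = {F. entire F \<and> integrable fock_measure (\<lambda>z. (cmod (F z))\<^sup>2)}"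

definition fock_inner :: "(complex ^ 'n \<Rightarrow> complex) \<Rightarrow> (complex ^ 'n \<Rightarrow> complex) \<Rightarrow> complex"
  where "fock_inner F H = (LINT z|fock_measure. F z * cnj (H z))"

definition fock_norm :: "(complex ^ 'n \<Rightarrow> complex) \<Rightarrow> real"
  where "fock_norm F = sqrt (LINT z|fock_measure. (cmod (F z))\<^sup>2)"

definition fock_bounded_linear ::
    "((complex ^ 'n \<Rightarrow> complex) \<Rightarrow> (complex ^ 'n \<Rightarrow> complex)) \<Rightarrow> bool"
  where "fock_bounded_linear S \<longleftrightarrow>
    (\<forall>F\<in>fock_space. S F \<in> fock_space) \<and>
    (\<forall>F\<in>fock_space. \<forall>H\<in>fock_space. S (\<lambda>z. F z + H z) = (\<lambda>z. S F z + S H z)) \<and>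
    (\<forall>c. \<forall>F\<in>fock_space. S (\<lambda>z. c * F z) = (\<lambda>z. c * S F z)) \<and>
    (\<exists>C. \<forall>F\<in>fock_space. fock_norm (S F) \<le> C * fock_norm F)"

definition rho :: "real ^ 'n \<Rightarrow> (complex ^ 'n \<Rightarrow> complex) \<Rightarrow> (complex ^ 'n \<Rightarrow> complex)"
  where "rho a F = (\<lambda>z. F (z + cvec a) * exp (- (1/2) * (cvec a \<bullet>\<^sub>c z)) *
                         exp (- (1/4) * of_real ((norm a)\<^sup>2)))"


subsection \<open>The Gauss-Bargmann transform\<close>

definition gauss :: "(real ^ 'n) measure"
  where "gauss = density lborel (\<lambda>x. ennreal (exp (- (norm x)\<^sup>2)))"

text \<open>
  Elements of \<open>L\<^sup>2(\<real>\<^sup>n, \<gamma>)\<close> and \<open>L\<^sup>\<infinity>(\<real>\<^sup>n)\<close> are represented by Borel functions; equality in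
  these spaces is equality almost everywhere.
\<close>

definition L2_gauss :: "(real ^ 'n \<Rightarrow> complex) set"
  where "L2_gauss = {f \<in> borel_measurable borel. integrable gauss (\<lambda>x. (cmod (f x))\<^sup>2)}"

definition L2_gauss_inner :: "(real ^ 'n \<Rightarrow> complex) \<Rightarrow> (real ^ 'n \<Rightarrow> complex) \<Rightarrow> complex"
  where "L2_gauss_inner f g = (LINT x|gauss. f x * cnj (g x))"

definition Linfty :: "(real ^ 'n \<Rightarrow> complex) set"
  where "Linfty = {m \<in> borel_measurable borel. \<exists>C. AE x in lborel. cmod (m x) \<le> C}"

definition gauss_bargmann :: "(real ^ 'n \<Rightarrow> complex) \<Rightarrow> (complex ^ 'n \<Rightarrow> complex)"
  where "gauss_bargmann f = (\<lambda>z. LINT \<xi>|lborel.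
    f \<xi> * exp (- ((cvec \<xi> - (\<i> / 2) *s z) \<bullet>\<^sub>c (cvec \<xi> - (\<i> / 2) *s z))))"

text \<open>
  The Hilbert space adjoint \<open>G\<^sup>* F\<close> is determined by \<open>\<langle>f, G\<^sup>* F\<rangle> = \<langle>G f, F\<rangle>\<close> for all \<open>f\<close> only up to
  equality almost everywhere; \<open>SOME\<close> picks a representative of this class.
\<close>

definition gauss_bargmann_adjoint :: "(complex ^ 'n \<Rightarrow> complex) \<Rightarrow> (real ^ 'n \<Rightarrow> complex)"
  where "gauss_bargmann_adjoint F = (SOME g. g \<in> L2_gauss \<and>
    (\<forall>f\<in>L2_gauss. L2_gauss_inner f g = fock_inner (gauss_bargmann f) F))"

lemma cdot_cvec_self: "cvec x \<bullet>\<^sub>c cvec x = of_real ((norm x)\<^sup>2)"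
  by (simp add: cdot_def cvec_def power2_norm_eq_inner inner_vec_def)

lemma gauss_bargmann_alt:
  assumes "f \<in> borel_measurable borel"
  shows "gauss_bargmann f z =
    exp ((1/4) * (z \<bullet>\<^sub>c z)) * (LINT \<xi>|gauss. f \<xi> * exp (\<i> * (z \<bullet>\<^sub>c cvec \<xi>)))"
proof -
  have sq: "(cvec \<xi> - (\<i> / 2) *s z) \<bullet>\<^sub>c (cvec \<xi> - (\<i> / 2) *s z)
      = of_real ((norm \<xi>)\<^sup>2) - \<i> * (z \<bullet>\<^sub>c cvec \<xi>) - (1/4) * (z \<bullet>\<^sub>c z)" for \<xi> :: "real ^ 'a"
  proof -
    have "(cvec \<xi> - (\<i> / 2) *s z) \<bullet>\<^sub>c (cvec \<xi> - (\<i> / 2) *s z)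
        = cvec \<xi> \<bullet>\<^sub>c cvec \<xi> - \<i> * (z \<bullet>\<^sub>c cvec \<xi>) - (1/4) * (z \<bullet>\<^sub>c z)"
      unfolding cdot_def sum_distrib_left sum_subtractf[symmetric]
      by (rule sum.cong) (auto simp: algebra_simps)
    then show ?thesis by (simp add: cdot_cvec_self)
  qed
  have split: "exp (- (of_real ((norm \<xi>)\<^sup>2) - \<i> * (z \<bullet>\<^sub>c cvec \<xi>) - (1/4) * (z \<bullet>\<^sub>c z)))
      = exp ((1/4) * (z \<bullet>\<^sub>c z)) * (exp (\<i> * (z \<bullet>\<^sub>c cvec \<xi>)) * of_real (exp (- (norm \<xi>)\<^sup>2)))"
    for \<xi> :: "real ^ 'a"
    by (simp add: exp_of_real[symmetric] exp_add[symmetric] algebra_simps)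
  have meas: "(\<lambda>\<xi>. f \<xi> * exp (\<i> * (z \<bullet>\<^sub>c cvec \<xi>))) \<in> borel_measurable lborel"
  proof -
    have "continuous_on UNIV (\<lambda>\<xi>. exp (\<i> * (z \<bullet>\<^sub>c cvec \<xi>)))"
      unfolding cdot_def cvec_def by (intro continuous_intros)
    then show ?thesis
      using assms borel_measurable_times[OF assms borel_measurable_continuous_onI] by simp
  qed
  have "(LINT \<xi>|gauss. f \<xi> * exp (\<i> * (z \<bullet>\<^sub>c cvec \<xi>)))
      = (LINT \<xi>|lborel. exp (- (norm \<xi>)\<^sup>2) *\<^sub>R (f \<xi> * exp (\<i> * (z \<bullet>\<^sub>c cvec \<xi>))))"
    unfolding gauss_def by (rule integral_density[OF meas]) auto
  then show ?thesis
    unfolding gauss_bargmann_def sq split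
    by (simp add: scaleR_conv_of_real mult_ac flip: integral_mult_right_zero)
qed

end

theory Submission
  imports Defs "HOL-Probability.Characteristic_Functions" "HOL-Complex_Analysis.Cauchy_Integral_Formula"
begin

text \<open>
  The transform \<open>G\<close> intertwines \<open>\<rho>(a)\<close> with the multiplication by the character \<open>e\<^sup>i\<^sup>a\<^sup>\<xi>\<close>
  (\<open>rho_gauss_bargmann\<close>). It is onto the Fock space and satisfies \<open>\<langle>Gf, Gg\<rangle> = k \<langle>f, g\<rangle>\<close> with
  \<open>k = \<pi>\<^sup>n\<^sup>/\<^sup>2\<close>. Hence \<open>G\<^sup>* G\<close> is the multiplication by \<open>k\<close>, and an operator has the form in the theorem exactly if its conjugate
  under \<open>G\<close> is the multiplication by the bounded function \<open>k m\<close>. Multiplications commute with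
  characters, which is one direction. For the other direction (\<open>commuting_imp_multiplier\<close>) let \<open>S\<close>
  commute with all \<open>\<rho>(a)\<close>. The functional \<open>f \<mapsto> S(Gf)(0)\<close> is bounded, so it is \<open>f \<mapsto> \<integral> q f d\<gamma>\<close> for
  some \<open>q\<close> in \<open>L\<^sup>2(\<gamma>)\<close>. If \<open>S(Gf) = Gh\<close>, evaluating \<open>S(\<rho>(a) Gf) = \<rho>(a) Gh\<close> at \<open>0\<close> says that \<open>q f\<close>
  and \<open>h\<close> have the same Fourier coefficient against \<open>e\<^sup>i\<^sup>a\<^sup>\<xi>\<close>, for every \<open>a\<close>; by injectivity of the
  Fourier transform \<open>h = q f\<close> almost everywhere. Finally, \<open>\<parallel>q f\<parallel> \<le> C \<parallel>f\<parallel>\<close> for all \<open>f\<close> forces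
  \<open>\<bar>q\<bar> \<le> C\<close> almost everywhere, and \<open>m = q / k\<close>.

  The unitarity of \<open>G\<close> is derived from the reproducing kernel of the Fock space rather than from
  Plancherel's theorem. An entire function that is integrable for the rotation invariant
  probability measure \<open>\<nu>\<close> has mean \<open>F(0)\<close>; translating, \<open>\<langle>F, e\<^sub>w\<rangle> = F(w)\<close> for the coherent states
  \<open>e\<^sub>w(z) = exp(z \<sqdot> w\<^sup>* / 2)\<close>, where \<open>w\<^sup>*\<close> is the complex conjugate (\<open>fock_reproducing\<close>). A Gaussian
  integral shows that \<open>G\<close> maps the exponential \<open>exp(u \<sqdot> \<xi>)\<close> to a multiple of a coherent state, so the
  reproducing property gives \<open>\<langle>Gf, Gg\<rangle> = k \<langle>f, g\<rangle>\<close> as soon as \<open>g\<close> is an exponential. Exponentials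
  span a dense subspace of \<open>L\<^sup>2(\<gamma>)\<close>, again by injectivity of the Fourier transform, and Fatou's
  lemma extends the isometry to all of \<open>L\<^sup>2(\<gamma>)\<close> (\<open>gauss_bargmann_isometry\<close>). For surjectivity
  (\<open>gauss_bargmann_surjective\<close>), represent \<open>f \<mapsto> \<langle>Gf, F\<rangle>\<close> by some \<open>g\<close>; then \<open>k\<^sup>-\<^sup>1 G g\<close> and \<open>F\<close> have the
  same inner products with all coherent states, so they agree at every point.
\<close>


section \<open>Square integrable functions on a finite measure space\<close>

definition L2 :: "'a measure \<Rightarrow> ('a \<Rightarrow> complex) set"
  where "L2 M = {f \<in> borel_measurable M. integrable M (\<lambda>x. (cmod (f x))\<^sup>2)}"

definition l2_inner :: "'a measure \<Rightarrow> ('a \<Rightarrow> complex) \<Rightarrow> ('a \<Rightarrow> complex) \<Rightarrow> complex"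
  where "l2_inner M f g = (LINT x|M. f x * cnj (g x))"

definition l2_norm :: "'a measure \<Rightarrow> ('a \<Rightarrow> complex) \<Rightarrow> real"
  where "l2_norm M f = sqrt (LINT x|M. (cmod (f x))\<^sup>2)"

lemma L2_measurable: "f \<in> L2 M \<Longrightarrow> f \<in> borel_measurable M"
  and L2_integrable: "f \<in> L2 M \<Longrightarrow> integrable M (\<lambda>x. (cmod (f x))\<^sup>2)"
  by (auto simp: L2_def)

lemma l2_norm_nonneg: "0 \<le> l2_norm M f"
  by (simp add: l2_norm_def)

lemma l2_norm_sq: "(l2_norm M f)\<^sup>2 = (LINT x|M. (cmod (f x))\<^sup>2)"
  by (simp add: l2_norm_def)

lemma l2_inner_self: "l2_inner M f f = of_real ((l2_norm M f)\<^sup>2)"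
  unfolding l2_norm_sq l2_inner_def integral_complex_of_real[symmetric] complex_norm_square ..

lemma l2_norm_zero_imp_AE:
  assumes "f \<in> L2 M" "l2_norm M f = 0"
  shows "AE x in M. f x = 0"
proof -
  have "(LINT x|M. (cmod (f x))\<^sup>2) = 0" using assms(2) by (simp add: l2_norm_def)
  then have "AE x in M. (cmod (f x))\<^sup>2 = 0"
    using integral_nonneg_eq_0_iff_AE[OF L2_integrable[OF assms(1)]] by simp
  then show ?thesis by eventually_elim simp
qed

lemma L2_prod_integrable:
  assumes "f \<in> L2 M" "g \<in> L2 M"
  shows "integrable M (\<lambda>x. f x * g x)"
proof (rule Bochner_Integration.integrable_bound)
  show "integrable M (\<lambda>x. (cmod (f x))\<^sup>2 + (cmod (g x))\<^sup>2)"
    using assms by (auto simp: L2_def)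
  show "(\<lambda>x. f x * g x) \<in> borel_measurable M"
    using assms by (auto simp: L2_def)
  have "cmod (f x * g x) \<le> (cmod (f x))\<^sup>2 + (cmod (g x))\<^sup>2" for x
  proof -
    have "2 * (cmod (f x) * cmod (g x)) \<le> (cmod (f x))\<^sup>2 + (cmod (g x))\<^sup>2"
      using zero_le_power2[of "cmod (f x) - cmod (g x)"] by (simp add: power2_diff algebra_simps)
    moreover have "0 \<le> cmod (f x) * cmod (g x)" by simp
    ultimately show ?thesis unfolding norm_mult by linarith
  qed
  then show "AE x in M. norm (f x * g x) \<le> norm ((cmod (f x))\<^sup>2 + (cmod (g x))\<^sup>2)"
    by (intro AE_I2) (simp add: order_trans[OF _ abs_ge_self])
qed

lemma L2_cnj: "f \<in> L2 M \<Longrightarrow> (\<lambda>x. cnj (f x)) \<in> L2 M"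
  using measurable_compose[of f M borel cnj borel]
  by (auto simp: L2_def borel_measurable_continuous_onI continuous_intros)

lemma L2_inner_integrable:
  "f \<in> L2 M \<Longrightarrow> g \<in> L2 M \<Longrightarrow> integrable M (\<lambda>x. f x * cnj (g x))"
  by (rule L2_prod_integrable[OF _ L2_cnj])

lemma cmod_add_sq: "(cmod (a + b))\<^sup>2 = (cmod a)\<^sup>2 + 2 * Re (a * cnj b) + (cmod b)\<^sup>2"
  by (simp add: cmod_power2 power2_sum algebra_simps)

lemma L2_add:
  assumes "f \<in> L2 M" "g \<in> L2 M"
  shows "(\<lambda>x. f x + g x) \<in> L2 M"
  using assms integrable_Re[OF L2_inner_integrable[OF assms]]
  by (auto simp: L2_def cmod_add_sq simp del: times_complex.sel)

lemma L2_cmult: "f \<in> L2 M \<Longrightarrow> (\<lambda>x. c * f x) \<in> L2 M"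
  by (auto simp: L2_def norm_mult power_mult_distrib)

lemma L2_diff:
  assumes "f \<in> L2 M" "g \<in> L2 M"
  shows "(\<lambda>x. f x - g x) \<in> L2 M"
  using L2_add[OF assms(1) L2_cmult[OF assms(2), of "-1"]] by simp

lemma l2_inner_add_left:
  assumes "f \<in> L2 M" "g \<in> L2 M" "h \<in> L2 M"
  shows "l2_inner M (\<lambda>x. f x + g x) h = l2_inner M f h + l2_inner M g h"
  using L2_inner_integrable[OF assms(1,3)] L2_inner_integrable[OF assms(2,3)]
  by (simp add: l2_inner_def algebra_simps)

lemma l2_inner_diff_left:
  assumes "f \<in> L2 M" "g \<in> L2 M" "h \<in> L2 M"
  shows "l2_inner M (\<lambda>x. f x - g x) h = l2_inner M f h - l2_inner M g h"
  using L2_inner_integrable[OF assms(1,3)] L2_inner_integrable[OF assms(2,3)]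
  by (simp add: l2_inner_def algebra_simps)

lemma l2_inner_diff_right:
  assumes "f \<in> L2 M" "g \<in> L2 M" "h \<in> L2 M"
  shows "l2_inner M h (\<lambda>x. f x - g x) = l2_inner M h f - l2_inner M h g"
  using L2_inner_integrable[OF assms(3,1)] L2_inner_integrable[OF assms(3,2)]
  by (simp add: l2_inner_def algebra_simps)

lemma l2_inner_cmult_left: "l2_inner M (\<lambda>x. c * f x) h = c * l2_inner M f h"
  by (simp add: l2_inner_def mult.assoc)

lemma l2_inner_cmult_right: "l2_inner M h (\<lambda>x. c * f x) = cnj c * l2_inner M h f"
  by (simp add: l2_inner_def mult.left_commute)

lemma l2_inner_cnj: "l2_inner M g f = cnj (l2_inner M f g)"
  by (simp add: l2_inner_def mult.commute flip: Bochner_Integration.integral_cnj)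

lemma l2_norm_cmult: "l2_norm M (\<lambda>x. c * f x) = cmod c * l2_norm M f"
  by (simp add: l2_norm_def norm_mult power_mult_distrib real_sqrt_mult)

lemma l2_norm_add_sq:
  assumes "f \<in> L2 M" "g \<in> L2 M"
  shows "(l2_norm M (\<lambda>x. f x + g x))\<^sup>2
    = (l2_norm M f)\<^sup>2 + 2 * Re (l2_inner M f g) + (l2_norm M g)\<^sup>2"
proof -
  note int = assms[THEN L2_integrable] L2_inner_integrable[OF assms]
  show ?thesis
    unfolding l2_norm_sq cmod_add_sq l2_inner_def integral_Re[OF int(3), symmetric]
    using int integrable_Re[OF int(3)]
    by (simp del: times_complex.sel)
qed

lemma l2_norm_diff_commute: "l2_norm M (\<lambda>x. f x - g x) = l2_norm M (\<lambda>x. g x - f x)"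
  by (simp add: l2_norm_def norm_minus_commute)

text \<open>
  The form with absolute values under the integral also compares the \<open>L\<^sup>1\<close> norm with the \<open>L\<^sup>2\<close> norm
  on a finite measure space.
\<close>

lemma l2_cauchy_schwarz_abs:
  assumes f: "f \<in> L2 M" and g: "g \<in> L2 M"
  shows "(LINT x|M. cmod (f x * g x)) \<le> l2_norm M f * l2_norm M g"
proof -
  define I where "I = (LINT x|M. cmod (f x * g x))"
  define a where "a = l2_norm M f"
  define b where "b = l2_norm M g"
  have ab: "0 \<le> a" "0 \<le> b" by (auto simp: a_def b_def l2_norm_nonneg)
  have int: "integrable M (\<lambda>x. cmod (f x * g x))"
    using L2_prod_integrable[OF f g] by (rule integrable_norm)
  \<comment> \<open>The inequality of arithmetic and geometric means with a weight \<open>t\<close>, integrated.\<close>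
  have amgm: "2 * I \<le> t * a\<^sup>2 + b\<^sup>2 / t" if "t > 0" for t
  proof -
    have pw: "2 * cmod (f x * g x) \<le> t * (cmod (f x))\<^sup>2 + (cmod (g x))\<^sup>2 / t" for x
    proof -
      have "0 \<le> (t * cmod (f x) - cmod (g x))\<^sup>2 / t" using that by simp
      also have "\<dots> = t * (cmod (f x))\<^sup>2 + (cmod (g x))\<^sup>2 / t - 2 * cmod (f x * g x)"
        using that by (simp add: norm_mult field_simps power2_eq_square)
      finally show ?thesis by simp
    qed
    have "2 * I = (LINT x|M. 2 * cmod (f x * g x))" by (simp add: I_def)
    also have "\<dots> \<le> (LINT x|M. t * (cmod (f x))\<^sup>2 + (cmod (g x))\<^sup>2 / t)"
      using int f g by (intro integral_mono pw) (auto simp: L2_def)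
    also have "\<dots> = t * a\<^sup>2 + b\<^sup>2 / t"
      using f g by (simp add: a_def b_def l2_norm_sq L2_def)
    finally show ?thesis .
  qed
  have "2 * I \<le> 2 * (a * b)"
  proof (rule tendsto_lowerbound)
    show "((\<lambda>e. (b + e) * a + (a + e) * b) \<longlongrightarrow> 2 * (a * b)) (at_right 0)"
      by (auto intro!: tendsto_eq_intros)
    show "\<forall>\<^sub>F e in at_right 0. 2 * I \<le> (b + e) * a + (a + e) * b"
    proof (rule eventually_at_rightI[of 0 1])
      fix e :: real assume e: "e \<in> {0<..<1}"
      have "2 * I \<le> (b + e) / (a + e) * a\<^sup>2 + b\<^sup>2 / ((b + e) / (a + e))"
        using ab e by (intro amgm) auto
      also have "(b + e) / (a + e) * a\<^sup>2 = (b + e) * a * (a / (a + e))"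
        by (simp add: power2_eq_square)
      also have "(b + e) * a * (a / (a + e)) \<le> (b + e) * a * 1"
        using ab e by (intro mult_left_mono) auto
      also have "b\<^sup>2 / ((b + e) / (a + e)) = (a + e) * b * (b / (b + e))"
        by (simp add: power2_eq_square)
      also have "(a + e) * b * (b / (b + e)) \<le> (a + e) * b * 1"
        using ab e by (intro mult_left_mono) auto
      finally show "2 * I \<le> (b + e) * a + (a + e) * b" by simp
    qed simp
  qed simp
  then show ?thesis by (simp add: I_def a_def b_def)
qed

lemma l2_cauchy_schwarz:
  assumes f: "f \<in> L2 M" and g: "g \<in> L2 M"
  shows "cmod (l2_inner M f g) \<le> l2_norm M f * l2_norm M g"
proof -
  have "cmod (l2_inner M f g) \<le> (LINT x|M. cmod (f x * cnj (g x)))"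
    unfolding l2_inner_def by (rule integral_norm_bound)
  also have "\<dots> \<le> l2_norm M f * l2_norm M (\<lambda>x. cnj (g x))"
    by (rule l2_cauchy_schwarz_abs[OF f L2_cnj[OF g]])
  finally show ?thesis by (simp add: l2_norm_def)
qed

lemma l2_norm_triangle:
  assumes f: "f \<in> L2 M" and g: "g \<in> L2 M"
  shows "l2_norm M (\<lambda>x. f x + g x) \<le> l2_norm M f + l2_norm M g"
proof (rule power2_le_imp_le)
  have "Re (l2_inner M f g) \<le> l2_norm M f * l2_norm M g"
    using complex_Re_le_cmod l2_cauchy_schwarz[OF f g] by (rule order_trans)
  then show "(l2_norm M (\<lambda>x. f x + g x))\<^sup>2 \<le> (l2_norm M f + l2_norm M g)\<^sup>2"
    by (simp add: l2_norm_add_sq[OF f g] power2_sum)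
qed (simp add: l2_norm_nonneg)

lemma l2_norm_abs_diff_le:
  assumes f: "f \<in> L2 M" and g: "g \<in> L2 M"
  shows "\<bar>l2_norm M f - l2_norm M g\<bar> \<le> l2_norm M (\<lambda>x. f x - g x)"
  using l2_norm_triangle[OF L2_diff[OF f g] g] l2_norm_triangle[OF L2_diff[OF g f] f]
  by (simp add: l2_norm_diff_commute[of M g f])

lemma l2_norm_tendsto:
  assumes f: "\<And>n. f n \<in> L2 M" and g: "g \<in> L2 M"
    and lim: "(\<lambda>n. l2_norm M (\<lambda>x. f n x - g x)) \<longlonglongrightarrow> 0"
  shows "(\<lambda>n. l2_norm M (f n)) \<longlonglongrightarrow> l2_norm M g"
proof -
  have "(\<lambda>n. l2_norm M (f n) - l2_norm M g) \<longlonglongrightarrow> 0"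
    by (rule Lim_null_comparison[OF _ lim]) (simp add: l2_norm_abs_diff_le f g)
  then show ?thesis by (simp add: LIM_zero_iff)
qed

lemma l2_inner_tendsto:
  assumes f: "\<And>n. f n \<in> L2 M" and g: "g \<in> L2 M" and h: "h \<in> L2 M"
    and lim: "(\<lambda>n. l2_norm M (\<lambda>x. f n x - g x)) \<longlonglongrightarrow> 0"
  shows "(\<lambda>n. l2_inner M (f n) h) \<longlonglongrightarrow> l2_inner M g h"
proof -
  have "(\<lambda>n. l2_inner M (f n) h - l2_inner M g h) \<longlonglongrightarrow> 0"
  proof (rule Lim_null_comparison)
    show "\<forall>\<^sub>F n in sequentially. norm (l2_inner M (f n) h - l2_inner M g h)
        \<le> l2_norm M (\<lambda>x. f n x - g x) * l2_norm M h"
      by (simp add: l2_inner_diff_left[OF f g h, symmetric] l2_cauchy_schwarz L2_diff f g h)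
    show "(\<lambda>n. l2_norm M (\<lambda>x. f n x - g x) * l2_norm M h) \<longlonglongrightarrow> 0"
      using tendsto_mult_left_zero[OF lim] by simp
  qed
  then show ?thesis by (simp add: LIM_zero_iff)
qed

text \<open>
  By Fatou's lemma, norm bounds survive almost everywhere limits. This identifies the limit in the
  Riesz--Fischer theorem, and it later shows that the Gauss--Bargmann transform of every square integrable function lies in the Fock space.
\<close>

lemma L2_fatou:
  assumes f: "\<And>n. f n \<in> L2 M" and g: "g \<in> borel_measurable M"
    and lim: "AE x in M. (\<lambda>n. f n x) \<longlonglongrightarrow> g x"
    and bound: "\<forall>\<^sub>F n in sequentially. l2_norm M (f n) \<le> C"
  shows "g \<in> L2 M" "l2_norm M g \<le> C"
proof -
  obtain n where "l2_norm M (f n) \<le> C"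
    using bound eventually_sequentially by auto
  then have C: "0 \<le> C" using l2_norm_nonneg order_trans by blast
  note [measurable] = g L2_measurable[OF f]
  have "(\<integral>\<^sup>+x. ennreal ((cmod (g x))\<^sup>2) \<partial>M)
      = (\<integral>\<^sup>+x. liminf (\<lambda>n. ennreal ((cmod (f n x))\<^sup>2)) \<partial>M)"
  proof (rule nn_integral_cong_AE, use lim in eventually_elim)
    case (elim x)
    then have "(\<lambda>n. ennreal ((cmod (f n x))\<^sup>2)) \<longlonglongrightarrow> ennreal ((cmod (g x))\<^sup>2)"
      by (intro tendsto_intros)
    then show ?case by (intro lim_imp_Liminf[symmetric]) auto
  qed
  also have "\<dots> \<le> liminf (\<lambda>n. \<integral>\<^sup>+x. ennreal ((cmod (f n x))\<^sup>2) \<partial>M)"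
    by (rule nn_integral_liminf) measurable
  also have "\<dots> = liminf (\<lambda>n. ennreal ((l2_norm M (f n))\<^sup>2))"
    using f by (simp add: l2_norm_sq nn_integral_eq_integral L2_integrable)
  also have "\<dots> \<le> liminf (\<lambda>n. ennreal (C\<^sup>2))"
    by (rule Liminf_mono, rule eventually_mono[OF bound])
      (auto intro!: ennreal_leI power_mono l2_norm_nonneg)
  finally have le: "(\<integral>\<^sup>+x. ennreal ((cmod (g x))\<^sup>2) \<partial>M) \<le> ennreal (C\<^sup>2)"
    by (simp add: Liminf_const)
  then have int: "integrable M (\<lambda>x. (cmod (g x))\<^sup>2)"
    by (auto simp: integrable_iff_bounded intro: order_le_less_trans)
  then show "g \<in> L2 M" using g by (simp add: L2_def)
  have "(l2_norm M g)\<^sup>2 \<le> C\<^sup>2"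
    using le int C by (simp add: l2_norm_sq nn_integral_eq_integral)
  then show "l2_norm M g \<le> C" using C by (rule power2_le_imp_le)
qed

context finite_measure
begin

lemma L2_const: "(\<lambda>x. c) \<in> L2 M"
  by (simp add: L2_def)

lemma integral_cmod_le_l2_norm:
  assumes "f \<in> L2 M"
  shows "(LINT x|M. cmod (f x)) \<le> l2_norm M f * l2_norm M (\<lambda>x. 1)"
  using l2_cauchy_schwarz_abs[OF assms L2_const[of 1]] by simp

lemma L2_imp_integrable: "f \<in> L2 M \<Longrightarrow> integrable M f"
  using L2_prod_integrable[OF _ L2_const[of 1]] by simp

text \<open>
  The Riesz--Fischer theorem. A subsequence with increments of norm at most \<open>2\<^sup>-\<^sup>n\<close> has an
  absolutely summable sequence of increments almost everywhere, because the \<open>L\<^sup>1\<close> norm is dominated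
  by the \<open>L\<^sup>2\<close> norm on a finite measure space; Fatou's lemma identifies its limit as the limit in
  norm.
\<close>

lemma L2_complete:
  assumes f: "\<And>n. f n \<in> L2 M"
    and cauchy: "\<And>e. e > 0 \<Longrightarrow> \<exists>N. \<forall>m\<ge>N. \<forall>n\<ge>N. l2_norm M (\<lambda>x. f m x - f n x) < e"
  shows "\<exists>g\<in>L2 M. (\<lambda>n. l2_norm M (\<lambda>x. f n x - g x)) \<longlonglongrightarrow> 0"
proof -
  have "\<exists>N. \<forall>m\<ge>N. \<forall>n\<ge>N. l2_norm M (\<lambda>x. f m x - f n x) < (1/2)^j" for j :: nat
    by (rule cauchy) simp
  then obtain N where N: "\<And>j m n. m \<ge> N j \<Longrightarrow> n \<ge> N j \<Longrightarrow> l2_norm M (\<lambda>x. f m x - f n x) < (1/2)^j"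
    by metis
  \<comment> \<open>Summing makes \<open>r\<close> monotone and keeps \<open>r j\<close> above \<open>N j\<close>.\<close>
  define r where "r j = (\<Sum>i\<le>j. N i)" for j
  have rN: "N j \<le> r j" for j unfolding r_def by (rule member_le_sum) auto
  have rmono: "r j \<le> r (Suc j)" for j by (simp add: r_def)
  have rge: "j \<le> k \<Longrightarrow> N j \<le> r k" for j k
    using rN[of j] lift_Suc_mono_le[of r j k] rmono by (meson order_trans)
  define u where "u j x = f (r (Suc j)) x - f (r j) x" for j x
  have u: "u j \<in> L2 M" for j unfolding u_def by (intro L2_diff f)
  have un: "l2_norm M (u j) \<le> (1/2)^j" for j
    unfolding u_def using N[of j "r (Suc j)" "r j"] rge by (simp add: less_imp_le)
  note [measurable] = L2_measurable[OF f] L2_measurable[OF u]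
  have "AE x in M. summable (\<lambda>j. cmod (u j x))"
  proof -
    define A where "A = l2_norm M (\<lambda>x. 1)"
    have "(\<integral>\<^sup>+x. (\<Sum>j. ennreal (cmod (u j x))) \<partial>M) = (\<Sum>j. \<integral>\<^sup>+x. ennreal (cmod (u j x)) \<partial>M)"
      by (rule nn_integral_suminf) measurable
    also have "\<dots> = (\<Sum>j. ennreal (LINT x|M. cmod (u j x)))"
      using L2_imp_integrable[OF u] by (simp add: nn_integral_eq_integral)
    also have "\<dots> \<le> (\<Sum>j. ennreal ((1/2)^j * A))"
    proof (intro suminf_le ennreal_leI allI)
      fix j
      have "(LINT x|M. cmod (u j x)) \<le> l2_norm M (u j) * A"
        unfolding A_def by (rule integral_cmod_le_l2_norm[OF u])
      also have "\<dots> \<le> (1/2)^j * A"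
        by (intro mult_right_mono un) (simp add: A_def l2_norm_nonneg)
      finally show "(LINT x|M. cmod (u j x)) \<le> (1/2)^j * A" .
    qed auto
    also have "\<dots> < \<infinity>"
      by (subst suminf_ennreal2)
        (auto simp: A_def l2_norm_nonneg intro!: summable_mult2 summable_geometric)
    finally have "AE x in M. (\<Sum>j. ennreal (cmod (u j x))) \<noteq> \<infinity>"
      by (intro nn_integral_noteq_infinite) auto
    then show ?thesis
      by eventually_elim (auto intro!: summable_suminf_not_top)
  qed
  then have conv: "AE x in M. convergent (\<lambda>j. f (r j) x)"
  proof eventually_elim
    case (elim x)
    then have "summable (\<lambda>j. u j x)" by (rule summable_norm_cancel)
    then have "convergent (\<lambda>n. \<Sum>j<n. u j x)" by (simp add: summable_iff_convergent)
    then have "convergent (\<lambda>n. (f (r n) x - f (r 0) x) + f (r 0) x)"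
      unfolding u_def sum_lessThan_telescope[of "\<lambda>j. f (r j) x"]
      by (intro convergent_add convergent_const)
    then show ?case by simp
  qed
  define g where "g x = lim (\<lambda>j. f (r j) x)" for x
  have [measurable]: "g \<in> borel_measurable M"
    unfolding g_def by measurable
  have lim: "AE x in M. (\<lambda>j. f (r j) x) \<longlonglongrightarrow> g x"
    using conv by eventually_elim (simp add: g_def convergent_LIMSEQ_iff)
  have close: "(\<lambda>x. f m x - g x) \<in> L2 M \<and> l2_norm M (\<lambda>x. f m x - g x) \<le> (1/2)^j"
    if "m \<ge> N j" for m j
  proof -
    have "AE x in M. (\<lambda>k. f m x - f (r k) x) \<longlonglongrightarrow> f m x - g x"
      using lim by eventually_elim (intro tendsto_intros)
    moreover have "\<forall>\<^sub>F k in sequentially. l2_norm M (\<lambda>x. f m x - f (r k) x) \<le> (1/2)^j"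
      using eventually_ge_at_top[of j]
      by eventually_elim (use N that rge in \<open>blast intro: less_imp_le\<close>)
    ultimately show ?thesis
      using L2_fatou[of "\<lambda>k x. f m x - f (r k) x" M "\<lambda>x. f m x - g x" "(1/2)^j"]
        L2_diff[OF f f] by auto
  qed
  have "g \<in> L2 M"
    using L2_diff[OF f[of "N 0"] conjunct1[OF close[of 0 "N 0"]]] by simp
  moreover have "(\<lambda>n. l2_norm M (\<lambda>x. f n x - g x)) \<longlonglongrightarrow> 0"
  proof (rule LIMSEQ_I)
    fix e :: real assume "0 < e"
    then obtain j where j: "(1/2)^j < e" using real_arch_pow_inv[of e "1/2"] by auto
    have "norm (l2_norm M (\<lambda>x. f n x - g x) - 0) < e" if "n \<ge> N j" for n
      using close[OF that] j by (simp add: l2_norm_nonneg)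
    then show "\<exists>no. \<forall>n\<ge>no. norm (l2_norm M (\<lambda>x. f n x - g x) - 0) < e" by blast
  qed
  ultimately show ?thesis by blast
qed

text \<open>
  A sequence in a midpoint convex set \<open>K\<close> whose norms tend to their infimum \<open>d\<close> is Cauchy by the
  parallelogram law. Its limit \<open>g\<close> need not lie in \<open>K\<close>, but it is orthogonal to every direction \<open>h\<close>
  along which \<open>K\<close> is invariant, because \<open>\<parallel>g + c h\<parallel> \<ge> d = \<parallel>g\<parallel>\<close> for all \<open>c\<close>. Both the Riesz
  representation theorem and the density criterion below are instances.
\<close>

lemma L2_minimizing_sequence:
  assumes K: "K \<subseteq> L2 M" "K \<noteq> {}"
    and mid: "\<And>f g. f \<in> K \<Longrightarrow> g \<in> K \<Longrightarrow> (\<lambda>x. (f x + g x) / 2) \<in> K"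
  obtains k g where "\<And>n. k n \<in> K" "g \<in> L2 M" "(\<lambda>n. l2_norm M (\<lambda>x. k n x - g x)) \<longlonglongrightarrow> 0"
    "\<And>h. h \<in> L2 M \<Longrightarrow> (\<And>f c. f \<in> K \<Longrightarrow> (\<lambda>x. f x + c * h x) \<in> K) \<Longrightarrow> l2_inner M g h = 0"
proof -
  define d where "d = (INF f\<in>K. l2_norm M f)"
  have bdd: "bdd_below (l2_norm M ` K)"
    by (rule bdd_belowI[of _ 0]) (auto simp: l2_norm_nonneg)
  have d: "f \<in> K \<Longrightarrow> d \<le> l2_norm M f" for f
    unfolding d_def by (rule cINF_lower[OF bdd])
  have d0: "0 \<le> d" unfolding d_def by (rule cINF_greatest[OF K(2)]) (simp add: l2_norm_nonneg)
  have "\<exists>f\<in>K. l2_norm M f < d + inverse (Suc n)" for n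
    using cINF_less_iff[OF K(2) bdd, of "d + inverse (Suc n)"] by (simp add: d_def)
  then obtain k where kK: "\<And>n. k n \<in> K" and kd: "\<And>n. l2_norm M (k n) < d + inverse (Suc n)"
    by metis
  have kL: "k n \<in> L2 M" for n using kK K(1) by blast
  have kn: "(\<lambda>n. l2_norm M (k n)) \<longlonglongrightarrow> d"
  proof (rule tendsto_sandwich[of "\<lambda>_. d"])
    show "(\<lambda>n. d + inverse (real (Suc n))) \<longlonglongrightarrow> d"
      using tendsto_add[OF tendsto_const LIMSEQ_inverse_real_of_nat, of d] by simp
  qed (use d kK less_imp_le[OF kd] in \<open>auto intro!: always_eventually simp del: of_nat_Suc\<close>)
  have par: "(l2_norm M (\<lambda>x. k m x - k n x))\<^sup>2
      \<le> 2 * (l2_norm M (k m))\<^sup>2 + 2 * (l2_norm M (k n))\<^sup>2 - 4 * d\<^sup>2" for m n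
  proof -
    have "d \<le> l2_norm M (\<lambda>x. (k m x + k n x) / 2)" by (rule d[OF mid[OF kK kK]])
    also have "\<dots> = l2_norm M (\<lambda>x. k m x + k n x) / 2"
      using l2_norm_cmult[of M "1/2" "\<lambda>x. k m x + k n x"] by simp
    finally have "(2 * d)\<^sup>2 \<le> (l2_norm M (\<lambda>x. k m x + k n x))\<^sup>2"
      using d0 by (intro power_mono) auto
    moreover have "(l2_norm M (\<lambda>x. k m x - k n x))\<^sup>2
        = (l2_norm M (k m))\<^sup>2 - 2 * Re (l2_inner M (k m) (k n)) + (l2_norm M (k n))\<^sup>2"
      using l2_norm_add_sq[OF kL[of m] L2_cmult[OF kL[of n], of "-1"]]
      by (simp add: l2_inner_cmult_right[of _ _ "-1", simplified] l2_norm_cmult[of _ "-1", simplified])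
    ultimately show ?thesis
      by (simp add: l2_norm_add_sq[OF kL kL] power_mult_distrib)
  qed
  have "\<exists>N. \<forall>m\<ge>N. \<forall>n\<ge>N. l2_norm M (\<lambda>x. k m x - k n x) < e" if "e > 0" for e
  proof -
    have "(\<lambda>n. 2 * (l2_norm M (k n))\<^sup>2 - 2 * d\<^sup>2) \<longlonglongrightarrow> 2 * d\<^sup>2 - 2 * d\<^sup>2"
      by (intro tendsto_intros kn)
    then have "\<forall>\<^sub>F n in sequentially. 2 * (l2_norm M (k n))\<^sup>2 - 2 * d\<^sup>2 < e\<^sup>2 / 2"
      using that by (intro order_tendstoD(2)[where a="e\<^sup>2/2"]) auto
    then obtain N where N: "\<And>n. n \<ge> N \<Longrightarrow> 2 * (l2_norm M (k n))\<^sup>2 - 2 * d\<^sup>2 < e\<^sup>2 / 2"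
      by (auto simp: eventually_sequentially)
    have "l2_norm M (\<lambda>x. k m x - k n x) < e" if "m \<ge> N" "n \<ge> N" for m n
    proof (rule power2_less_imp_less)
      show "(l2_norm M (\<lambda>x. k m x - k n x))\<^sup>2 < e\<^sup>2"
        using par[of m n] N[OF that(1)] N[OF that(2)] by linarith
    qed (use \<open>e > 0\<close> in simp)
    then show ?thesis by blast
  qed
  then obtain g where g: "g \<in> L2 M" and lim: "(\<lambda>n. l2_norm M (\<lambda>x. k n x - g x)) \<longlonglongrightarrow> 0"
    using L2_complete[of k] kL by blast
  have gd: "l2_norm M g = d"
    using LIMSEQ_unique[OF l2_norm_tendsto[OF kL g lim] kn] .
  have "l2_inner M g h = 0"
    if h: "h \<in> L2 M" and inv: "\<And>f c. f \<in> K \<Longrightarrow> (\<lambda>x. f x + c * h x) \<in> K" for h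
  proof -
    have ge: "d \<le> l2_norm M (\<lambda>x. g x + c * h x)" for c
    proof (rule LIMSEQ_le_const)
      show "(\<lambda>n. l2_norm M (\<lambda>x. k n x + c * h x)) \<longlonglongrightarrow> l2_norm M (\<lambda>x. g x + c * h x)"
        using lim by (intro l2_norm_tendsto L2_add kL g L2_cmult h) simp
    qed (use d inv kK in blast)
    have quad: "0 \<le> 2 * Re (cnj c * l2_inner M g h) + (cmod c)\<^sup>2 * (l2_norm M h)\<^sup>2" for c
    proof -
      have "d\<^sup>2 \<le> (l2_norm M (\<lambda>x. g x + c * h x))\<^sup>2"
        using ge d0 by (intro power_mono)
      then show ?thesis
        unfolding l2_norm_add_sq[OF g L2_cmult[OF h]]
        by (simp add: gd l2_inner_cmult_right l2_norm_cmult power_mult_distrib)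
    qed
    define w where "w = l2_inner M g h"
    define B where "B = (l2_norm M h)\<^sup>2 + 1"
    have B: "B > 0" "(l2_norm M h)\<^sup>2 \<le> B" by (auto simp: B_def add_nonneg_pos)
    \<comment> \<open>Moving from \<open>g\<close> against \<open>\<langle>g, h\<rangle>\<close> by a short enough step would decrease the norm.\<close>
    have "0 \<le> 2 * Re (cnj (- w / B) * w) + (cmod (- w / B))\<^sup>2 * (l2_norm M h)\<^sup>2"
      using quad[of "- w / B"] by (simp add: w_def)
    also have "\<dots> \<le> 2 * Re (cnj (- w / B) * w) + (cmod (- w / B))\<^sup>2 * B"
      using B by (intro add_left_mono mult_left_mono) auto
    also have "cnj (- w / B) * w = of_real (- (cmod w)\<^sup>2 / B)"
      using complex_norm_square[of w] by (simp add: mult.commute)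
    also have "2 * Re (of_real (- (cmod w)\<^sup>2 / B)) + (cmod (- w / B))\<^sup>2 * B = - (cmod w)\<^sup>2 / B"
      using B by (simp add: norm_divide power_divide power2_eq_square)
    finally have "(cmod w)\<^sup>2 \<le> 0" using B by (simp add: field_simps)
    then show ?thesis by (simp add: w_def)
  qed
  with kK g lim show thesis by (rule that)
qed

text \<open>
  The element of least norm in the hyperplane \<open>\<phi> = 1\<close> is orthogonal to the kernel of \<open>\<phi>\<close>, because
  the hyperplane is invariant under the kernel; so it represents \<open>\<phi>\<close> after rescaling.
\<close>

lemma L2_riesz_representation:
  assumes add: "\<And>f g. f \<in> L2 M \<Longrightarrow> g \<in> L2 M \<Longrightarrow> \<phi> (\<lambda>x. f x + g x) = \<phi> f + \<phi> g"
    and cmult: "\<And>c f. f \<in> L2 M \<Longrightarrow> \<phi> (\<lambda>x. c * f x) = c * \<phi> f"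
    and bound: "\<And>f. f \<in> L2 M \<Longrightarrow> cmod (\<phi> f) \<le> C * l2_norm M f"
  shows "\<exists>g\<in>L2 M. \<forall>f\<in>L2 M. \<phi> f = l2_inner M f g"
proof (cases "\<forall>f\<in>L2 M. \<phi> f = 0")
  case True
  then show ?thesis
    using L2_const[of 0] by (intro bexI[of _ "\<lambda>x. 0"]) (auto simp: l2_inner_def)
next
  case False
  then obtain f0 where f0: "f0 \<in> L2 M" "\<phi> f0 \<noteq> 0" by auto
  define K where "K = {f \<in> L2 M. \<phi> f = 1}"
  have "(\<lambda>x. 1 / \<phi> f0 * f0 x) \<in> K"
    using f0 L2_cmult[OF f0(1), of "1 / \<phi> f0"] cmult[OF f0(1), of "1 / \<phi> f0"] by (simp add: K_def)
  moreover have "K \<subseteq> L2 M" by (auto simp: K_def)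
  moreover have "(\<lambda>x. (f x + g x) / 2) \<in> K" if "f \<in> K" "g \<in> K" for f g
  proof -
    have fg: "f \<in> L2 M" "g \<in> L2 M" "\<phi> f = 1" "\<phi> g = 1" using that by (auto simp: K_def)
    show ?thesis
      using L2_cmult[OF L2_add[OF fg(1,2)], of "1/2"] cmult[OF L2_add[OF fg(1,2)], of "1/2"]
      by (simp add: K_def add[OF fg(1,2)] fg(3,4))
  qed
  ultimately obtain k g where kK: "\<And>n. k n \<in> K" and g: "g \<in> L2 M"
    and lim: "(\<lambda>n. l2_norm M (\<lambda>x. k n x - g x)) \<longlonglongrightarrow> 0"
    and orth: "\<And>h. h \<in> L2 M \<Longrightarrow> (\<And>f c. f \<in> K \<Longrightarrow> (\<lambda>x. f x + c * h x) \<in> K) \<Longrightarrow> l2_inner M g h = 0"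
    using L2_minimizing_sequence[of K] by blast
  have diff: "\<phi> (\<lambda>x. f x - h x) = \<phi> f - \<phi> h" if "f \<in> L2 M" "h \<in> L2 M" for f h
    using add[OF that(1) L2_cmult[OF that(2), of "-1"]] cmult[OF that(2), of "-1"] by simp
  have "(\<lambda>n. 1 - \<phi> g) \<longlonglongrightarrow> 0"
  proof (rule Lim_null_comparison)
    show "(\<lambda>n. C * l2_norm M (\<lambda>x. k n x - g x)) \<longlonglongrightarrow> 0"
      using tendsto_mult_right_zero[OF lim] by simp
    have "cmod (1 - \<phi> g) \<le> C * l2_norm M (\<lambda>x. k n x - g x)" for n
      using kK[of n] bound[OF L2_diff[of "k n" M g]] g by (simp add: K_def diff)
    then show "\<forall>\<^sub>F n in sequentially. norm (1 - \<phi> g) \<le> C * l2_norm M (\<lambda>x. k n x - g x)" by simp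
  qed
  then have g1: "\<phi> g = 1" by (simp add: LIMSEQ_const_iff)
  have orth0: "l2_inner M h g = 0" if h: "h \<in> L2 M" "\<phi> h = 0" for h
  proof -
    have "l2_inner M g h = 0"
      by (rule orth) (use h in \<open>auto simp: K_def add cmult L2_add L2_cmult\<close>)
    then show ?thesis by (subst l2_inner_cnj) simp
  qed
  define G where "G = (l2_norm M g)\<^sup>2"
  have "G \<noteq> 0" using bound[OF g] g1 by (auto simp: G_def)
  have "\<phi> f = l2_inner M f (\<lambda>x. of_real (1 / G) * g x)" if f: "f \<in> L2 M" for f
  proof -
    have "l2_inner M (\<lambda>x. f x - \<phi> f * g x) g = 0"
      by (rule orth0) (simp_all add: L2_diff L2_cmult f g diff cmult g1)
    then have "l2_inner M f g = \<phi> f * of_real G"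
      by (simp add: l2_inner_diff_left L2_cmult f g l2_inner_cmult_left l2_inner_self G_def)
    then show ?thesis using \<open>G \<noteq> 0\<close> by (simp only: l2_inner_cmult_right) simp
  qed
  then show ?thesis using L2_cmult[OF g] by blast
qed

text \<open>
  Applied to the coset \<open>f + D\<close>, the minimizing sequence converges to a function orthogonal to \<open>D\<close>,
  hence to zero.
\<close>

lemma L2_dense_if_orthogonal_trivial:
  assumes D: "D \<subseteq> L2 M" "(\<lambda>x. 0) \<in> D"
    and D_add: "\<And>p q. p \<in> D \<Longrightarrow> q \<in> D \<Longrightarrow> (\<lambda>x. p x + q x) \<in> D"
    and D_cmult: "\<And>c p. p \<in> D \<Longrightarrow> (\<lambda>x. c * p x) \<in> D"
    and triv: "\<And>g. g \<in> L2 M \<Longrightarrow> (\<And>p. p \<in> D \<Longrightarrow> l2_inner M g p = 0) \<Longrightarrow> AE x in M. g x = 0"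
    and f: "f \<in> L2 M"
  shows "\<exists>p. (\<forall>n. p n \<in> D) \<and> (\<lambda>n. l2_norm M (\<lambda>x. p n x - f x)) \<longlonglongrightarrow> 0"
proof -
  define K where "K = {k. (\<lambda>x. f x - k x) \<in> D}"
  have "K \<subseteq> L2 M"
  proof
    fix k assume "k \<in> K"
    then have "(\<lambda>x. f x - k x) \<in> L2 M"
      using D(1) by (auto simp: K_def)
    from L2_diff[OF f this] show "k \<in> L2 M" by simp
  qed
  moreover have "f \<in> K" using D(2) by (simp add: K_def)
  moreover have "(\<lambda>x. (k x + l x) / 2) \<in> K" if "k \<in> K" "l \<in> K" for k l
  proof -
    have "(\<lambda>x. 1/2 * ((f x - k x) + (f x - l x))) \<in> D"
      using that unfolding K_def by (intro D_cmult D_add) auto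
    then show ?thesis by (simp add: K_def diff_divide_distrib add_divide_distrib algebra_simps)
  qed
  ultimately obtain k g where kK: "\<And>n. k n \<in> K" and g: "g \<in> L2 M"
    and lim: "(\<lambda>n. l2_norm M (\<lambda>x. k n x - g x)) \<longlonglongrightarrow> 0"
    and orth: "\<And>h. h \<in> L2 M \<Longrightarrow> (\<And>f c. f \<in> K \<Longrightarrow> (\<lambda>x. f x + c * h x) \<in> K) \<Longrightarrow> l2_inner M g h = 0"
    using L2_minimizing_sequence[of K] by blast
  have "AE x in M. g x = 0"
  proof (rule triv[OF g])
    fix p assume p: "p \<in> D"
    show "l2_inner M g p = 0"
    proof (rule orth)
      fix k c assume "k \<in> K"
      then have "(\<lambda>x. (f x - k x) + (- c) * p x) \<in> D"
        using p by (intro D_add D_cmult) (auto simp: K_def)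
      then show "(\<lambda>x. k x + c * p x) \<in> K" by (simp add: K_def algebra_simps)
    qed (use p D(1) in blast)
  qed
  then have "AE x in M. (cmod ((f x - k n x) - f x))\<^sup>2 = (cmod (k n x - g x))\<^sup>2" for n
    by eventually_elim simp
  then have "(LINT x|M. (cmod ((f x - k n x) - f x))\<^sup>2) = (LINT x|M. (cmod (k n x - g x))\<^sup>2)" for n
    using L2_diff[OF _ g, of "k n"] L2_diff[OF L2_diff[OF f, of "k n"] f] kK[of n] \<open>K \<subseteq> L2 M\<close>
    by (intro integral_cong_AE) (auto dest: L2_integrable borel_measurable_integrable)
  then have "l2_norm M (\<lambda>x. (f x - k n x) - f x) = l2_norm M (\<lambda>x. k n x - g x)" for n
    by (simp add: l2_norm_def)
  then show ?thesis
    using kK lim by (intro exI[of _ "\<lambda>n x. f x - k n x"]) (simp add: K_def)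
qed

end


section \<open>Gaussian integrals\<close>

text \<open>
  The imaginary part of \<open>c\<close> is the characteristic function of the standard normal distribution, the
  real part is an affine change of variables.
\<close>

lemma gaussian_integral_real:
  fixes s :: real and c :: complex
  assumes s: "s > 0"
  shows "has_bochner_integral lborel (\<lambda>x::real. exp (of_real (- s * x\<^sup>2) + c * of_real x))
    (of_real (sqrt (pi / s)) * exp (c\<^sup>2 / (4 * of_real s)))"
proof -
  define a b where "a = Re c" and "b = Im c"
  have c: "c = of_real a + \<i> * of_real b" by (simp add: a_def b_def complex_eq)
  define r where "r = sqrt (2 * s)"
  have r: "r > 0" "r\<^sup>2 = 2 * s" using s by (auto simp: r_def)
  define t where "t = b / r"
  have "integrable lborel (\<lambda>x. std_normal_density x *\<^sub>R iexp (t * x))"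
  proof (rule Bochner_Integration.integrable_bound)
    show "integrable lborel std_normal_density"
      using integrable_normal_density[of 1 0] by simp
  qed (auto simp: norm_mult)
  moreover have "(LINT x|lborel. std_normal_density x *\<^sub>R iexp (t * x)) = of_real (exp (- t\<^sup>2 / 2))"
    using fun_cong[OF char_std_normal_distribution, of t]
    by (simp add: char_def integral_density)
  ultimately have "has_bochner_integral lborel (\<lambda>x. std_normal_density x *\<^sub>R iexp (t * x))
      (of_real (exp (- t\<^sup>2 / 2)))"
    by (simp add: has_bochner_integral_iff)
  \<comment> \<open>Rescale to the variance \<open>1 / (2 s)\<close> and move the centre to \<open>a / (2 s)\<close>: this
      completes the square for the real part of \<open>c\<close>.\<close>
  then have "has_bochner_integral lborel
      (\<lambda>x. std_normal_density (- a / r + r * x) *\<^sub>R iexp (t * (- a / r + r * x)))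
      (of_real (exp (- t\<^sup>2 / 2)) /\<^sub>R \<bar>r\<bar>)"
    using r by (subst (asm) lborel_has_bochner_integral_real_affine_iff[of r _ _ "- a / r"]) auto
  then have "has_bochner_integral lborel
      (\<lambda>x. (of_real (sqrt (2 * pi)) * exp (of_real (a\<^sup>2 / (4 * s)) + \<i> * of_real (a * b / (2 * s)))) *
        (std_normal_density (- a / r + r * x) *\<^sub>R iexp (t * (- a / r + r * x))))
      ((of_real (sqrt (2 * pi)) * exp (of_real (a\<^sup>2 / (4 * s)) + \<i> * of_real (a * b / (2 * s)))) *
        (of_real (exp (- t\<^sup>2 / 2)) /\<^sub>R \<bar>r\<bar>))"
    by (rule has_bochner_integral_mult_right)
  also have "(\<lambda>x. (of_real (sqrt (2 * pi)) * exp (of_real (a\<^sup>2 / (4 * s)) + \<i> * of_real (a * b / (2 * s)))) *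
        (std_normal_density (- a / r + r * x) *\<^sub>R iexp (t * (- a / r + r * x))))
      = (\<lambda>x. exp (of_real (- s * x\<^sup>2) + c * of_real x))"
  proof
    fix x :: real
    have e1: "- (- a / r + r * x)\<^sup>2 / 2 = - a\<^sup>2 / (4 * s) - s * x\<^sup>2 + a * x"
    proof -
      have "- (- a / r + r * x)\<^sup>2 / 2 = - a\<^sup>2 / (2 * r\<^sup>2) - r\<^sup>2 * x\<^sup>2 / 2 + a * x"
        using r(1) by (simp add: power2_eq_square field_simps)
      then show ?thesis by (simp add: r(2))
    qed
    have e2: "t * (- a / r + r * x) = - a * b / (2 * s) + b * x"
    proof -
      have "t * (- a / r + r * x) = - a * b / r\<^sup>2 + b * x"
        using r(1) by (simp add: t_def power2_eq_square field_simps)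
      then show ?thesis by (simp add: r(2))
    qed
    have "(of_real (sqrt (2 * pi)) * exp (of_real (a\<^sup>2 / (4 * s)) + \<i> * of_real (a * b / (2 * s)))) *
        (std_normal_density (- a / r + r * x) *\<^sub>R iexp (t * (- a / r + r * x)))
      = exp (of_real (a\<^sup>2 / (4 * s)) + \<i> * of_real (a * b / (2 * s))) *
        (exp (of_real (- a\<^sup>2 / (4 * s) - s * x\<^sup>2 + a * x)) * exp (\<i> * of_real (- a * b / (2 * s) + b * x)))"
    proof -
      have "sqrt (2 * pi) * std_normal_density (- a / r + r * x) = exp (- a\<^sup>2 / (4 * s) - s * x\<^sup>2 + a * x)"
        unfolding std_normal_density_def e1 by simp
      then have Pd: "of_real (sqrt (2 * pi)) * of_real (std_normal_density (- a / r + r * x))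
          = exp (complex_of_real (- a\<^sup>2 / (4 * s) - s * x\<^sup>2 + a * x))"
        by (simp only: exp_of_real of_real_mult[symmetric])
      have alg: "P * d = e \<Longrightarrow> P * E * (d * w) = E * (e * w)" for P E d w e :: complex
        by (erule subst) (simp only: mult_ac)
      show ?thesis unfolding e2 scaleR_conv_of_real by (rule alg[OF Pd])
    qed
    also have "\<dots> = exp (of_real (- s * x\<^sup>2) + c * of_real x)"
    proof -
      have "of_real (a\<^sup>2 / (4 * s)) + \<i> * of_real (a * b / (2 * s)) +
          (of_real (- a\<^sup>2 / (4 * s) - s * x\<^sup>2 + a * x) + \<i> * of_real (- a * b / (2 * s) + b * x))
          = of_real (- s * x\<^sup>2) + c * of_real x"
        unfolding c complex_eq_iff by simp
      then show ?thesis by (simp only: exp_add[symmetric])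
    qed
    finally show "(of_real (sqrt (2 * pi)) * exp (of_real (a\<^sup>2 / (4 * s)) + \<i> * of_real (a * b / (2 * s)))) *
        (std_normal_density (- a / r + r * x) *\<^sub>R iexp (t * (- a / r + r * x)))
      = exp (of_real (- s * x\<^sup>2) + c * of_real x)" .
  qed
  also have "(of_real (sqrt (2 * pi)) * exp (of_real (a\<^sup>2 / (4 * s)) + \<i> * of_real (a * b / (2 * s)))) *
        (of_real (exp (- t\<^sup>2 / 2)) /\<^sub>R \<bar>r\<bar>)
      = of_real (sqrt (pi / s)) * exp (c\<^sup>2 / (4 * of_real s))"
  proof -
    have root: "sqrt (2 * pi) / r = sqrt (pi / s)"
      using s by (simp add: r_def real_sqrt_mult real_sqrt_divide)
    have t2: "- t\<^sup>2 / 2 = - b\<^sup>2 / (4 * s)"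
      by (simp add: t_def power_divide r(2))
    have "c\<^sup>2 = of_real (a\<^sup>2 - b\<^sup>2) + \<i> * of_real (2 * a * b)"
      unfolding c complex_eq_iff by (simp add: power2_eq_square)
    then have "c\<^sup>2 / (4 * of_real s) = of_real ((a\<^sup>2 - b\<^sup>2) / (4 * s)) + \<i> * of_real (2 * a * b / (4 * s))"
      by (simp add: add_divide_distrib)
    also have "\<dots> = of_real (a\<^sup>2 / (4 * s)) + \<i> * of_real (a * b / (2 * s)) + of_real (- b\<^sup>2 / (4 * s))"
      unfolding complex_eq_iff by (simp add: diff_divide_distrib)
    finally have c2: "c\<^sup>2 / (4 * of_real s) = \<dots>" .
    have E: "exp (of_real (a\<^sup>2 / (4 * s)) + \<i> * of_real (a * b / (2 * s))) * of_real (exp (- t\<^sup>2 / 2))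
        = exp (c\<^sup>2 / (4 * of_real s))"
      unfolding t2 c2 exp_add exp_of_real ..
    have q: "of_real (exp (- t\<^sup>2 / 2)) /\<^sub>R \<bar>r\<bar> = of_real (1 / r) * complex_of_real (exp (- t\<^sup>2 / 2))"
      using r(1) by (simp add: scaleR_conv_of_real field_simps)
    have root': "of_real (sqrt (2 * pi)) * of_real (1 / r) = complex_of_real (sqrt (pi / s))"
      unfolding root[symmetric] of_real_mult[symmetric] by simp
    have alg: "P * q = u \<Longrightarrow> E * e = v \<Longrightarrow> P * E * (q * e) = u * v" for P E q e u v :: complex
      by (simp add: mult.assoc mult.left_commute[of E])
    show ?thesis unfolding q by (rule alg[OF root' E])
  qed
  finally show ?thesis .
qed

lemma lborel_has_bochner_integral_prod:
  fixes g :: "'a::euclidean_space \<Rightarrow> real \<Rightarrow> complex"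
  assumes g: "\<And>b. b \<in> Basis \<Longrightarrow> has_bochner_integral lborel (g b) (I b)"
  shows "has_bochner_integral lborel (\<lambda>x::'a. \<Prod>b\<in>Basis. g b (x \<bullet> b)) (\<Prod>b\<in>Basis. I b)"
proof -
  interpret product_sigma_finite "\<lambda>_::'a. lborel :: real measure" ..
  have gi: "\<And>b. b \<in> Basis \<Longrightarrow> integrable lborel (g b)"
    and gI: "\<And>b. b \<in> Basis \<Longrightarrow> integral\<^sup>L lborel (g b) = I b"
    using g by (auto simp: has_bochner_integral_iff)
  let ?T = "\<lambda>f. \<Sum>b\<in>Basis. f b *\<^sub>R b :: 'a"
  have T: "?T \<in> measurable (\<Pi>\<^sub>M b\<in>Basis. lborel) borel" by measurable
  have gm: "(\<lambda>x::'a. \<Prod>b\<in>Basis. g b (x \<bullet> b)) \<in> borel_measurable borel"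
  proof (rule borel_measurable_prod)
    fix b :: 'a assume "b \<in> Basis"
    then have [measurable]: "g b \<in> borel_measurable borel"
      using borel_measurable_integrable[OF gi] by simp
    show "(\<lambda>x. g b (x \<bullet> b)) \<in> borel_measurable borel" by measurable
  qed
  have eq: "(\<Prod>b\<in>Basis. g b (?T f \<bullet> b)) = (\<Prod>b\<in>Basis. g b (f b))" for f
    by (intro prod.cong refl) simp
  show ?thesis
    unfolding has_bochner_integral_iff
    by (subst (1 2) lborel_eq)
      (simp add: integrable_distr_eq[OF T gm] integral_distr[OF T gm] eq
        product_integrable_prod product_integral_prod gi gI)
qed

lemma norm_sq_eq_sum_Basis: "(norm x)\<^sup>2 = (\<Sum>b\<in>Basis. (x \<bullet> b)\<^sup>2)"
  by (simp add: power2_norm_eq_inner euclidean_inner[of x x] flip: power2_eq_square)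

lemma gaussian_integral:
  fixes s :: real and c :: "'a::euclidean_space \<Rightarrow> complex"
  assumes s: "s > 0"
  shows "has_bochner_integral lborel
    (\<lambda>x::'a. exp (of_real (- s * (norm x)\<^sup>2) + (\<Sum>b\<in>Basis. c b * of_real (x \<bullet> b))))
    (of_real (sqrt (pi / s) ^ DIM('a)) * exp ((\<Sum>b\<in>Basis. (c b)\<^sup>2) / (4 * of_real s)))"
proof -
  have "has_bochner_integral lborel
      (\<lambda>x::'a. \<Prod>b\<in>Basis. exp (of_real (- s * (x \<bullet> b)\<^sup>2) + c b * of_real (x \<bullet> b)))
      (\<Prod>b\<in>Basis. of_real (sqrt (pi / s)) * exp ((c b)\<^sup>2 / (4 * of_real s)))"
    by (rule lborel_has_bochner_integral_prod) (rule gaussian_integral_real[OF s])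
  also have "(\<lambda>x::'a. \<Prod>b\<in>Basis. exp (of_real (- s * (x \<bullet> b)\<^sup>2) + c b * of_real (x \<bullet> b)))
      = (\<lambda>x. exp (of_real (- s * (norm x)\<^sup>2) + (\<Sum>b\<in>Basis. c b * of_real (x \<bullet> b))))"
  proof
    fix x :: 'a
    show "(\<Prod>b\<in>Basis. exp (of_real (- s * (x \<bullet> b)\<^sup>2) + c b * of_real (x \<bullet> b)))
        = exp (of_real (- s * (norm x)\<^sup>2) + (\<Sum>b\<in>Basis. c b * of_real (x \<bullet> b)))"
      by (simp add: norm_sq_eq_sum_Basis exp_sum[symmetric] sum.distrib sum_distrib_left sum_negf sum_subtractf)
  qed
  also have "(\<Prod>b\<in>(Basis::'a set). of_real (sqrt (pi / s)) * exp ((c b)\<^sup>2 / (4 * of_real s)))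
      = of_real (sqrt (pi / s) ^ DIM('a)) * exp ((\<Sum>b\<in>Basis. (c b)\<^sup>2) / (4 * of_real s))"
    by (simp add: prod.distrib exp_sum sum_divide_distrib)
  finally show ?thesis .
qed

corollary gaussian_integral_norm:
  assumes s: "s > 0"
  shows "has_bochner_integral lborel (\<lambda>x::'a::euclidean_space. exp (- s * (norm x)\<^sup>2)) (sqrt (pi / s) ^ DIM('a))"
  using has_bochner_integral_Re[OF gaussian_integral[OF s, of "\<lambda>_::'a. 0"]]
  by (simp add: exp_of_real flip: of_real_power of_real_mult of_real_minus)

corollary gaussian_linear_integrable:
  fixes v :: "'a::euclidean_space"
  assumes s: "s > 0"
  shows "integrable lborel (\<lambda>x::'a. exp (- s * (norm x)\<^sup>2 + v \<bullet> x))"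
proof -
  have "integrable lborel (\<lambda>x::'a. exp (of_real (- s * (norm x)\<^sup>2) +
      (\<Sum>b\<in>Basis. of_real (v \<bullet> b) * of_real (x \<bullet> b)) :: complex))"
    using gaussian_integral[OF s, of "\<lambda>b. of_real (v \<bullet> b)"] by (simp add: has_bochner_integral_iff)
  moreover have "(\<Sum>b\<in>Basis. of_real (v \<bullet> b) * of_real (x \<bullet> b)) = complex_of_real (v \<bullet> x)" for x
    by (simp add: euclidean_inner[of v x])
  ultimately have "integrable lborel (\<lambda>x::'a. complex_of_real (exp (- s * (norm x)\<^sup>2 + v \<bullet> x)))"
    by (simp only: of_real_add[symmetric] exp_of_real)
  from integrable_norm[OF this] show ?thesis by simp
qed

corollary gaussian_fourier:
  fixes v :: "'a::euclidean_space"
  assumes s: "s > 0"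
  shows "has_bochner_integral lborel (\<lambda>y::'a. of_real (exp (- s * (norm y)\<^sup>2)) * exp (\<i> * of_real (y \<bullet> v)))
    (of_real (sqrt (pi / s) ^ DIM('a) * exp (- (norm v)\<^sup>2 / (4 * s))))"
proof -
  have v: "(\<Sum>b\<in>Basis. (\<i> * of_real (v \<bullet> b))\<^sup>2) = of_real (- (norm v)\<^sup>2)"
    by (simp add: power_mult_distrib sum_negf norm_sq_eq_sum_Basis flip: of_real_power)
  have y: "(\<Sum>b\<in>Basis. \<i> * of_real (v \<bullet> b) * of_real (y \<bullet> b)) = \<i> * of_real (y \<bullet> v)" for y
    by (simp add: euclidean_inner[of y v] sum_distrib_left mult_ac)
  have d: "of_real (- (norm v)\<^sup>2) / (4 * of_real s) = complex_of_real (- (norm v)\<^sup>2 / (4 * s))"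
    by simp
  show ?thesis
    using gaussian_integral[OF s, of "\<lambda>b. \<i> * of_real (v \<bullet> b)"]
    unfolding v y d exp_add exp_of_real of_real_mult[of "sqrt (pi / s) ^ DIM('a)"] .
qed

lemma lborel_integral_affine:
  fixes f :: "'a::euclidean_space \<Rightarrow> 'b::{banach, second_countable_topology}"
  assumes f: "f \<in> borel_measurable borel" and c: "c \<noteq> 0"
  shows "(LINT x|lborel. f x) = \<bar>c\<bar>^DIM('a) *\<^sub>R (LINT x|lborel. f (t + c *\<^sub>R x))"
  using f by (subst lborel_affine[OF c, of t]) (simp add: integral_density integral_distr)

lemma lborel_integrable_translate:
  fixes f :: "'a::euclidean_space \<Rightarrow> 'b::{banach, second_countable_topology}"
  assumes f: "integrable lborel f"
  shows "integrable lborel (\<lambda>x. f (t + x))"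
  using f integrable_distr_eq[of "(+) t" lborel borel f] by (simp add: lborel_distr_plus)


section \<open>Injectivity of the Fourier transform\<close>

text \<open>
  A Gaussian is the Fourier transform of a Gaussian, so that by Fubini's theorem the integral of
  \<open>f\<close> against a translated Gaussian is a superposition of values of the Fourier transform of \<open>f\<close>.
\<close>

lemma fourier_transform_zero_imp_gaussian_zero:
  fixes f :: "'a::euclidean_space \<Rightarrow> complex"
  assumes f: "integrable lborel f"
    and zero: "\<And>a. (LINT \<xi>|lborel. f \<xi> * exp (\<i> * of_real (a \<bullet> \<xi>))) = 0"
    and t: "t > 0"
  shows "(LINT \<xi>|lborel. f \<xi> * of_real (exp (- t * (norm (x - \<xi>))\<^sup>2))) = 0"
proof -
  \<comment> \<open>The width for which the Fourier transform is a multiple of \<open>exp(- t \<parallel>\<cdot>\<parallel>\<^sup>2)\<close>.\<close>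
  define s where "s = 1 / (4 * t)"
  have s: "s > 0" "1 / (4 * s) = t" using t by (auto simp: s_def)
  define A where "A = sqrt (pi / s) ^ DIM('a)"
  have A: "A \<noteq> 0" using s by (simp add: A_def)
  have [measurable]: "f \<in> borel_measurable borel" using borel_measurable_integrable[OF f] by simp
  let ?h = "\<lambda>\<xi> y. f \<xi> * (of_real (exp (- s * (norm y)\<^sup>2)) * exp (\<i> * of_real (y \<bullet> (\<xi> - x))))"
  have inner: "(LINT y|lborel. ?h \<xi> y) = f \<xi> * of_real (A * exp (- t * (norm (x - \<xi>))\<^sup>2))" for \<xi>
    using has_bochner_integral_integral_eq[OF gaussian_fourier[OF s(1), of "\<xi> - x"]] s(2)
    by (simp add: A_def norm_minus_commute s_def mult.commute)
  have "integrable (lborel \<Otimes>\<^sub>M lborel) (case_prod ?h)"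
  proof (rule lborel_pair.Fubini_integrable)
    show "case_prod ?h \<in> borel_measurable (lborel \<Otimes>\<^sub>M lborel)" by measurable
    have "integrable lborel (\<lambda>\<xi>. cmod (f \<xi>) * (LINT y|lborel. exp (- s * (norm (y::'a))\<^sup>2)))"
      using f by (intro integrable_mult_left integrable_norm)
    then show "integrable lborel (\<lambda>\<xi>. LINT y|lborel. norm (case (\<xi>, y) of (\<xi>, y) \<Rightarrow> ?h \<xi> y))"
      by (simp add: norm_mult)
    show "AE \<xi> in lborel. integrable lborel (\<lambda>y. case (\<xi>, y) of (\<xi>, y) \<Rightarrow> ?h \<xi> y)"
      using gaussian_fourier[OF s(1), where 'a='a] by (auto simp: has_bochner_integral_iff)
  qed
  from lborel_pair.Fubini_integral[OF this]
  have "(LINT \<xi>|lborel. f \<xi> * of_real (A * exp (- t * (norm (x - \<xi>))\<^sup>2)))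
      = (LINT y|lborel. LINT \<xi>|lborel. ?h \<xi> y)"
    by (simp only: inner)
  also have "\<dots> = (LINT y|lborel. (of_real (exp (- s * (norm y)\<^sup>2)) * exp (- \<i> * of_real (y \<bullet> x))) *
      (LINT \<xi>|lborel. f \<xi> * exp (\<i> * of_real (y \<bullet> \<xi>))))"
  proof (intro Bochner_Integration.integral_cong refl)
    fix y
    have "?h \<xi> y = (of_real (exp (- s * (norm y)\<^sup>2)) * exp (- \<i> * of_real (y \<bullet> x))) *
        (f \<xi> * exp (\<i> * of_real (y \<bullet> \<xi>)))" for \<xi>
    proof -
      have "exp (\<i> * of_real (y \<bullet> (\<xi> - x))) = exp (- \<i> * of_real (y \<bullet> x)) * exp (\<i> * of_real (y \<bullet> \<xi>))"
        unfolding exp_add[symmetric] by (rule arg_cong[of _ _ exp]) (simp add: inner_diff_right algebra_simps)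
      then show ?thesis by (simp only: mult_ac)
    qed
    then show "(LINT \<xi>|lborel. ?h \<xi> y) = (of_real (exp (- s * (norm y)\<^sup>2)) * exp (- \<i> * of_real (y \<bullet> x))) *
        (LINT \<xi>|lborel. f \<xi> * exp (\<i> * of_real (y \<bullet> \<xi>)))"
      by (simp only: integral_mult_right_zero)
  qed
  also have "\<dots> = 0" by (simp add: zero)
  finally have "of_real A * (LINT \<xi>|lborel. f \<xi> * of_real (exp (- t * (norm (x - \<xi>))\<^sup>2))) = 0"
    by (simp add: mult.left_commute)
  then show ?thesis using A by simp
qed

text \<open>
  The test function \<open>\<psi>\<close> is the limit of its convolutions with Gaussians of width \<open>1 / (k + 1)\<close>, and
  these convolutions are superpositions of translated Gaussians.
\<close>

lemma fourier_transform_zero_imp_continuous_zero: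
  fixes f :: "'a::euclidean_space \<Rightarrow> complex" and \<psi> :: "'a \<Rightarrow> real"
  assumes f: "integrable lborel f"
    and zero: "\<And>a. (LINT \<xi>|lborel. f \<xi> * exp (\<i> * of_real (a \<bullet> \<xi>))) = 0"
    and cont: "continuous_on UNIV \<psi>" and bound: "\<And>x. \<bar>\<psi> x\<bar> \<le> B"
  shows "(LINT \<xi>|lborel. f \<xi> * of_real (\<psi> \<xi>)) = 0"
proof -
  have [measurable]: "f \<in> borel_measurable borel" using borel_measurable_integrable[OF f] by simp
  have [measurable]: "\<psi> \<in> borel_measurable borel" using cont by (rule borel_measurable_continuous_onI)
  define g where "g y = exp (- (norm y)\<^sup>2)" for y :: 'a
  have [measurable]: "g \<in> borel_measurable borel" unfolding g_def by measurable
  define A where "A = (LINT y|lborel. g y)"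
  have g: "integrable lborel g" and A: "A \<noteq> 0"
    using gaussian_integral_norm[of 1, where 'a='a] by (auto simp: g_def[abs_def] A_def has_bochner_integral_iff)
  have g0: "0 \<le> g y" for y by (simp add: g_def)
  have B: "0 \<le> B" using bound[of 0] by linarith
  define \<psi>k where "\<psi>k k \<xi> = (LINT y|lborel. \<psi> (\<xi> + (1 / real (Suc k)) *\<^sub>R y) * g y)" for k \<xi>
  have [measurable]: "\<psi>k k \<in> borel_measurable borel" for k
    unfolding \<psi>k_def by measurable
  have bnd: "\<bar>\<psi> z * g y\<bar> \<le> B * g y" for z y
    using bound[of z] g0[of y] by (simp add: abs_mult mult_right_mono)
  have \<psi>k_bound: "\<bar>\<psi>k k \<xi>\<bar> \<le> B * A" for k \<xi>
  proof -
    have "norm (\<psi>k k \<xi>) \<le> (LINT y|lborel. B * g y)"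
      unfolding \<psi>k_def
    proof (rule Bochner_Integration.integral_norm_bound_integral)
      show "integrable lborel (\<lambda>y. \<psi> (\<xi> + (1 / real (Suc k)) *\<^sub>R y) * g y)"
      proof (rule Bochner_Integration.integrable_bound)
        show "integrable lborel (\<lambda>y. B * g y)" using g by simp
        show "AE y in lborel. norm (\<psi> (\<xi> + (1 / real (Suc k)) *\<^sub>R y) * g y) \<le> norm (B * g y)"
          using order_trans[OF bnd abs_ge_self] by (intro AE_I2) simp
      qed measurable
      show "integrable lborel (\<lambda>y. B * g y)" using g by simp
      show "norm (\<psi> (\<xi> + (1 / real (Suc k)) *\<^sub>R y) * g y) \<le> B * g y" for y
        using bnd by simp
    qed
    then show ?thesis by (simp add: A_def)
  qed
  have \<psi>k_lim: "(\<lambda>k. \<psi>k k \<xi>) \<longlonglongrightarrow> \<psi> \<xi> * A" for \<xi>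
  proof -
    have "(\<lambda>k. \<psi>k k \<xi>) \<longlonglongrightarrow> (LINT y|lborel. \<psi> \<xi> * g y)"
      unfolding \<psi>k_def
    proof (rule integral_dominated_convergence[where w="\<lambda>y. B * g y"])
      show "AE y in lborel. (\<lambda>k. \<psi> (\<xi> + (1 / real (Suc k)) *\<^sub>R y) * g y) \<longlonglongrightarrow> \<psi> \<xi> * g y"
      proof (intro AE_I2 tendsto_mult tendsto_const)
        fix y
        have "(\<lambda>k. \<xi> + (1 / real (Suc k)) *\<^sub>R y) \<longlonglongrightarrow> \<xi> + 0 *\<^sub>R y"
          using LIMSEQ_inverse_real_of_nat by (intro tendsto_intros) (simp add: inverse_eq_divide)
        then show "(\<lambda>k. \<psi> (\<xi> + (1 / real (Suc k)) *\<^sub>R y)) \<longlonglongrightarrow> \<psi> \<xi>"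
          using cont by (intro isCont_tendsto_compose[of _ \<psi>]) (auto simp: continuous_on_eq_continuous_at)
      qed
    next
      show "integrable lborel (\<lambda>y. B * g y)" using g by simp
      show "AE y in lborel. norm (\<psi> (\<xi> + (1 / real (Suc k)) *\<^sub>R y) * g y) \<le> B * g y" for k
        using bnd by (intro AE_I2) simp
    qed measurable
    then show ?thesis by (simp add: A_def)
  qed
  have \<psi>k_zero: "(LINT \<xi>|lborel. f \<xi> * of_real (\<psi>k k \<xi>)) = 0" for k
  proof -
    define c where "c = 1 / real (Suc k)"
    define t where "t = 1 / c\<^sup>2"
    have c: "c > 0" and t: "t > 0" by (auto simp: c_def t_def)
    have gt: "exp (- t * (norm (x - \<xi>))\<^sup>2) = g ((1 / c) *\<^sub>R (x - \<xi>))" for x \<xi> :: 'a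
      by (simp add: g_def t_def power_mult_distrib power_divide)
    have \<psi>k_c: "\<psi>k k \<xi> = (LINT y|lborel. \<psi> (\<xi> + c *\<^sub>R y) * g y)" for \<xi>
      by (simp only: \<psi>k_def c_def)
    let ?h = "\<lambda>x \<xi>. of_real (\<psi> x) * (f \<xi> * of_real (exp (- t * (norm (x - \<xi>))\<^sup>2)))"
    have int_t: "integrable lborel (\<lambda>x::'a. exp (- t * (norm (x - \<xi>))\<^sup>2))" for \<xi>
      using lborel_integrable_translate[of "\<lambda>x::'a. exp (- t * (norm x)\<^sup>2)" "- \<xi>"]
        gaussian_integral_norm[OF t, where 'a='a] by (simp add: has_bochner_integral_iff)
    have sub: "(LINT x|lborel. \<psi> x * exp (- t * (norm (x - \<xi>))\<^sup>2)) = c ^ DIM('a) * \<psi>k k \<xi>" for \<xi>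
      unfolding gt \<psi>k_c using c
      by (subst lborel_integral_affine[where c=c and t=\<xi>]) simp_all
    have int_g: "(LINT x|lborel. exp (- t * (norm (x - \<xi>))\<^sup>2)) = c ^ DIM('a) * A" for \<xi> :: 'a
      unfolding gt A_def using c
      by (subst lborel_integral_affine[where c=c and t=\<xi>]) simp_all
    have h_bound: "norm (?h x \<xi>) \<le> cmod (f \<xi>) * (B * exp (- t * (norm (x - \<xi>))\<^sup>2))" for x \<xi>
    proof -
      have "norm (?h x \<xi>) = cmod (f \<xi>) * (\<bar>\<psi> x\<bar> * exp (- t * (norm (x - \<xi>))\<^sup>2))"
        by (simp add: norm_mult)
      also have "\<dots> \<le> cmod (f \<xi>) * (B * exp (- t * (norm (x - \<xi>))\<^sup>2))"
        by (intro mult_left_mono mult_right_mono bound) auto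
      finally show ?thesis .
    qed
    have int_hB: "integrable lborel (\<lambda>x. cmod (f \<xi>) * (B * exp (- t * (norm (x - \<xi>))\<^sup>2)))" for \<xi>
      by (intro integrable_mult_right int_t)
    have int_h: "integrable lborel (\<lambda>x. ?h x \<xi>)" for \<xi>
    proof (rule Bochner_Integration.integrable_bound[OF int_hB])
      show "AE x in lborel. norm (?h x \<xi>) \<le> norm (cmod (f \<xi>) * (B * exp (- t * (norm (x - \<xi>))\<^sup>2)))"
        using order_trans[OF h_bound abs_ge_self] by (intro AE_I2) (simp only: real_norm_def)
    qed measurable
    have norm_h: "(LINT x|lborel. norm (?h x \<xi>)) \<le> cmod (f \<xi>) * (B * (c ^ DIM('a) * A))" for \<xi>
    proof -
      have "(LINT x|lborel. norm (?h x \<xi>))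
          \<le> (LINT x|lborel. cmod (f \<xi>) * (B * exp (- t * (norm (x - \<xi>))\<^sup>2)))"
        by (intro integral_mono integrable_norm int_h int_hB h_bound)
      then show ?thesis by (simp only: integral_mult_right_zero int_g)
    qed
    have meas: "case_prod (\<lambda>\<xi> x. ?h x \<xi>) \<in> borel_measurable (lborel \<Otimes>\<^sub>M lborel)" by measurable
    have "integrable (lborel \<Otimes>\<^sub>M lborel) (case_prod (\<lambda>\<xi> x. ?h x \<xi>))"
    proof (rule lborel_pair.Fubini_integrable[OF meas], unfold prod.case)
      show "AE \<xi> in lborel. integrable lborel (\<lambda>x. ?h x \<xi>)"
        by (intro AE_I2 int_h)
      show "integrable lborel (\<lambda>\<xi>. LINT x|lborel. norm (?h x \<xi>))"
      proof (rule Bochner_Integration.integrable_bound)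
        show "integrable lborel (\<lambda>\<xi>. cmod (f \<xi>) * (B * (c ^ DIM('a) * A)))"
          using f by (intro integrable_mult_left integrable_norm)
        have "norm (LINT x|lborel. norm (?h x \<xi>)) \<le> norm (cmod (f \<xi>) * (B * (c ^ DIM('a) * A)))" for \<xi>
        proof -
          have "0 \<le> (LINT x|lborel. norm (?h x \<xi>))" by (rule integral_nonneg_AE) simp
          then show ?thesis using order_trans[OF norm_h abs_ge_self] by (simp only: real_norm_def abs_of_nonneg)
        qed
        then show "AE \<xi> in lborel. norm (LINT x|lborel. norm (?h x \<xi>))
            \<le> norm (cmod (f \<xi>) * (B * (c ^ DIM('a) * A)))" by (intro AE_I2)
      qed measurable
    qed
    then have "(LINT \<xi>|lborel. LINT x|lborel. ?h x \<xi>) = (LINT x|lborel. LINT \<xi>|lborel. ?h x \<xi>)"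
      by (rule lborel_pair.Fubini_integral[symmetric])
    also have "\<dots> = 0"
      using fourier_transform_zero_imp_gaussian_zero[OF f zero t] by simp
    finally have "(LINT \<xi>|lborel. LINT x|lborel. ?h x \<xi>) = 0" .
    moreover have "(LINT x|lborel. ?h x \<xi>) = of_real (c ^ DIM('a)) * (f \<xi> * of_real (\<psi>k k \<xi>))" for \<xi>
    proof -
      have "(LINT x|lborel. ?h x \<xi>) = (LINT x|lborel. f \<xi> * of_real (\<psi> x * exp (- t * (norm (x - \<xi>))\<^sup>2)))"
        by (simp only: of_real_mult mult_ac)
      also have "\<dots> = f \<xi> * of_real (LINT x|lborel. \<psi> x * exp (- t * (norm (x - \<xi>))\<^sup>2))"
        by (simp only: integral_mult_right_zero integral_complex_of_real)
      finally show ?thesis unfolding sub by (simp add: mult_ac)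
    qed
    ultimately show ?thesis using c by simp
  qed
  have "(\<lambda>k. LINT \<xi>|lborel. f \<xi> * of_real (\<psi>k k \<xi>)) \<longlonglongrightarrow> (LINT \<xi>|lborel. f \<xi> * of_real (\<psi> \<xi> * A))"
  proof (rule integral_dominated_convergence[where w="\<lambda>\<xi>. cmod (f \<xi>) * (B * A)"])
    show "AE \<xi> in lborel. (\<lambda>k. f \<xi> * of_real (\<psi>k k \<xi>)) \<longlonglongrightarrow> f \<xi> * of_real (\<psi> \<xi> * A)"
      by (intro AE_I2 tendsto_intros \<psi>k_lim)
    show "AE \<xi> in lborel. norm (f \<xi> * of_real (\<psi>k k \<xi>)) \<le> cmod (f \<xi>) * (B * A)" for k
      using \<psi>k_bound by (intro AE_I2) (auto simp: norm_mult intro!: mult_left_mono)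
    show "integrable lborel (\<lambda>\<xi>. cmod (f \<xi>) * (B * A))"
      using f by (intro integrable_mult_left integrable_norm)
  qed measurable
  then have "(LINT \<xi>|lborel. f \<xi> * of_real (\<psi> \<xi>) * of_real A) = 0"
    by (simp add: \<psi>k_zero LIMSEQ_const_iff mult.assoc)
  then show ?thesis using A by simp
qed

text \<open>
  Indicators of closed sets are limits of bounded continuous functions, and closed sets are an
  intersection stable generator of the Borel sets; so \<open>f\<close> has integral zero over every Borel set.
\<close>

theorem fourier_transform_injective:
  fixes f :: "'a::euclidean_space \<Rightarrow> complex"
  assumes f: "integrable lborel f"
    and zero: "\<And>a. (LINT \<xi>|lborel. f \<xi> * exp (\<i> * of_real (a \<bullet> \<xi>))) = 0"
  shows "AE \<xi> in lborel. f \<xi> = 0"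
proof (rule sigma_finite_measure.density_zero[OF lborel.sigma_finite_measure_axioms f])
  have [measurable]: "f \<in> borel_measurable borel" using borel_measurable_integrable[OF f] by simp
  have total: "(LINT \<xi>|lborel. f \<xi>) = 0" using zero[of 0] by simp
  have int: "integrable lborel (\<lambda>\<xi>. indicator A \<xi> *\<^sub>R f \<xi>)" if "A \<in> sets borel" for A
    using that f by (intro integrable_mult_indicator) auto
  fix A :: "'a set" assume "A \<in> sets lborel"
  then have A: "A \<in> sigma_sets UNIV (Collect closed)" by (simp add: borel_eq_closed)
  have stable: "Int_stable (Collect closed :: 'a set set)" by (auto simp: Int_stable_def)
  have Pow: "Collect closed \<subseteq> Pow (UNIV :: 'a set)" by simp
  show "set_lebesgue_integral lborel A f = 0"
    using stable Pow A
  proof (induction rule: sigma_sets_induct_disjoint)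
    case (basic C)
    then have C: "closed C" by simp
    show ?case
    proof (cases "C = {}")
      case False
      let ?\<psi> = "\<lambda>k x. max 0 (1 - real k * infdist x C)"
      have [measurable]: "C \<in> sets borel" using C by auto
      have [measurable]: "(\<lambda>x. infdist x C) \<in> borel_measurable borel"
        by (intro borel_measurable_continuous_onI continuous_intros)
      have \<psi>_le: "\<bar>?\<psi> k x\<bar> \<le> 1" for k x by (simp add: infdist_nonneg)
      have "(\<lambda>k. LINT \<xi>|lborel. f \<xi> * of_real (?\<psi> k \<xi>)) \<longlonglongrightarrow> (LINT \<xi>|lborel. indicator C \<xi> *\<^sub>R f \<xi>)"
      proof (rule integral_dominated_convergence[where w="\<lambda>\<xi>. cmod (f \<xi>)"])
        have "(\<lambda>k. f \<xi> * of_real (?\<psi> k \<xi>)) \<longlonglongrightarrow> indicator C \<xi> *\<^sub>R f \<xi>" for \<xi>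
        proof (cases "\<xi> \<in> C")
          case True
          then show ?thesis by simp
        next
          case nin: False
          then have d: "infdist \<xi> C > 0"
            using in_closed_iff_infdist_zero[OF C False] infdist_nonneg[of \<xi> C] by (auto simp: less_le)
          obtain n where n: "1 < real n * infdist \<xi> C" using reals_Archimedean3[OF d] by blast
          have "\<forall>\<^sub>F k in sequentially. f \<xi> * of_real (?\<psi> k \<xi>) = 0"
            using eventually_ge_at_top[of n]
          proof eventually_elim
            case (elim k)
            have "real n * infdist \<xi> C \<le> real k * infdist \<xi> C"
              using d elim by (intro mult_right_mono) auto
            then show ?case using n by simp
          qed
          then show ?thesis using nin by (simp add: tendsto_eventually)
        qed
        then show "AE \<xi> in lborel. (\<lambda>k. f \<xi> * of_real (?\<psi> k \<xi>)) \<longlonglongrightarrow> indicator C \<xi> *\<^sub>R f \<xi>" by simp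
        show "AE \<xi> in lborel. norm (f \<xi> * of_real (?\<psi> k \<xi>)) \<le> cmod (f \<xi>)" for k
        proof (rule AE_I2)
          fix \<xi>
          show "norm (f \<xi> * of_real (?\<psi> k \<xi>)) \<le> cmod (f \<xi>)"
            unfolding norm_mult norm_of_real by (rule mult_left_le[OF \<psi>_le norm_ge_zero])
        qed
        show "integrable lborel (\<lambda>\<xi>. cmod (f \<xi>))" using f by (rule integrable_norm)
      qed measurable
      moreover have "(LINT \<xi>|lborel. f \<xi> * of_real (?\<psi> k \<xi>)) = 0" for k
        by (rule fourier_transform_zero_imp_continuous_zero[OF f zero _ \<psi>_le]) (intro continuous_intros)
      ultimately show ?thesis by (simp add: LIMSEQ_const_iff set_lebesgue_integral_def)
    qed (simp add: set_lebesgue_integral_def)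
  next
    case (compl A)
    then have A: "A \<in> sets borel" by (simp add: borel_eq_closed)
    have "(LINT \<xi>|lborel. indicator (UNIV - A) \<xi> *\<^sub>R f \<xi>) = (LINT \<xi>|lborel. f \<xi> - indicator A \<xi> *\<^sub>R f \<xi>)"
      by (intro Bochner_Integration.integral_cong) (auto simp: indicator_def)
    also have "\<dots> = (LINT \<xi>|lborel. f \<xi>) - (LINT \<xi>|lborel. indicator A \<xi> *\<^sub>R f \<xi>)"
      by (rule Bochner_Integration.integral_diff[OF f int[OF A]])
    also have "\<dots> = 0" using compl(2) total by (simp add: set_lebesgue_integral_def)
    finally show ?case by (simp add: set_lebesgue_integral_def)
  next
    case (union A)
    then have A: "\<And>i. A i \<in> sets borel" by (auto simp: borel_eq_closed)
    have int_U: "set_integrable lborel (\<Union>i. A i) f"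
      unfolding set_integrable_def using A by (intro int sets.countable_UN) auto
    have "set_lebesgue_integral lborel (\<Union>i. A i) f = (\<Sum>i. set_lebesgue_integral lborel (A i) f)"
    proof (rule lebesgue_integral_countable_add[OF _ _ int_U])
      show "A i \<in> sets lborel" for i using A by simp
      show "A i \<inter> A j = {}" if "i \<noteq> j" for i j
        using union(1) that by (simp add: disjoint_family_on_def)
    qed
    also have "\<dots> = 0" unfolding union(3) by simp
    finally show ?case .
  qed (simp add: set_lebesgue_integral_def)
qed


section \<open>Invariance of Lebesgue measure under isometries\<close>

lemma nn_integral_lborel_affine_unit:
  fixes f :: "'a::euclidean_space \<Rightarrow> ennreal"
  assumes f: "f \<in> borel_measurable borel" and c: "\<bar>c\<bar> = 1"
  shows "(\<integral>\<^sup>+x. f (t + c *\<^sub>R x) \<partial>lborel) = (\<integral>\<^sup>+x. f x \<partial>lborel)"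
proof -
  have "c \<noteq> 0" using c by auto
  from lborel_affine[OF this, of t] have *: "lborel = distr lborel borel (\<lambda>x. t + c *\<^sub>R x)"
    by (simp add: c density_1)
  show ?thesis
    using f by (subst (2) *) (simp add: nn_integral_distr)
qed

text \<open>
  The argument for the uniqueness of Haar measure: for the image \<open>\<mu>\<close> of Lebesgue measure \<open>\<lambda>\<close>
  under \<open>T\<close>, translation invariance of both measures and Tonelli's theorem turn
  \<open>\<integral> f d\<mu> \<cdot> \<integral> g d\<lambda>\<close> into \<open>\<integral> f d\<lambda> \<cdot> \<integral> g(- x) d\<mu>(x)\<close>. If \<open>g\<close> is a radial Gaussian, the two factors
  that contain \<open>g\<close> agree, because \<open>T\<close> preserves the norm.
\<close>

lemma lborel_distr_isometry:
  fixes T :: "'a::euclidean_space \<Rightarrow> 'a"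
  assumes lin: "linear T" and iso: "\<And>x. norm (T x) = norm x"
  shows "distr lborel borel T = lborel"
proof (rule measure_eqI)
  have [measurable]: "T \<in> borel_measurable borel"
    using lin by (simp add: borel_measurable_continuous_onI linear_continuous_on linear_conv_bounded_linear)
  have "inj T"
    using lin iso by (metis linear_injective_0 norm_eq_zero)
  then have surj: "surj T" by (rule linear_inj_imp_surj[OF lin])
  note Tadd = linear_add[OF lin] and Tdiff = linear_diff[OF lin]
  define g where "g y = ennreal (exp (- (norm y)\<^sup>2))" for y :: 'a
  have [measurable]: "g \<in> borel_measurable borel" unfolding g_def by measurable
  have gT: "g (T x) = g x" for x by (simp add: g_def iso)
  define G where "G = (\<integral>\<^sup>+y. g y \<partial>lborel)"
  have "G = ennreal (sqrt pi ^ DIM('a))"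
    using gaussian_integral_norm[of 1, where 'a='a]
    by (simp add: G_def g_def has_bochner_integral_iff nn_integral_eq_integral)
  then have G: "G \<noteq> 0" "G \<noteq> \<infinity>" by auto
  fix A assume "A \<in> sets (distr lborel borel T)"
  then have [measurable]: "A \<in> sets borel" by simp
  define f where "f x = (indicator A x :: ennreal)" for x
  have [measurable]: "f \<in> borel_measurable borel" unfolding f_def by measurable
  have "(\<integral>\<^sup>+x. f (T x) \<partial>lborel) * G = (\<integral>\<^sup>+y. (\<integral>\<^sup>+x. f (T x) \<partial>lborel) * g y \<partial>lborel)"
    by (simp add: G_def nn_integral_cmult)
  also have "\<dots> = (\<integral>\<^sup>+y. (\<integral>\<^sup>+x. f (T x + y) * g y \<partial>lborel) \<partial>lborel)"
  proof (rule nn_integral_cong)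
    fix y
    obtain v where v: "y = T v" using surj by auto
    have "(\<integral>\<^sup>+x. f (T x + y) \<partial>lborel) = (\<integral>\<^sup>+x. f (T (v + 1 *\<^sub>R x)) \<partial>lborel)"
      by (simp add: v Tadd add.commute)
    also have "\<dots> = (\<integral>\<^sup>+x. f (T x) \<partial>lborel)"
      by (rule nn_integral_lborel_affine_unit) simp_all
    finally show "(\<integral>\<^sup>+x. f (T x) \<partial>lborel) * g y = (\<integral>\<^sup>+x. f (T x + y) * g y \<partial>lborel)"
      by (simp add: nn_integral_multc)
  qed
  also have "\<dots> = (\<integral>\<^sup>+x. (\<integral>\<^sup>+y. f (T x + y) * g y \<partial>lborel) \<partial>lborel)"
    by (rule lborel_pair.Fubini') measurable
  also have "\<dots> = (\<integral>\<^sup>+x. (\<integral>\<^sup>+y. f y * g (y - T x) \<partial>lborel) \<partial>lborel)"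
  proof (rule nn_integral_cong)
    fix x
    show "(\<integral>\<^sup>+y. f (T x + y) * g y \<partial>lborel) = (\<integral>\<^sup>+y. f y * g (y - T x) \<partial>lborel)"
      using nn_integral_lborel_affine_unit[of "\<lambda>y. f y * g (y - T x)" 1 "T x"] by simp
  qed
  also have "\<dots> = (\<integral>\<^sup>+y. (\<integral>\<^sup>+x. f y * g (y - T x) \<partial>lborel) \<partial>lborel)"
    by (rule lborel_pair.Fubini'[symmetric]) measurable
  also have "\<dots> = (\<integral>\<^sup>+y. f y * G \<partial>lborel)"
  proof (rule nn_integral_cong)
    fix y
    obtain v where v: "y = T v" using surj by auto
    have "(\<integral>\<^sup>+x. g (y - T x) \<partial>lborel) = (\<integral>\<^sup>+x. g (v + (-1) *\<^sub>R x) \<partial>lborel)"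
      by (simp add: v Tdiff[symmetric] gT)
    also have "\<dots> = G"
      unfolding G_def by (rule nn_integral_lborel_affine_unit) simp_all
    finally show "(\<integral>\<^sup>+x. f y * g (y - T x) \<partial>lborel) = f y * G"
      by (simp add: nn_integral_cmult)
  qed
  also have "\<dots> = (\<integral>\<^sup>+y. f y \<partial>lborel) * G" by (simp add: nn_integral_multc)
  finally have "(\<integral>\<^sup>+x. f (T x) \<partial>lborel) = (\<integral>\<^sup>+y. f y \<partial>lborel)"
    using G by (simp add: ennreal_mult_cancel_left mult.commute[of _ G])
  moreover have "(\<integral>\<^sup>+x. f (T x) \<partial>lborel) = (\<integral>\<^sup>+x. f x \<partial>distr lborel borel T)"
    by (simp add: nn_integral_distr)
  ultimately show "emeasure (distr lborel borel T) A = emeasure lborel A"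
    by (simp add: f_def)
qed simp


section \<open>Entire functions on complex coordinate space\<close>

lemma cdot_add_right: "w \<bullet>\<^sub>c (x + y) = w \<bullet>\<^sub>c x + w \<bullet>\<^sub>c y"
  and cdot_add_left: "(x + y) \<bullet>\<^sub>c w = x \<bullet>\<^sub>c w + y \<bullet>\<^sub>c w"
  and cdot_smult_right: "w \<bullet>\<^sub>c (c *s x) = c * (w \<bullet>\<^sub>c x)"
  and cdot_smult_left: "(c *s x) \<bullet>\<^sub>c w = c * (x \<bullet>\<^sub>c w)"
  by (simp_all add: cdot_def algebra_simps sum.distrib sum_distrib_left)

lemma cdot_commute: "w \<bullet>\<^sub>c x = x \<bullet>\<^sub>c w"
  by (simp add: cdot_def mult.commute)

lemma cdot_zero_right [simp]: "w \<bullet>\<^sub>c 0 = 0" and cdot_zero_left [simp]: "0 \<bullet>\<^sub>c w = 0"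
  by (simp_all add: cdot_def)

lemma cdot_bounded_linear: "bounded_linear (\<lambda>x. w \<bullet>\<^sub>c x)"
  unfolding linear_conv_bounded_linear[symmetric]
  by (rule linearI) (simp_all add: cdot_def algebra_simps sum.distrib scaleR_sum_right)

lemma entire_cong_derivative:
  assumes "\<And>z. (F has_derivative D z) (at z)" "\<And>z h. D z h = c z \<bullet>\<^sub>c h"
  shows "entire F"
proof -
  have "D z = (\<lambda>h. c z \<bullet>\<^sub>c h)" for z using assms(2) by auto
  then show ?thesis unfolding entire_def using assms(1) by metis
qed

lemma entire_mult:
  assumes "entire F" "entire H"
  shows "entire (\<lambda>z. F z * H z)"
proof -
  from assms obtain c d where c: "\<And>z. (F has_derivative (\<lambda>h. c z \<bullet>\<^sub>c h)) (at z)"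
    and d: "\<And>z. (H has_derivative (\<lambda>h. d z \<bullet>\<^sub>c h)) (at z)"
    unfolding entire_def by metis
  show ?thesis
    by (rule entire_cong_derivative[OF has_derivative_mult[OF c d], where c="\<lambda>z. F z *s d z + H z *s c z"])
      (simp add: cdot_add_left cdot_smult_left)
qed

lemma entire_exp:
  assumes "entire F"
  shows "entire (\<lambda>z. exp (F z))"
proof -
  from assms obtain c where c: "\<And>z. (F has_derivative (\<lambda>h. c z \<bullet>\<^sub>c h)) (at z)"
    unfolding entire_def by metis
  have "((\<lambda>z. exp (F z)) has_derivative (\<lambda>h. exp (F z) * (c z \<bullet>\<^sub>c h))) (at z)" for z
    using has_derivative_compose[OF c DERIV_exp[unfolded has_field_derivative_def]] by simp
  then show ?thesis
    by (rule entire_cong_derivative[where c="\<lambda>z. exp (F z) *s c z"]) (simp add: cdot_smult_left)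
qed

lemma entire_linear: "entire (\<lambda>z. w \<bullet>\<^sub>c z)"
  unfolding entire_def using bounded_linear_imp_has_derivative[OF cdot_bounded_linear] by blast

lemma entire_const: "entire (\<lambda>z. c)"
  by (rule entire_cong_derivative[where D="\<lambda>_ _. 0" and c="\<lambda>_. 0"]) simp_all

lemma entire_add:
  assumes "entire F" "entire H"
  shows "entire (\<lambda>z. F z + H z)"
proof -
  from assms obtain c d where c: "\<And>z. (F has_derivative (\<lambda>h. c z \<bullet>\<^sub>c h)) (at z)"
    and d: "\<And>z. (H has_derivative (\<lambda>h. d z \<bullet>\<^sub>c h)) (at z)"
    unfolding entire_def by metis
  show ?thesis
    by (rule entire_cong_derivative[OF has_derivative_add[OF c d], where c="\<lambda>z. c z + d z"])
      (simp add: cdot_add_left)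
qed

lemma entire_translate:
  assumes "entire F"
  shows "entire (\<lambda>z. F (w + z))"
proof -
  from assms obtain c where c: "\<And>z. (F has_derivative (\<lambda>h. c z \<bullet>\<^sub>c h)) (at z)"
    unfolding entire_def by metis
  have tr: "((\<lambda>z. w + z) has_derivative (\<lambda>h. h)) (at z)" for z :: "complex ^ 'a"
    by (auto intro!: derivative_eq_intros)
  have "((\<lambda>z. F (w + z)) has_derivative (\<lambda>h. c (w + z) \<bullet>\<^sub>c h)) (at z)" for z
    by (rule has_derivative_compose[OF tr c])
  then show ?thesis unfolding entire_def by blast
qed

lemma entire_scale:
  assumes "entire F"
  shows "entire (\<lambda>z. F (a *s z))"
proof -
  from assms obtain c where c: "\<And>z. (F has_derivative (\<lambda>h. c z \<bullet>\<^sub>c h)) (at z)"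
    unfolding entire_def by metis
  have "bounded_linear (\<lambda>z :: complex ^ 'a. a *s z)"
    unfolding linear_conv_bounded_linear[symmetric]
    by (rule linearI) (simp_all add: vec_eq_iff algebra_simps)
  then have sc: "((\<lambda>z :: complex ^ 'a. a *s z) has_derivative (\<lambda>h. a *s h)) (at z)" for z
    by (rule bounded_linear_imp_has_derivative)
  show ?thesis
    by (rule entire_cong_derivative[OF has_derivative_compose[OF sc c], where c="\<lambda>z. a *s c (a *s z)"])
      (simp add: cdot_smult_left cdot_smult_right)
qed

lemma entire_cdot_self: "entire (\<lambda>z. z \<bullet>\<^sub>c z)"
proof (rule entire_cong_derivative)
  show "((\<lambda>z. z \<bullet>\<^sub>c z) has_derivative (\<lambda>h. \<Sum>j\<in>UNIV. z $ j * h $ j + h $ j * z $ j)) (at z)" for z :: "complex ^ 'a"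
    unfolding cdot_def
    by (intro has_derivative_sum has_derivative_mult bounded_linear_imp_has_derivative bounded_linear_vec_nth)
  show "(\<Sum>j\<in>UNIV. z $ j * h $ j + h $ j * z $ j) = (2 *s z) \<bullet>\<^sub>c h" for z h :: "complex ^ 'a"
    by (simp add: cdot_def mult_ac)
qed

lemma entire_continuous: "entire F \<Longrightarrow> continuous_on S F"
  unfolding entire_def
  by (meson continuous_at_imp_continuous_on has_derivative_continuous)

lemma entire_measurable: "entire F \<Longrightarrow> F \<in> borel_measurable borel"
  by (intro borel_measurable_continuous_onI entire_continuous)

lemma entire_holomorphic_line:
  assumes "entire F"
  shows "(\<lambda>t. F (t *s z)) holomorphic_on UNIV"
proof -
  from assms obtain c where c: "\<And>z. (F has_derivative (\<lambda>h. c z \<bullet>\<^sub>c h)) (at z)"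
    unfolding entire_def by metis
  have "bounded_linear (\<lambda>t. t *s z)"
    unfolding linear_conv_bounded_linear[symmetric]
    by (rule linearI) (simp_all add: vec_eq_iff algebra_simps)
  then have line: "((\<lambda>t. t *s z) has_derivative (\<lambda>h. h *s z)) (at t)" for t
    by (rule bounded_linear_imp_has_derivative)
  have "((\<lambda>t. F (t *s z)) has_field_derivative (c (t *s z) \<bullet>\<^sub>c z)) (at t)" for t
    using has_derivative_compose[OF line c]
    by (simp add: has_field_derivative_def cdot_smult_right mult_commute_abs)
  then show ?thesis by (auto simp: holomorphic_on_def field_differentiable_def)
qed

lemma holomorphic_circle_mean:
  assumes h: "h holomorphic_on UNIV"
  shows "(LINT t:{0..1}|lborel. h (exp (2 * of_real pi * \<i> * of_real t))) = h 0"
proof -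
  let ?f = "\<lambda>t::real. h (exp (2 * of_real pi * \<i> * of_real t))"
  have "((\<lambda>u. h u / (u - 0)) has_contour_integral (2 * of_real pi * \<i> * h 0)) (circlepath 0 1)"
    by (rule Cauchy_integral_circlepath_simple) (use h holomorphic_on_subset in auto)
  then have "((\<lambda>t. (2 * of_real pi * \<i>) * ?f t) has_integral (2 * of_real pi * \<i> * h 0)) {0..1}"
    unfolding has_contour_integral_def
  proof (rule has_integral_eq[rotated])
    fix t :: real assume "t \<in> {0..1}"
    then have "vector_derivative (circlepath 0 1) (at t within {0..1})
        = 2 * of_real pi * \<i> * exp (2 * of_real pi * \<i> * of_real t)"
      by (simp add: vector_derivative_circlepath01)
    then show "h (circlepath 0 1 t) / (circlepath 0 1 t - 0) *
        vector_derivative (circlepath 0 1) (at t within {0..1}) = (2 * of_real pi * \<i>) * ?f t"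
      by (simp only:) (simp add: circlepath)
  qed
  from has_integral_mult_right[OF this, of "1 / (2 * of_real pi * \<i>)"]
  have hi: "(?f has_integral h 0) {0..1}" by simp
  have "continuous_on {0..1} ?f"
    by (intro continuous_on_compose2[OF holomorphic_on_imp_continuous_on[OF h]] continuous_intros) auto
  then have "set_integrable lborel {0..1} ?f" by (rule borel_integrable_atLeastAtMost')
  from set_borel_integral_eq_integral(2)[OF this] integral_unique[OF hi] show ?thesis by simp
qed


section \<open>The reproducing kernel of the Fock space\<close>

abbreviation fock_weight :: "complex ^ 'n \<Rightarrow> real"
  where "fock_weight z \<equiv> (1 / (2 * pi) ^ CARD('n)) * exp (- (1/2) * (norm z)\<^sup>2)"

lemma sets_fock_measure [measurable_cong, simp]: "sets fock_measure = sets borel"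
  and space_fock_measure [simp]: "space fock_measure = UNIV"
  by (simp_all add: fock_measure_def)

lemma measurable_fock_measure_iff: "F \<in> borel_measurable fock_measure \<longleftrightarrow> F \<in> borel_measurable borel"
  by (simp cong: measurable_cong_sets)

lemma integrable_fock_measure_iff:
  fixes F :: "complex ^ 'n \<Rightarrow> 'b::{banach, second_countable_topology}"
  assumes "F \<in> borel_measurable borel"
  shows "integrable fock_measure F \<longleftrightarrow> integrable lborel (\<lambda>z. fock_weight z *\<^sub>R F z)"
  unfolding fock_measure_def using assms by (intro integrable_density) auto

lemma integral_fock_measure:
  fixes F :: "complex ^ 'n \<Rightarrow> 'b::{banach, second_countable_topology}"
  assumes "F \<in> borel_measurable borel"
  shows "(LINT z|fock_measure. F z) = (LINT z|lborel. fock_weight z *\<^sub>R F z)"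
  unfolding fock_measure_def using assms by (intro integral_density) auto

lemma prob_space_fock_measure: "prob_space (fock_measure :: (complex ^ 'n) measure)"
proof
  have "has_bochner_integral lborel (\<lambda>z::complex^'n. (1 / (2 * pi) ^ CARD('n)) * exp (- (1/2) * (norm z)\<^sup>2))
      ((1 / (2 * pi) ^ CARD('n)) * sqrt (pi / (1/2)) ^ DIM(complex ^ 'n))"
    by (intro has_bochner_integral_mult_right gaussian_integral_norm) simp
  also have "sqrt (pi / (1/2)) ^ DIM(complex ^ 'n) = (2 * pi) ^ CARD('n)"
    by (simp add: mult.commute[of "CARD('n)"] power_mult)
  finally have "has_bochner_integral lborel (fock_weight :: complex ^ 'n \<Rightarrow> real) 1" by simp
  then have "integrable lborel (fock_weight :: complex ^ 'n \<Rightarrow> real)"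
    and "integral\<^sup>L lborel (fock_weight :: complex ^ 'n \<Rightarrow> real) = 1"
    unfolding has_bochner_integral_iff by blast+
  then have "(\<integral>\<^sup>+z. ennreal (fock_weight (z :: complex ^ 'n)) \<partial>lborel) = ennreal 1"
    using nn_integral_eq_integral[of lborel "fock_weight :: complex ^ 'n \<Rightarrow> real"] by auto
  then show "emeasure (fock_measure :: (complex ^ 'n) measure) (space fock_measure) = 1"
    by (simp add: fock_measure_def emeasure_density)
qed

interpretation fock: prob_space "fock_measure :: (complex ^ 'n) measure"
  by (rule prob_space_fock_measure)

lemma fock_measure_rotate:
  fixes F :: "complex ^ 'n \<Rightarrow> 'b::{banach, second_countable_topology}"
  assumes F: "F \<in> borel_measurable borel" and c: "cmod c = 1"
  shows "integrable fock_measure (\<lambda>z. F (c *s z)) \<longleftrightarrow> integrable fock_measure F"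
    and "(LINT z|fock_measure. F (c *s z)) = (LINT z|fock_measure. F z)"
proof -
  have lin: "linear (\<lambda>z::complex ^ 'n. c *s z)"
    by (rule linearI) (simp_all add: vec_eq_iff algebra_simps)
  have iso: "norm (c *s z) = norm z" for z :: "complex ^ 'n"
    by (simp add: norm_vec_def norm_mult c)
  note inv = lborel_distr_isometry[OF lin iso]
  have cm: "(\<lambda>z::complex ^ 'n. c *s z) \<in> borel_measurable borel"
    using lin by (simp add: borel_measurable_continuous_onI linear_continuous_on linear_conv_bounded_linear)
  have FT: "(\<lambda>z. F (c *s z)) \<in> borel_measurable borel"
    using measurable_compose[OF cm F] .
  have wF: "(\<lambda>z. fock_weight z *\<^sub>R F z) \<in> borel_measurable borel"
    using F by measurable
  have eq: "fock_weight z *\<^sub>R F (c *s z) = fock_weight (c *s z) *\<^sub>R F (c *s z)" for z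
    by (simp add: iso)
  show "integrable fock_measure (\<lambda>z. F (c *s z)) \<longleftrightarrow> integrable fock_measure F"
    unfolding integrable_fock_measure_iff[OF F] integrable_fock_measure_iff[OF FT] eq
    by (subst (2) inv[symmetric]) (rule integrable_distr_eq[symmetric], use cm wF in simp_all)
  show "(LINT z|fock_measure. F (c *s z)) = (LINT z|fock_measure. F z)"
    unfolding integral_fock_measure[OF F] integral_fock_measure[OF FT] eq
    by (subst (2) inv[symmetric]) (rule integral_distr[symmetric], use cm wF in simp_all)
qed

text \<open>
  Rotating the argument by a unit complex number does not change the integral. Averaged over the
  circle, the integrand becomes the constant \<open>F 0\<close> by Cauchy's formula on each complex
  line through the origin.
\<close>

lemma entire_fock_mean:
  fixes F :: "complex ^ 'n \<Rightarrow> complex"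
  assumes F: "entire F" and int: "integrable fock_measure F"
  shows "(LINT z|fock_measure. F z) = F 0"
proof -
  interpret pair_sigma_finite "lborel :: real measure" "fock_measure :: (complex ^ 'n) measure" ..
  define r where "r t = exp (2 * of_real pi * \<i> * of_real t)" for t :: real
  have r: "cmod (r t) = 1" for t by (simp add: r_def)
  note Fm [measurable] = entire_measurable[OF F]
  let ?h = "\<lambda>t z. indicator {0..1::real} t *\<^sub>R F (r t *s z)"
  have "continuous_on UNIV (\<lambda>p::real \<times> (complex ^ 'n). r (fst p) *s snd p)"
    unfolding r_def vector_scalar_mult_def by (intro continuous_intros)
  then have rm [measurable]: "(\<lambda>p::real \<times> (complex ^ 'n). r (fst p) *s snd p) \<in> borel_measurable borel"
    by (rule borel_measurable_continuous_onI)
  have "(\<lambda>p. indicator {0..1} (fst p) *\<^sub>R F (r (fst p) *s snd p)) \<in> borel_measurable (borel \<Otimes>\<^sub>M borel)"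
    using rm unfolding borel_prod[symmetric] by measurable
  then have hm: "case_prod ?h \<in> borel_measurable (lborel \<Otimes>\<^sub>M fock_measure)"
    by (simp add: case_prod_beta' cong: measurable_cong_sets sets_pair_measure_cong)
  have "integrable (lborel \<Otimes>\<^sub>M fock_measure) (case_prod ?h)"
  proof (rule Fubini_integrable[OF hm], unfold prod.case)
    have eq: "(LINT z|fock_measure. norm (?h t z))
        = indicator {0..1} t *\<^sub>R (LINT z|fock_measure. norm (F z))" for t
      using fock_measure_rotate(2)[OF _ r, of "\<lambda>z. norm (F z)" t] by simp
    show "integrable lborel (\<lambda>t. LINT z|fock_measure. norm (?h t z))"
      unfolding eq by (intro integrable_scaleR_left integrable_real_indicator) auto
    show "AE t in lborel. integrable fock_measure (\<lambda>z. ?h t z)"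
      using int fock_measure_rotate(1)[OF Fm r] by simp
  qed
  from Fubini_integral[OF this]
  have "(LINT z|fock_measure. LINT t|lborel. ?h t z) = (LINT t|lborel. LINT z|fock_measure. ?h t z)" .
  also have "\<dots> = (LINT z|fock_measure. F z)"
    by (simp add: fock_measure_rotate(2)[OF Fm r])
  finally have "(LINT z|fock_measure. LINT t|lborel. ?h t z) = (LINT z|fock_measure. F z)" .
  moreover have "(LINT t|lborel. ?h t z) = F 0" for z
    using holomorphic_circle_mean[OF entire_holomorphic_line[OF F, of z]]
    by (simp add: set_lebesgue_integral_def r_def)
  ultimately show ?thesis by (simp add: fock.prob_space[simplified])
qed

lemma fock_space_altdef: "fock_space = {F \<in> L2 fock_measure. entire F}"
  by (auto simp: fock_space_def L2_def entire_measurable measurable_fock_measure_iff)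

lemma fock_spaceD: "F \<in> fock_space \<Longrightarrow> F \<in> L2 fock_measure" "F \<in> fock_space \<Longrightarrow> entire F"
  by (auto simp: fock_space_altdef)

lemma fock_space_cmult: "F \<in> fock_space \<Longrightarrow> (\<lambda>z. c * F z) \<in> fock_space"
  by (simp add: fock_space_altdef L2_cmult entire_mult[OF entire_const])

lemma fock_space_add: "F \<in> fock_space \<Longrightarrow> H \<in> fock_space \<Longrightarrow> (\<lambda>z. F z + H z) \<in> fock_space"
  by (simp add: fock_space_altdef L2_add entire_add)

lemma fock_inner_eq: "fock_inner = l2_inner fock_measure"
  by (simp add: fock_inner_def l2_inner_def fun_eq_iff)

lemma fock_norm_eq: "fock_norm = l2_norm fock_measure"
  by (simp add: fock_norm_def l2_norm_def fun_eq_iff)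

definition vcnj :: "complex ^ 'n \<Rightarrow> complex ^ 'n"
  where "vcnj w = (\<chi> j. cnj (w $ j))"

text \<open>
  The reproducing kernel of the Fock space at the point \<open>w\<close>.
\<close>

definition coherent :: "complex ^ 'n \<Rightarrow> complex ^ 'n \<Rightarrow> complex"
  where "coherent w z = exp ((1/2) * (vcnj w \<bullet>\<^sub>c z))"

lemma vcnj_vcnj [simp]: "vcnj (vcnj w) = w"
  by (simp add: vcnj_def vec_eq_iff)

lemma vcnj_add: "vcnj (w + z) = vcnj w + vcnj z"
  by (simp add: vcnj_def vec_eq_iff)

lemma cnj_cdot: "cnj (w \<bullet>\<^sub>c z) = vcnj w \<bullet>\<^sub>c vcnj z"
  by (simp add: cdot_def vcnj_def cnj_sum)

lemma norm_sq_cdot: "of_real ((norm z)\<^sup>2) = z \<bullet>\<^sub>c vcnj z"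
proof -
  have "(norm z)\<^sup>2 = (\<Sum>j\<in>UNIV. (cmod (z $ j))\<^sup>2)"
    by (simp add: norm_vec_def L2_set_def sum_nonneg)
  then show ?thesis
    by (simp only: cdot_def vcnj_def of_real_sum complex_norm_square vec_lambda_beta)
qed

lemma Re_vcnj_cdot: "Re (vcnj w \<bullet>\<^sub>c z) = w \<bullet> z"
  by (simp add: cdot_def vcnj_def inner_vec_def inner_complex_def Re_sum)

lemma entire_coherent: "entire (coherent w)"
  unfolding coherent_def[abs_def]
  by (intro entire_exp entire_mult entire_const entire_linear)

lemma coherent_in_fock_space: "coherent w \<in> fock_space"
proof -
  have "integrable lborel (\<lambda>z. (1 / (2 * pi) ^ CARD('a)) * exp (- (1/2) * (norm z)\<^sup>2 + w \<bullet> z))"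
    by (intro integrable_mult_right gaussian_linear_integrable) simp
  moreover have "(cmod (coherent w z))\<^sup>2 = exp (w \<bullet> z)" for z
    by (simp add: coherent_def norm_exp_eq_Re Re_vcnj_cdot flip: exp_double)
  ultimately have "integrable lborel (\<lambda>z. fock_weight z *\<^sub>R (cmod (coherent w z))\<^sup>2)"
    by (simp only: exp_add real_scaleR_def mult.assoc)
  then have "integrable fock_measure (\<lambda>z. (cmod (coherent w z))\<^sup>2)"
    using entire_measurable[OF entire_coherent, of w] by (subst integrable_fock_measure_iff) auto
  then show ?thesis by (simp add: fock_space_def entire_coherent)
qed

text \<open>
  The substitution \<open>z = w + \<zeta>\<close> turns the Gaussian weight times the conjugated kernel into the
  Gaussian weight centred at \<open>w\<close> times an entire function of \<open>\<zeta>\<close>, to which the mean value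
  property applies.
\<close>

theorem fock_reproducing:
  assumes F: "F \<in> fock_space"
  shows "fock_inner F (coherent w) = F w"
proof -
  define H where "H \<zeta> = F (w + \<zeta>) * exp ((- (1/2)) * (vcnj w \<bullet>\<^sub>c \<zeta>))" for \<zeta>
  have entH: "entire H"
    unfolding H_def[abs_def]
    by (rule entire_mult[OF entire_translate[OF fock_spaceD(2)[OF F]]
          entire_exp[OF entire_mult[OF entire_const entire_linear]]])
  define K where "K z = F z * cnj (coherent w z)" for z
  have intK: "integrable fock_measure K"
    unfolding K_def[abs_def] by (intro L2_inner_integrable fock_spaceD F coherent_in_fock_space)
  then have mK: "K \<in> borel_measurable borel"
    using borel_measurable_integrable measurable_fock_measure_iff by blast
  with intK have intK: "integrable lborel (\<lambda>z. fock_weight z *\<^sub>R K z)"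
    by (simp only: integrable_fock_measure_iff)
  have eq: "fock_weight (w + \<zeta>) *\<^sub>R K (w + \<zeta>) = fock_weight \<zeta> *\<^sub>R H \<zeta>" for \<zeta>
  proof -
    have n: "of_real (- (1/2) * (norm z)\<^sup>2) = - (1/2) * (z \<bullet>\<^sub>c vcnj z)" for z :: "complex ^ 'a"
      by (simp flip: norm_sq_cdot)
    have E: "exp (of_real (- (1/2) * (norm (w + \<zeta>))\<^sup>2)) * exp ((1/2) * (w \<bullet>\<^sub>c vcnj (w + \<zeta>)))
        = exp (of_real (- (1/2) * (norm \<zeta>)\<^sup>2)) * exp ((- (1/2)) * (vcnj w \<bullet>\<^sub>c \<zeta>))"
      unfolding exp_add[symmetric] n vcnj_add cdot_add_left cdot_add_right cdot_commute[of \<zeta> "vcnj w"]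
      by (intro arg_cong[of _ _ exp]) (simp add: algebra_simps)
    have K: "K (w + \<zeta>) = F (w + \<zeta>) * exp ((1/2) * (w \<bullet>\<^sub>c vcnj (w + \<zeta>)))"
      by (simp add: K_def coherent_def exp_cnj cnj_cdot)
    have alg: "(k * e) * (u * b) = (k * d) * (u * h)" if "e * b = d * h" for e b d h k u :: complex
    proof -
      have "(k * e) * (u * b) = (k * u) * (e * b)" by (simp only: mult_ac)
      also have "\<dots> = (k * d) * (u * h)" unfolding that by (simp only: mult_ac)
      finally show ?thesis .
    qed
    show ?thesis
      unfolding K H_def scaleR_conv_of_real of_real_mult[of "1 / (2 * pi) ^ CARD('a)"] exp_of_real[symmetric]
      by (rule alg[OF E])
  qed
  have "integrable fock_measure H"
    using lborel_integrable_translate[OF intK, of w]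
    unfolding eq by (simp only: integrable_fock_measure_iff[OF entire_measurable[OF entH]])
  then have "(LINT z|fock_measure. H z) = H 0" by (rule entire_fock_mean[OF entH])
  moreover have "fock_inner F (coherent w) = (LINT z|fock_measure. K z)"
    by (simp add: fock_inner_def K_def)
  moreover have "(LINT z|fock_measure. K z) = (LINT z|fock_measure. H z)"
  proof -
    have "(\<lambda>z. fock_weight z *\<^sub>R K z) \<in> borel_measurable borel"
      using borel_measurable_integrable[OF intK] by simp
    from lborel_integral_affine[OF this, of 1 w] show ?thesis
      unfolding integral_fock_measure[OF mK] integral_fock_measure[OF entire_measurable[OF entH]] scaleR_one eq
      by simp
  qed
  ultimately show ?thesis by (simp add: H_def)
qed

lemma fock_space_eqI:
  assumes "F \<in> fock_space" "H \<in> fock_space"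
    and "\<And>w. fock_inner F (coherent w) = fock_inner H (coherent w)"
  shows "F = H"
  using assms by (auto simp: fock_reproducing)


section \<open>The Gauss space\<close>

lemma sets_gauss [measurable_cong, simp]: "sets gauss = sets borel"
  and space_gauss [simp]: "space gauss = UNIV"
  by (simp_all add: gauss_def)

lemma measurable_gauss_iff: "f \<in> borel_measurable gauss \<longleftrightarrow> f \<in> borel_measurable borel"
  by (simp cong: measurable_cong_sets)

lemma integrable_gauss_iff:
  fixes f :: "real ^ 'n \<Rightarrow> 'b::{banach, second_countable_topology}"
  assumes "f \<in> borel_measurable borel"
  shows "integrable gauss f \<longleftrightarrow> integrable lborel (\<lambda>x. exp (- (norm x)\<^sup>2) *\<^sub>R f x)"
  unfolding gauss_def using assms by (intro integrable_density) auto

lemma integral_gauss: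
  fixes f :: "real ^ 'n \<Rightarrow> 'b::{banach, second_countable_topology}"
  assumes "f \<in> borel_measurable borel"
  shows "(LINT x|gauss. f x) = (LINT x|lborel. exp (- (norm x)\<^sup>2) *\<^sub>R f x)"
  unfolding gauss_def using assms by (intro integral_density) auto

lemma AE_gauss_iff: "(AE x in gauss. P x) \<longleftrightarrow> (AE x in lborel. P x)"
  unfolding gauss_def by (subst AE_density) auto

lemma finite_measure_gauss: "finite_measure (gauss :: (real ^ 'n) measure)"
proof
  have "(\<integral>\<^sup>+x. ennreal (exp (- (norm (x :: real ^ 'n))\<^sup>2)) \<partial>lborel)
      = ennreal (sqrt pi ^ CARD('n))"
    using gaussian_integral_norm[of 1, where 'a="real ^ 'n"]
    by (simp add: has_bochner_integral_iff nn_integral_eq_integral)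
  then show "emeasure (gauss :: (real ^ 'n) measure) (space gauss) \<noteq> \<infinity>"
    by (simp add: gauss_def emeasure_density)
qed

interpretation gauss: finite_measure "gauss :: (real ^ 'n) measure"
  by (rule finite_measure_gauss)

lemma L2_gauss_eq: "L2_gauss = L2 gauss"
  by (auto simp: L2_gauss_def L2_def measurable_gauss_iff)

lemma L2_gauss_inner_eq: "L2_gauss_inner = l2_inner gauss"
  by (simp add: L2_gauss_inner_def l2_inner_def fun_eq_iff)

lemma exp_norm_in_L2_gauss: "(\<lambda>\<xi> :: real ^ 'n. of_real (exp (r * norm \<xi>))) \<in> L2 gauss"
proof -
  let ?k = "\<lambda>\<xi> :: real ^ 'n. complex_of_real (exp (r * norm \<xi>))"
  have m: "?k \<in> borel_measurable borel" by measurable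
  have i: "integrable lborel (\<lambda>\<xi> :: real ^ 'n. exp (2 * r\<^sup>2) * exp (- (1/2) * (norm \<xi>)\<^sup>2))"
    using gaussian_integral_norm[of "1/2", where 'a="real ^ 'n"]
    by (intro integrable_mult_right) (simp add: has_bochner_integral_iff)
  have "integrable lborel (\<lambda>\<xi>. exp (- (norm \<xi>)\<^sup>2) *\<^sub>R (cmod (?k \<xi>))\<^sup>2)"
  proof (rule Bochner_Integration.integrable_bound[OF i], measurable, rule AE_I2)
    fix \<xi> :: "real ^ 'n"
    have "exp (- (norm \<xi>)\<^sup>2) * (exp (r * norm \<xi>))\<^sup>2 = exp (- (norm \<xi>)\<^sup>2 + 2 * (r * norm \<xi>))"
      by (simp only: exp_add exp_double)
    also have "\<dots> \<le> exp (2 * r\<^sup>2 + - (1/2) * (norm \<xi>)\<^sup>2)"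
      using zero_le_power2[of "2 * r - norm \<xi>"] by (simp add: power2_diff algebra_simps)
    finally show "norm (exp (- (norm \<xi>)\<^sup>2) *\<^sub>R (cmod (?k \<xi>))\<^sup>2)
        \<le> norm (exp (2 * r\<^sup>2) * exp (- (1/2) * (norm \<xi>)\<^sup>2))"
      by (simp only: exp_add) (simp add: norm_mult norm_power)
  qed
  then have "integrable gauss (\<lambda>\<xi>. (cmod (?k \<xi>))\<^sup>2)"
    by (subst integrable_gauss_iff) auto
  with m show ?thesis by (simp add: L2_def measurable_gauss_iff)
qed

text \<open>
  All functions to be paired with elements of \<open>L\<^sup>2(\<gamma>)\<close> (exponentials, exponentials times
  coordinates, indicators) are at most of exponential growth.
\<close>

lemma exp_growth_in_L2_gauss:
  fixes k :: "real ^ 'n \<Rightarrow> complex"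
  assumes k: "k \<in> borel_measurable borel" and le: "\<And>\<xi>. cmod (k \<xi>) \<le> exp (r * norm \<xi>)"
  shows "k \<in> L2 gauss"
proof -
  have "integrable gauss (\<lambda>\<xi>. (cmod (k \<xi>))\<^sup>2)"
  proof (rule Bochner_Integration.integrable_bound[OF L2_integrable[OF exp_norm_in_L2_gauss[of r]]])
    show "(\<lambda>\<xi>. (cmod (k \<xi>))\<^sup>2) \<in> borel_measurable gauss"
      using k by (simp add: measurable_gauss_iff)
    have "(cmod (k \<xi>))\<^sup>2 \<le> (exp (r * norm \<xi>))\<^sup>2" for \<xi>
      using le by (intro power_mono) auto
    then show "AE \<xi> in gauss. norm ((cmod (k \<xi>))\<^sup>2) \<le> norm ((cmod (of_real (exp (r * norm \<xi>))))\<^sup>2)"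
      by (intro AE_I2) (simp add: norm_power)
  qed
  with k show ?thesis by (simp add: L2_def measurable_gauss_iff)
qed

definition expf :: "complex ^ 'n \<Rightarrow> real ^ 'n \<Rightarrow> complex"
  where "expf u \<xi> = exp (u \<bullet>\<^sub>c cvec \<xi>)"

lemma expf_add: "expf (u + v) \<xi> = expf u \<xi> * expf v \<xi>"
  by (simp add: expf_def cdot_add_left exp_add)

lemma cnj_expf: "cnj (expf u \<xi>) = expf (vcnj u) \<xi>"
proof -
  have "vcnj (cvec \<xi>) = cvec \<xi>" by (simp add: vcnj_def cvec_def vec_eq_iff)
  then show ?thesis by (simp add: expf_def exp_cnj cnj_cdot)
qed

lemma continuous_on_expf: "continuous_on S (expf u)"
  unfolding expf_def[abs_def] cdot_def cvec_def by (intro continuous_intros)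

lemma expf_measurable [measurable]: "expf u \<in> borel_measurable borel"
  by (rule borel_measurable_continuous_onI[OF continuous_on_expf])

lemma norm_cvec [simp]: "norm (cvec x) = norm x"
  by (simp add: norm_vec_def cvec_def)

lemma norm_vcnj [simp]: "norm (vcnj u) = norm u"
  by (simp add: norm_vec_def vcnj_def)

lemma cmod_cdot_le: "cmod (u \<bullet>\<^sub>c v) \<le> norm u * norm v"
proof -
  have "cmod (u \<bullet>\<^sub>c v) \<le> (\<Sum>j\<in>UNIV. cmod (u $ j) * cmod (v $ j))"
    unfolding cdot_def by (rule order_trans[OF norm_sum]) (simp add: norm_mult)
  also have "\<dots> \<le> L2_set (\<lambda>j. cmod (u $ j)) UNIV * L2_set (\<lambda>j. cmod (v $ j)) UNIV"
    using L2_set_mult_ineq[of "\<lambda>j. cmod (u $ j)" "\<lambda>j. cmod (v $ j)" UNIV] by simp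
  finally show ?thesis by (simp add: norm_vec_def)
qed

lemma cmod_expf_le: "cmod (expf u \<xi>) \<le> exp (norm u * norm \<xi>)"
proof -
  have "cmod (expf u \<xi>) = exp (Re (u \<bullet>\<^sub>c cvec \<xi>))" by (simp add: expf_def norm_exp_eq_Re)
  also have "\<dots> \<le> exp (norm u * norm \<xi>)"
    using order_trans[OF complex_Re_le_cmod cmod_cdot_le[of u "cvec \<xi>"]] by simp
  finally show ?thesis .
qed

lemma expf_in_L2_gauss: "expf u \<in> L2 gauss"
  by (rule exp_growth_in_L2_gauss[OF expf_measurable cmod_expf_le])

lemma sum_Basis_real_vec: "(\<Sum>b\<in>(Basis :: (real ^ 'n) set). g b) = (\<Sum>j\<in>UNIV. g (axis j 1))"
proof -
  have B: "(Basis :: (real ^ 'n) set) = (\<lambda>j. axis j 1) ` UNIV"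
    by (auto simp: Basis_vec_def)
  have inj: "inj (\<lambda>j::'n. axis j (1::real))"
    by (auto intro!: injI simp: axis_eq_axis)
  show ?thesis unfolding B by (subst sum.reindex[OF inj]) simp
qed

lemma integral_expf_gauss:
  fixes u :: "complex ^ 'n"
  shows "(LINT \<xi>|gauss. expf u \<xi>) = of_real (sqrt pi ^ CARD('n)) * exp ((1/4) * (u \<bullet>\<^sub>c u))"
proof -
  define c where "c b = u \<bullet>\<^sub>c cvec b" for b :: "real ^ 'n"
  have c: "c (axis j 1) = u $ j" for j
    by (simp add: c_def cdot_def cvec_def axis_def if_distrib[of of_real] if_distrib[of "(*) _"] cong: if_cong)
  have "(\<Sum>b\<in>Basis. c b * of_real (\<xi> \<bullet> b)) = u \<bullet>\<^sub>c cvec \<xi>" for \<xi>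
    by (simp add: sum_Basis_real_vec c inner_axis cdot_def cvec_def)
  moreover have "(\<Sum>b\<in>Basis. (c b)\<^sup>2) = u \<bullet>\<^sub>c u"
    by (simp add: sum_Basis_real_vec c cdot_def power2_eq_square)
  ultimately have "(LINT \<xi>|lborel. exp (of_real (- 1 * (norm \<xi>)\<^sup>2) + u \<bullet>\<^sub>c cvec \<xi>))
      = of_real (sqrt (pi / 1) ^ CARD('n)) * exp ((u \<bullet>\<^sub>c u) / (4 * of_real 1))"
    using has_bochner_integral_integral_eq[OF gaussian_integral[of 1 c]] by simp
  moreover have "exp (of_real (- 1 * (norm \<xi>)\<^sup>2) + u \<bullet>\<^sub>c cvec \<xi>) = exp (- (norm \<xi>)\<^sup>2) *\<^sub>R expf u \<xi>" for \<xi>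
    by (simp only: exp_add expf_def scaleR_conv_of_real exp_of_real mult_minus1)
  ultimately show ?thesis by (simp add: integral_gauss[OF expf_measurable])
qed

lemma gauss_fourier_injective:
  fixes g :: "real ^ 'n \<Rightarrow> complex"
  assumes g: "integrable gauss g"
    and zero: "\<And>a. (LINT \<xi>|gauss. g \<xi> * expf (\<i> *s cvec a) \<xi>) = 0"
  shows "AE \<xi> in lborel. g \<xi> = 0"
proof -
  have m: "g \<in> borel_measurable borel"
    using borel_measurable_integrable[OF g] by (simp add: measurable_gauss_iff)
  have "AE \<xi> in lborel. exp (- (norm \<xi>)\<^sup>2) *\<^sub>R g \<xi> = 0"
  proof (rule fourier_transform_injective)
    show "integrable lborel (\<lambda>\<xi>. exp (- (norm \<xi>)\<^sup>2) *\<^sub>R g \<xi>)"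
      using g by (simp add: integrable_gauss_iff[OF m])
    fix a :: "real ^ 'n"
    have "expf (\<i> *s cvec a) \<xi> = exp (\<i> * of_real (a \<bullet> \<xi>))" for \<xi>
      by (simp add: expf_def cdot_smult_left) (simp add: cdot_def cvec_def inner_vec_def)
    moreover have "(\<lambda>\<xi>. g \<xi> * expf (\<i> *s cvec a) \<xi>) \<in> borel_measurable borel" using m by measurable
    ultimately show "(LINT \<xi>|lborel. (exp (- (norm \<xi>)\<^sup>2) *\<^sub>R g \<xi>) * exp (\<i> * of_real (a \<bullet> \<xi>))) = 0"
      using zero[of a] by (simp add: integral_gauss)
  qed
  then show ?thesis by eventually_elim simp
qed


section \<open>The Gauss--Bargmann transform\<close>

lemma gauss_bargmann_expf_integral:
  assumes "f \<in> L2 gauss"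
  shows "gauss_bargmann f z = exp ((1/4) * (z \<bullet>\<^sub>c z)) * (LINT \<xi>|gauss. f \<xi> * expf (\<i> *s z) \<xi>)"
  using gauss_bargmann_alt[of f z] L2_measurable[OF assms]
  by (simp add: measurable_gauss_iff expf_def cdot_smult_left)

lemma has_derivative_quadratic_remainder:
  fixes F :: "'a::real_normed_vector \<Rightarrow> 'b::real_normed_vector"
  assumes L: "bounded_linear L"
    and rem: "\<And>h. norm h \<le> 1 \<Longrightarrow> norm (F (x + h) - F x - L h) \<le> K * (norm h)\<^sup>2"
  shows "(F has_derivative L) (at x)"
  unfolding has_derivative_at
proof (intro conjI L)
  show "(\<lambda>h. norm (F (x + h) - F x - L h) / norm h) \<midarrow>0\<rightarrow> 0"
  proof (rule Lim_null_comparison)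
    show "\<forall>\<^sub>F h in at 0. norm (norm (F (x + h) - F x - L h) / norm h) \<le> K * norm h"
      unfolding eventually_at
    proof (intro exI[of _ 1] conjI ballI impI)
      fix h :: 'a assume "h \<noteq> 0 \<and> dist h 0 < 1"
      then have "norm (F (x + h) - F x - L h) \<le> K * (norm h)\<^sup>2" "norm h > 0" by (auto intro!: rem)
      then show "norm (norm (F (x + h) - F x - L h) / norm h) \<le> K * norm h"
        by (simp add: divide_le_eq power2_eq_square)
    qed simp
    show "((\<lambda>h. K * norm h) \<longlongrightarrow> 0) (at 0)" by (auto intro!: tendsto_eq_intros)
  qed
qed

lemma cmod_exp_remainder_le: "cmod (exp w - 1 - w) \<le> (cmod w)\<^sup>2 * exp (cmod w)"
proof -
  have "cmod (exp w - (\<Sum>i\<le>1. w ^ i / fact i)) \<le> exp \<bar>Re w\<bar> * cmod w ^ Suc 1 / fact 1"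
    by (rule Taylor_exp)
  also have "\<dots> \<le> exp (cmod w) * (cmod w)\<^sup>2"
    using abs_Re_le_cmod[of w] by (simp add: power2_eq_square mult_right_mono)
  finally show ?thesis by (simp add: algebra_simps)
qed

text \<open>
  Differentiation under the integral sign: the second order Taylor remainder of the exponential
  is at most \<open>\<parallel>h\<parallel>\<^sup>2\<close> times a function of exponential growth that does not depend on \<open>h\<close>.
\<close>

lemma entire_laplace_transform:
  fixes f :: "real ^ 'n \<Rightarrow> complex"
  assumes f: "f \<in> L2 gauss"
  shows "entire (\<lambda>u. LINT \<xi>|gauss. f \<xi> * expf u \<xi>)"
  unfolding entire_def
proof (intro allI exI)
  fix u :: "complex ^ 'n"
  \<comment> \<open>The exponent \<open>3\<close> comes from \<open>\<parallel>\<xi>\<parallel>\<^sup>2 e\<^sup>\<parallel>\<^sup>\<xi>\<^sup>\<parallel> \<le> e\<^sup>3\<^sup>\<parallel>\<^sup>\<xi>\<^sup>\<parallel>\<close>, which covers the remainder for \<open>\<parallel>h\<parallel> \<le> 1\<close>.\<close>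
  define E where "E \<xi> = complex_of_real (exp ((norm u + 3) * norm \<xi>))" for \<xi> :: "real ^ 'n"
  have E: "E \<in> L2 gauss" unfolding E_def[abs_def] by (rule exp_norm_in_L2_gauss)
  have le_exp: "x \<le> exp x" for x :: real using exp_ge_add_one_self[of x] by linarith
  have coord: "(\<lambda>\<xi>. of_real (\<xi> $ j) * expf u \<xi>) \<in> L2 gauss" for j
  proof (rule exp_growth_in_L2_gauss[where r="1 + norm u"])
    show "(\<lambda>\<xi>. of_real (\<xi> $ j) * expf u \<xi>) \<in> borel_measurable borel"
      by (intro borel_measurable_continuous_onI continuous_intros continuous_on_expf)
    fix \<xi> :: "real ^ 'n"
    have "cmod (of_real (\<xi> $ j) * expf u \<xi>) \<le> exp (norm \<xi>) * exp (norm u * norm \<xi>)"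
      unfolding norm_mult norm_of_real
      using order_trans[OF component_le_norm_cart le_exp] by (intro mult_mono cmod_expf_le) auto
    then show "cmod (of_real (\<xi> $ j) * expf u \<xi>) \<le> exp ((1 + norm u) * norm \<xi>)"
      by (simp add: exp_add[symmetric] algebra_simps)
  qed
  define D where "D = (\<chi> j. LINT \<xi>|gauss. f \<xi> * (of_real (\<xi> $ j) * expf u \<xi>))"
  show "((\<lambda>u. LINT \<xi>|gauss. f \<xi> * expf u \<xi>) has_derivative (\<lambda>h. D \<bullet>\<^sub>c h)) (at u)"
  proof (rule has_derivative_quadratic_remainder[OF cdot_bounded_linear])
    fix h :: "complex ^ 'n" assume h: "norm h \<le> 1"
    have int: "integrable gauss (\<lambda>\<xi>. f \<xi> * expf v \<xi>)" for v
      by (rule L2_prod_integrable[OF f expf_in_L2_gauss])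
    have intc: "integrable gauss (\<lambda>\<xi>. h $ j * (f \<xi> * (of_real (\<xi> $ j) * expf u \<xi>)))" for j
      by (intro integrable_mult_right L2_prod_integrable[OF f coord])
    have sumc: "(\<Sum>j\<in>UNIV. h $ j * (f \<xi> * (of_real (\<xi> $ j) * expf u \<xi>))) = f \<xi> * ((h \<bullet>\<^sub>c cvec \<xi>) * expf u \<xi>)" for \<xi>
      by (simp add: cdot_def cvec_def sum_distrib_left sum_distrib_right mult_ac)
    have Dh: "D \<bullet>\<^sub>c h = (LINT \<xi>|gauss. f \<xi> * ((h \<bullet>\<^sub>c cvec \<xi>) * expf u \<xi>))"
    proof -
      have "D \<bullet>\<^sub>c h = (\<Sum>j\<in>UNIV. LINT \<xi>|gauss. h $ j * (f \<xi> * (of_real (\<xi> $ j) * expf u \<xi>)))"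
        by (simp add: D_def cdot_def mult.commute)
      also have "\<dots> = (LINT \<xi>|gauss. (\<Sum>j\<in>UNIV. h $ j * (f \<xi> * (of_real (\<xi> $ j) * expf u \<xi>))))"
        by (rule Bochner_Integration.integral_sum[symmetric]) (rule intc)
      finally show ?thesis by (simp only: sumc)
    qed
    have inth: "integrable gauss (\<lambda>\<xi>. f \<xi> * ((h \<bullet>\<^sub>c cvec \<xi>) * expf u \<xi>))"
    proof -
      have "integrable gauss (\<lambda>\<xi>. \<Sum>j\<in>UNIV. h $ j * (f \<xi> * (of_real (\<xi> $ j) * expf u \<xi>)))"
        by (rule Bochner_Integration.integrable_sum) (rule intc)
      then show ?thesis by (simp only: sumc)
    qed
    have "(LINT \<xi>|gauss. f \<xi> * expf (u + h) \<xi>) - (LINT \<xi>|gauss. f \<xi> * expf u \<xi>) - D \<bullet>\<^sub>c h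
        = (LINT \<xi>|gauss. f \<xi> * expf (u + h) \<xi> - f \<xi> * expf u \<xi> - f \<xi> * ((h \<bullet>\<^sub>c cvec \<xi>) * expf u \<xi>))"
      using int inth by (simp add: Dh)
    also have "norm \<dots> \<le> (LINT \<xi>|gauss. (norm h)\<^sup>2 * cmod (f \<xi> * E \<xi>))"
    proof (rule Bochner_Integration.integral_norm_bound_integral)
      show "integrable gauss (\<lambda>\<xi>. f \<xi> * expf (u + h) \<xi> - f \<xi> * expf u \<xi> - f \<xi> * ((h \<bullet>\<^sub>c cvec \<xi>) * expf u \<xi>))"
        using int inth by simp
      show "integrable gauss (\<lambda>\<xi>. (norm h)\<^sup>2 * cmod (f \<xi> * E \<xi>))"
        by (intro integrable_mult_right integrable_norm L2_prod_integrable f E)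
      fix \<xi> :: "real ^ 'n"
      define w where "w = h \<bullet>\<^sub>c cvec \<xi>"
      have w: "cmod w \<le> norm h * norm \<xi>" unfolding w_def using cmod_cdot_le[of h "cvec \<xi>"] by simp
      have w1: "cmod w \<le> norm \<xi>"
        using w h mult_right_mono[OF h norm_ge_zero[of \<xi>]] by linarith
      have "cmod (exp w - 1 - w) \<le> (cmod w)\<^sup>2 * exp (cmod w)" by (rule cmod_exp_remainder_le)
      also have "\<dots> \<le> (norm h * norm \<xi>)\<^sup>2 * exp (norm \<xi>)"
        using w w1 by (intro mult_mono power_mono) auto
      also have "\<dots> \<le> (norm h * exp (norm \<xi>))\<^sup>2 * exp (norm \<xi>)"
        using le_exp by (intro mult_right_mono power_mono mult_left_mono) auto
      also have "\<dots> = (norm h)\<^sup>2 * exp (3 * norm \<xi>)"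
        by (simp add: power_mult_distrib exp_double[symmetric] exp_add[symmetric])
      finally have R: "cmod (exp w - 1 - w) \<le> (norm h)\<^sup>2 * exp (3 * norm \<xi>)" .
      have "f \<xi> * expf (u + h) \<xi> - f \<xi> * expf u \<xi> - f \<xi> * ((h \<bullet>\<^sub>c cvec \<xi>) * expf u \<xi>)
          = f \<xi> * expf u \<xi> * (exp w - 1 - w)"
        unfolding expf_add by (simp add: w_def expf_def[of h] algebra_simps)
      then have "norm (f \<xi> * expf (u + h) \<xi> - f \<xi> * expf u \<xi> - f \<xi> * ((h \<bullet>\<^sub>c cvec \<xi>) * expf u \<xi>))
          = cmod (f \<xi>) * (cmod (expf u \<xi>) * cmod (exp w - 1 - w))"
        by (simp add: norm_mult)
      also have "\<dots> \<le> cmod (f \<xi>) * (exp (norm u * norm \<xi>) * ((norm h)\<^sup>2 * exp (3 * norm \<xi>)))"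
        by (intro mult_left_mono mult_mono cmod_expf_le R) auto
      also have "\<dots> = (norm h)\<^sup>2 * cmod (f \<xi> * E \<xi>)"
        by (simp add: E_def norm_mult exp_add[symmetric] algebra_simps)
      finally show "norm (f \<xi> * expf (u + h) \<xi> - f \<xi> * expf u \<xi> - f \<xi> * ((h \<bullet>\<^sub>c cvec \<xi>) * expf u \<xi>))
          \<le> (norm h)\<^sup>2 * cmod (f \<xi> * E \<xi>)" .
    qed
    also have "\<dots> = (LINT \<xi>|gauss. cmod (f \<xi> * E \<xi>)) * (norm h)\<^sup>2" by simp
    finally show "norm ((LINT \<xi>|gauss. f \<xi> * expf (u + h) \<xi>) - (LINT \<xi>|gauss. f \<xi> * expf u \<xi>) - D \<bullet>\<^sub>c h)
        \<le> (LINT \<xi>|gauss. cmod (f \<xi> * E \<xi>)) * (norm h)\<^sup>2" .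
  qed
qed

lemma entire_gauss_bargmann:
  assumes f: "f \<in> L2 gauss"
  shows "entire (gauss_bargmann f)"
proof -
  have "gauss_bargmann f = (\<lambda>z. exp ((1/4) * (z \<bullet>\<^sub>c z)) * (LINT \<xi>|gauss. f \<xi> * expf (\<i> *s z) \<xi>))"
    by (rule ext) (rule gauss_bargmann_expf_integral[OF f])
  moreover have "entire (\<lambda>z. exp ((1/4) * (z \<bullet>\<^sub>c z)) * (LINT \<xi>|gauss. f \<xi> * expf (\<i> *s z) \<xi>))"
    by (rule entire_mult[OF entire_exp[OF entire_mult[OF entire_const entire_cdot_self]]
        entire_scale[OF entire_laplace_transform[OF f]]])
  ultimately show ?thesis by simp
qed

lemma gauss_bargmann_inner:
  assumes "f \<in> L2 gauss"
  shows "gauss_bargmann f z = exp ((1/4) * (z \<bullet>\<^sub>c z)) * l2_inner gauss f (expf (vcnj (\<i> *s z)))"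
  using gauss_bargmann_expf_integral[OF assms] by (simp add: l2_inner_def cnj_expf)

lemma gauss_bargmann_add:
  assumes "f \<in> L2 gauss" "g \<in> L2 gauss"
  shows "gauss_bargmann (\<lambda>\<xi>. f \<xi> + g \<xi>) = (\<lambda>z. gauss_bargmann f z + gauss_bargmann g z)"
  using assms by (simp add: fun_eq_iff gauss_bargmann_inner L2_add l2_inner_add_left expf_in_L2_gauss distrib_left)

lemma gauss_bargmann_cmult:
  assumes "f \<in> L2 gauss"
  shows "gauss_bargmann (\<lambda>\<xi>. c * f \<xi>) = (\<lambda>z. c * gauss_bargmann f z)"
  using assms by (simp add: fun_eq_iff gauss_bargmann_inner L2_cmult l2_inner_cmult_left)

lemma gauss_bargmann_expf:
  fixes u :: "complex ^ 'n"
  shows "gauss_bargmann (expf u) =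
    (\<lambda>z. of_real (sqrt pi ^ CARD('n)) * exp ((1/4) * (u \<bullet>\<^sub>c u)) * coherent (vcnj (\<i> *s u)) z)"
proof
  fix z :: "complex ^ 'n"
  have "gauss_bargmann (expf u) z = exp ((1/4) * (z \<bullet>\<^sub>c z)) * (LINT \<xi>|gauss. expf (u + \<i> *s z) \<xi>)"
    by (simp add: gauss_bargmann_expf_integral expf_in_L2_gauss expf_add)
  also have "\<dots> = of_real (sqrt pi ^ CARD('n)) * (exp ((1/4) * (z \<bullet>\<^sub>c z)) *
      exp ((1/4) * ((u + \<i> *s z) \<bullet>\<^sub>c (u + \<i> *s z))))"
    by (simp add: integral_expf_gauss)
  also have "exp ((1/4) * (z \<bullet>\<^sub>c z)) * exp ((1/4) * ((u + \<i> *s z) \<bullet>\<^sub>c (u + \<i> *s z)))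
      = exp ((1/4) * (u \<bullet>\<^sub>c u)) * exp ((1/2) * ((\<i> *s u) \<bullet>\<^sub>c z))"
    unfolding exp_add[symmetric] cdot_add_left cdot_add_right cdot_smult_left cdot_smult_right cdot_commute[of z u]
    by (intro arg_cong[of _ _ exp]) (simp add: algebra_simps)
  finally show "gauss_bargmann (expf u) z
      = of_real (sqrt pi ^ CARD('n)) * exp ((1/4) * (u \<bullet>\<^sub>c u)) * coherent (vcnj (\<i> *s u)) z"
    by (simp add: coherent_def mult.assoc)
qed

lemma gauss_bargmann_expf_in_fock_space: "gauss_bargmann (expf u) \<in> fock_space"
  unfolding gauss_bargmann_expf by (rule fock_space_cmult[OF coherent_in_fock_space])

text \<open>
  The reproducing property evaluates this inner product without any double integral. The
  hypothesis that \<open>Gf\<close> lies in the Fock space is discharged for all \<open>f\<close> later, by density.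
\<close>

lemma fock_inner_gauss_bargmann_expf:
  fixes u :: "complex ^ 'n"
  assumes f: "f \<in> L2 gauss" and Gf: "gauss_bargmann f \<in> fock_space"
  shows "fock_inner (gauss_bargmann f) (gauss_bargmann (expf u))
    = of_real (sqrt pi ^ CARD('n)) * l2_inner gauss f (expf u)"
proof -
  define w where "w = vcnj (\<i> *s u)"
  have w: "vcnj (\<i> *s w) = u" by (simp add: w_def vcnj_def vec_eq_iff)
  have ww: "w \<bullet>\<^sub>c w = - cnj (u \<bullet>\<^sub>c u)"
    by (simp add: w_def cnj_cdot[symmetric] cdot_smult_left cdot_smult_right)
  have "fock_inner (gauss_bargmann f) (gauss_bargmann (expf u))
      = cnj (of_real (sqrt pi ^ CARD('n)) * exp ((1/4) * (u \<bullet>\<^sub>c u))) * fock_inner (gauss_bargmann f) (coherent w)"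
    unfolding gauss_bargmann_expf fock_inner_eq l2_inner_cmult_right w_def ..
  also have "fock_inner (gauss_bargmann f) (coherent w) = exp ((1/4) * (w \<bullet>\<^sub>c w)) * l2_inner gauss f (expf u)"
    using fock_reproducing[OF Gf, of w] by (simp add: gauss_bargmann_inner[OF f] w)
  also have "cnj (of_real (sqrt pi ^ CARD('n)) * exp ((1/4) * (u \<bullet>\<^sub>c u))) *
      (exp ((1/4) * (w \<bullet>\<^sub>c w)) * l2_inner gauss f (expf u))
    = of_real (sqrt pi ^ CARD('n)) * (exp ((1/4) * cnj (u \<bullet>\<^sub>c u) + (1/4) * (w \<bullet>\<^sub>c w)) * l2_inner gauss f (expf u))"
    by (simp add: exp_add exp_cnj mult.assoc)
  finally show ?thesis by (simp add: ww)
qed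

text \<open>
  The functions on which \<open>G\<close> respects the inner product with every function that
  \<open>G\<close> maps into the Fock space. In this form the set is visibly a linear subspace, and it contains
  the exponentials; in the end it is all of \<open>L\<^sup>2(\<gamma>)\<close>.
\<close>

definition gb_isometric :: "(real ^ 'n \<Rightarrow> complex) set"
  where "gb_isometric = {p \<in> L2 gauss. gauss_bargmann p \<in> fock_space \<and>
    (\<forall>q\<in>L2 gauss. gauss_bargmann q \<in> fock_space \<longrightarrow>
      fock_inner (gauss_bargmann p) (gauss_bargmann q) = of_real (sqrt pi ^ CARD('n)) * l2_inner gauss p q)}"

lemma expf_gb_isometric: "expf u \<in> gb_isometric"
  unfolding gb_isometric_def mem_Collect_eq
proof (intro conjI ballI impI expf_in_L2_gauss gauss_bargmann_expf_in_fock_space)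
  fix q :: "real ^ 'a \<Rightarrow> complex" assume q: "q \<in> L2 gauss" "gauss_bargmann q \<in> fock_space"
  have "fock_inner (gauss_bargmann (expf u)) (gauss_bargmann q)
      = cnj (fock_inner (gauss_bargmann q) (gauss_bargmann (expf u)))"
    unfolding fock_inner_eq by (rule l2_inner_cnj)
  also have "\<dots> = of_real (sqrt pi ^ CARD('a)) * cnj (l2_inner gauss q (expf u))"
    by (simp add: fock_inner_gauss_bargmann_expf[OF q])
  also have "cnj (l2_inner gauss q (expf u)) = l2_inner gauss (expf u) q"
    by (rule l2_inner_cnj[symmetric])
  finally show "fock_inner (gauss_bargmann (expf u)) (gauss_bargmann q)
      = of_real (sqrt pi ^ CARD('a)) * l2_inner gauss (expf u) q" .
qed

lemma gb_isometric_add: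
  assumes "p \<in> gb_isometric" "q \<in> gb_isometric"
  shows "(\<lambda>\<xi>. p \<xi> + q \<xi>) \<in> gb_isometric"
  using assms unfolding gb_isometric_def
  by (auto simp: gauss_bargmann_add L2_add fock_space_add fock_inner_eq l2_inner_add_left fock_spaceD distrib_left)

lemma gb_isometric_cmult:
  assumes "p \<in> gb_isometric"
  shows "(\<lambda>\<xi>. c * p \<xi>) \<in> gb_isometric"
  using assms unfolding gb_isometric_def
  by (auto simp: gauss_bargmann_cmult L2_cmult fock_space_cmult fock_inner_eq l2_inner_cmult_left)

lemma gb_isometric_norm:
  fixes p :: "real ^ 'n \<Rightarrow> complex"
  assumes p: "p \<in> gb_isometric"
  shows "fock_norm (gauss_bargmann p) = sqrt (sqrt pi ^ CARD('n)) * l2_norm gauss p"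
proof -
  have "l2_inner fock_measure (gauss_bargmann p) (gauss_bargmann p)
      = of_real (sqrt pi ^ CARD('n)) * l2_inner gauss p p"
    using p by (simp add: gb_isometric_def fock_inner_eq)
  then have "of_real ((l2_norm fock_measure (gauss_bargmann p))\<^sup>2)
      = complex_of_real (sqrt pi ^ CARD('n) * (l2_norm gauss p)\<^sup>2)"
    by (simp only: l2_inner_self of_real_mult)
  then have "(l2_norm fock_measure (gauss_bargmann p))\<^sup>2 = sqrt pi ^ CARD('n) * (l2_norm gauss p)\<^sup>2"
    by (simp only: of_real_eq_iff)
  then have "sqrt ((l2_norm fock_measure (gauss_bargmann p))\<^sup>2) = sqrt (sqrt pi ^ CARD('n) * (l2_norm gauss p)\<^sup>2)"
    by simp
  then show ?thesis
    by (simp only: fock_norm_eq real_sqrt_mult real_sqrt_abs abs_of_nonneg[OF l2_norm_nonneg])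
qed

text \<open>
  A function orthogonal to all characters \<open>e\<^sup>i\<^sup>a\<^sup>\<xi>\<close> vanishes, by injectivity of the Fourier transform.
\<close>

lemma gb_isometric_dense:
  assumes f: "f \<in> L2 gauss"
  shows "\<exists>p. (\<forall>n. p n \<in> gb_isometric) \<and> (\<lambda>n. l2_norm gauss (\<lambda>\<xi>. p n \<xi> - f \<xi>)) \<longlonglongrightarrow> 0"
proof (rule gauss.L2_dense_if_orthogonal_trivial[OF _ _ gb_isometric_add gb_isometric_cmult _ f])
  show "gb_isometric \<subseteq> L2 gauss" by (auto simp: gb_isometric_def)
  show "(\<lambda>\<xi>. 0) \<in> gb_isometric" using gb_isometric_cmult[OF expf_gb_isometric, of 0] by simp
  fix g :: "real ^ 'a \<Rightarrow> complex"
  assume g: "g \<in> L2 gauss" and orth: "\<And>p. p \<in> gb_isometric \<Longrightarrow> l2_inner gauss g p = 0"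
  have "AE \<xi> in lborel. g \<xi> = 0"
  proof (rule gauss_fourier_injective[OF gauss.L2_imp_integrable[OF g]])
    fix a :: "real ^ 'a"
    show "(LINT \<xi>|gauss. g \<xi> * expf (\<i> *s cvec a) \<xi>) = 0"
      using orth[OF expf_gb_isometric, of "vcnj (\<i> *s cvec a)"] by (simp add: l2_inner_def cnj_expf)
  qed
  then show "AE \<xi> in gauss. g \<xi> = 0" by (simp add: AE_gauss_iff)
qed

text \<open>
  Pointwise, \<open>G\<close> is an inner product with an exponential, so \<open>G(p n)\<close> converges pointwise to \<open>Gf\<close> when
  \<open>p n\<close> converges to \<open>f\<close>. Fatou's lemma then transfers the norm identity for \<open>p n\<close> to a bound for \<open>f\<close>.
\<close>

lemma
  fixes f :: "real ^ 'n \<Rightarrow> complex"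
  assumes f: "f \<in> L2 gauss"
  shows gauss_bargmann_in_fock_space: "gauss_bargmann f \<in> fock_space"
    and gauss_bargmann_norm_le: "fock_norm (gauss_bargmann f) \<le> sqrt (sqrt pi ^ CARD('n)) * l2_norm gauss f"
proof -
  define s where "s = sqrt (sqrt pi ^ CARD('n))"
  have s: "s > 0" by (simp add: s_def)
  obtain p where p: "\<And>n. p n \<in> gb_isometric" and lim: "(\<lambda>n. l2_norm gauss (\<lambda>\<xi>. p n \<xi> - f \<xi>)) \<longlonglongrightarrow> 0"
    using gb_isometric_dense[OF f] by blast
  have pL: "p n \<in> L2 gauss" for n using p by (auto simp: gb_isometric_def)
  have Gp: "gauss_bargmann (p n) \<in> L2 fock_measure" for n
    using p by (auto simp: gb_isometric_def fock_spaceD)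
  have Gm: "gauss_bargmann f \<in> borel_measurable fock_measure"
    using entire_measurable[OF entire_gauss_bargmann[OF f]] by (simp add: measurable_fock_measure_iff)
  have pt: "AE z in fock_measure. (\<lambda>n. gauss_bargmann (p n) z) \<longlonglongrightarrow> gauss_bargmann f z"
    unfolding gauss_bargmann_inner[OF pL] gauss_bargmann_inner[OF f]
    by (intro AE_I2 tendsto_mult tendsto_const l2_inner_tendsto pL f expf_in_L2_gauss lim)
  have main: "gauss_bargmann f \<in> L2 fock_measure \<and> l2_norm fock_measure (gauss_bargmann f) \<le> s * l2_norm gauss f + e"
    if e: "e > 0" for e
  proof -
    have "(\<lambda>n. s * l2_norm gauss (p n)) \<longlonglongrightarrow> s * l2_norm gauss f"
      by (intro tendsto_mult tendsto_const l2_norm_tendsto pL f lim)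
    then have "\<forall>\<^sub>F n in sequentially. s * l2_norm gauss (p n) < s * l2_norm gauss f + e"
      using e by (intro order_tendstoD(2)) auto
    then have "\<forall>\<^sub>F n in sequentially. l2_norm fock_measure (gauss_bargmann (p n)) \<le> s * l2_norm gauss f + e"
      by eventually_elim (use gb_isometric_norm[OF p] in \<open>simp add: s_def fock_norm_eq\<close>)
    from L2_fatou[OF Gp Gm pt this] show ?thesis by blast
  qed
  show "gauss_bargmann f \<in> fock_space"
    using main[of 1] entire_gauss_bargmann[OF f] by (simp add: fock_space_altdef)
  have "l2_norm fock_measure (gauss_bargmann f) \<le> s * l2_norm gauss f"
    by (rule field_le_epsilon) (use main in blast)
  then show "fock_norm (gauss_bargmann f) \<le> sqrt (sqrt pi ^ CARD('n)) * l2_norm gauss f"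
    by (simp add: fock_norm_eq s_def)
qed

theorem gauss_bargmann_isometry:
  fixes f g :: "real ^ 'n \<Rightarrow> complex"
  assumes f: "f \<in> L2 gauss" and g: "g \<in> L2 gauss"
  shows "fock_inner (gauss_bargmann f) (gauss_bargmann g) = of_real (sqrt pi ^ CARD('n)) * l2_inner gauss f g"
proof -
  obtain p where p: "\<And>n. p n \<in> gb_isometric" and lim: "(\<lambda>n. l2_norm gauss (\<lambda>\<xi>. p n \<xi> - f \<xi>)) \<longlonglongrightarrow> 0"
    using gb_isometric_dense[OF f] by blast
  have pL: "p n \<in> L2 gauss" for n using p by (auto simp: gb_isometric_def)
  have diff: "gauss_bargmann (\<lambda>\<xi>. p n \<xi> - f \<xi>) = (\<lambda>z. gauss_bargmann (p n) z - gauss_bargmann f z)" for n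
    using gauss_bargmann_add[OF pL L2_cmult[OF f, of "-1"], of n] gauss_bargmann_cmult[OF f, of "-1"] by simp
  have "(\<lambda>n. l2_norm fock_measure (\<lambda>z. gauss_bargmann (p n) z - gauss_bargmann f z)) \<longlonglongrightarrow> 0"
  proof (rule Lim_null_comparison)
    show "\<forall>\<^sub>F n in sequentially. norm (l2_norm fock_measure (\<lambda>z. gauss_bargmann (p n) z - gauss_bargmann f z))
        \<le> sqrt (sqrt pi ^ CARD('n)) * l2_norm gauss (\<lambda>\<xi>. p n \<xi> - f \<xi>)"
      using gauss_bargmann_norm_le[OF L2_diff[OF pL f]]
      by (intro always_eventually allI) (simp only: diff fock_norm_eq real_norm_def abs_of_nonneg[OF l2_norm_nonneg])
    show "(\<lambda>n. sqrt (sqrt pi ^ CARD('n)) * l2_norm gauss (\<lambda>\<xi>. p n \<xi> - f \<xi>)) \<longlonglongrightarrow> 0"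
      using tendsto_mult_right_zero[OF lim] by simp
  qed
  then have lim1: "(\<lambda>n. fock_inner (gauss_bargmann (p n)) (gauss_bargmann g)) \<longlonglongrightarrow> fock_inner (gauss_bargmann f) (gauss_bargmann g)"
    unfolding fock_inner_eq
    by (intro l2_inner_tendsto fock_spaceD gauss_bargmann_in_fock_space pL f g)
  moreover have eq: "fock_inner (gauss_bargmann (p n)) (gauss_bargmann g)
      = of_real (sqrt pi ^ CARD('n)) * l2_inner gauss (p n) g" for n
    using p[of n] g gauss_bargmann_in_fock_space[OF g] by (simp add: gb_isometric_def)
  moreover have "(\<lambda>n. of_real (sqrt pi ^ CARD('n)) * l2_inner gauss (p n) g)
      \<longlonglongrightarrow> of_real (sqrt pi ^ CARD('n)) * l2_inner gauss f g"
    by (intro tendsto_mult tendsto_const l2_inner_tendsto pL f g lim)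
  ultimately have "(\<lambda>n. fock_inner (gauss_bargmann (p n)) (gauss_bargmann g))
      \<longlonglongrightarrow> of_real (sqrt pi ^ CARD('n)) * l2_inner gauss f g" by (simp only: eq)
  with lim1 show ?thesis by (rule LIMSEQ_unique)
qed

lemma gauss_bargmann_norm:
  fixes f :: "real ^ 'n \<Rightarrow> complex"
  assumes f: "f \<in> L2 gauss"
  shows "fock_norm (gauss_bargmann f) = sqrt (sqrt pi ^ CARD('n)) * l2_norm gauss f"
  using f by (intro gb_isometric_norm)
    (simp add: gb_isometric_def gauss_bargmann_in_fock_space gauss_bargmann_isometry)

text \<open>
  The candidate preimage is \<open>G\<^sup>* F\<close> divided by \<open>\<pi>\<^sup>n\<^sup>/\<^sup>2\<close>, with \<open>G\<^sup>* F\<close> from the Riesz theorem. Coherent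
  states are images of exponentials, so testing against them reduces to the isometry.
\<close>

theorem gauss_bargmann_surjective:
  fixes F :: "complex ^ 'n \<Rightarrow> complex"
  assumes F: "F \<in> fock_space"
  shows "\<exists>f\<in>L2 gauss. gauss_bargmann f = F"
proof -
  define s where "s = complex_of_real (sqrt pi ^ CARD('n))"
  have s: "s \<noteq> 0" by (simp add: s_def)
  have "\<exists>g\<in>L2 gauss. \<forall>f\<in>L2 gauss. fock_inner (gauss_bargmann f) F = l2_inner gauss f g"
  proof (rule gauss.L2_riesz_representation)
    fix f :: "real ^ 'n \<Rightarrow> complex" assume f: "f \<in> L2 gauss"
    show "fock_inner (gauss_bargmann (\<lambda>\<xi>. f \<xi> + g \<xi>)) F
        = fock_inner (gauss_bargmann f) F + fock_inner (gauss_bargmann g) F" if "g \<in> L2 gauss" for g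
      unfolding gauss_bargmann_add[OF f that] fock_inner_eq
      by (intro l2_inner_add_left fock_spaceD gauss_bargmann_in_fock_space f that F)
    show "fock_inner (gauss_bargmann (\<lambda>\<xi>. c * f \<xi>)) F = c * fock_inner (gauss_bargmann f) F" for c
      unfolding gauss_bargmann_cmult[OF f] fock_inner_eq by (rule l2_inner_cmult_left)
    have "cmod (fock_inner (gauss_bargmann f) F) \<le> fock_norm (gauss_bargmann f) * fock_norm F"
      unfolding fock_inner_eq fock_norm_eq
      by (intro l2_cauchy_schwarz fock_spaceD gauss_bargmann_in_fock_space f F)
    also have "\<dots> \<le> sqrt (sqrt pi ^ CARD('n)) * l2_norm gauss f * fock_norm F"
      by (intro mult_right_mono gauss_bargmann_norm_le f) (simp add: fock_norm_eq l2_norm_nonneg)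
    finally show "cmod (fock_inner (gauss_bargmann f) F)
        \<le> (sqrt (sqrt pi ^ CARD('n)) * fock_norm F) * l2_norm gauss f"
      by (simp only: mult_ac)
  qed
  then obtain g where g: "g \<in> L2 gauss"
    and rep: "\<And>f. f \<in> L2 gauss \<Longrightarrow> fock_inner (gauss_bargmann f) F = l2_inner gauss f g" by blast
  define f where "f \<xi> = (1 / s) * g \<xi>" for \<xi>
  have f: "f \<in> L2 gauss" unfolding f_def[abs_def] by (rule L2_cmult[OF g])
  have "gauss_bargmann f = F"
  proof (rule fock_space_eqI[OF gauss_bargmann_in_fock_space[OF f] F])
    fix w :: "complex ^ 'n"
    \<comment> \<open>The exponential whose transform is a multiple of the coherent state at \<open>w\<close>.\<close>
    define u where "u = (- \<i>) *s vcnj w"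
    have w: "vcnj (\<i> *s u) = w" by (simp add: u_def vcnj_def vec_eq_iff)
    define k where "k = s * exp ((1/4) * (u \<bullet>\<^sub>c u))"
    have k: "k \<noteq> 0" using s by (simp add: k_def)
    have Gu: "gauss_bargmann (expf u) = (\<lambda>z. k * coherent w z)"
      by (simp only: gauss_bargmann_expf w k_def s_def)
    have "fock_inner (gauss_bargmann f) (gauss_bargmann (expf u)) = s * l2_inner gauss f (expf u)"
      unfolding s_def by (rule gauss_bargmann_isometry[OF f expf_in_L2_gauss])
    also have "\<dots> = l2_inner gauss g (expf u)"
      using s by (simp only: f_def[abs_def] l2_inner_cmult_left) simp
    also have "\<dots> = cnj (fock_inner (gauss_bargmann (expf u)) F)"
      unfolding rep[OF expf_in_L2_gauss] by (rule l2_inner_cnj)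
    also have "\<dots> = fock_inner F (gauss_bargmann (expf u))"
      unfolding fock_inner_eq by (rule l2_inner_cnj[symmetric])
    finally show "fock_inner (gauss_bargmann f) (coherent w) = fock_inner F (coherent w)"
      unfolding Gu fock_inner_eq l2_inner_cmult_right using k by simp
  qed
  with f show ?thesis by blast
qed

text \<open>
  By the isometry \<open>\<pi>\<^sup>n\<^sup>/\<^sup>2 f\<close> satisfies the condition that defines the adjoint, and any two functions
  that satisfy it agree almost everywhere.
\<close>

theorem
  fixes f :: "real ^ 'n \<Rightarrow> complex"
  assumes f: "f \<in> L2 gauss"
  shows gauss_bargmann_adjoint_in_L2: "gauss_bargmann_adjoint (gauss_bargmann f) \<in> L2 gauss"
    and gauss_bargmann_adjoint_gauss_bargmann: "AE \<xi> in lborel. gauss_bargmann_adjoint (gauss_bargmann f) \<xi> = of_real (sqrt pi ^ CARD('n)) * f \<xi>"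
proof -
  define s where "s = complex_of_real (sqrt pi ^ CARD('n))"
  let ?P = "\<lambda>g. g \<in> L2 gauss \<and> (\<forall>h\<in>L2 gauss. l2_inner gauss h g = fock_inner (gauss_bargmann h) (gauss_bargmann f))"
  have sf: "(\<lambda>\<xi>. s * f \<xi>) \<in> L2 gauss" by (rule L2_cmult[OF f])
  have "?P (\<lambda>\<xi>. s * f \<xi>)"
    using sf by (simp add: gauss_bargmann_isometry f l2_inner_cmult_right s_def)
  then have A: "?P (gauss_bargmann_adjoint (gauss_bargmann f))"
    unfolding gauss_bargmann_adjoint_def L2_gauss_eq L2_gauss_inner_eq by (rule someI[of ?P])
  then show "gauss_bargmann_adjoint (gauss_bargmann f) \<in> L2 gauss" by blast
  define d where "d \<xi> = gauss_bargmann_adjoint (gauss_bargmann f) \<xi> - s * f \<xi>" for \<xi>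
  have d: "d \<in> L2 gauss" unfolding d_def[abs_def] using A sf by (intro L2_diff) auto
  have "(\<lambda>\<xi>. gauss_bargmann_adjoint (gauss_bargmann f) \<xi> - s * f \<xi>) = d"
    by (simp add: d_def fun_eq_iff)
  with l2_inner_diff_right[OF conjunct1[OF A] sf d]
  have "l2_inner gauss d d = l2_inner gauss d (gauss_bargmann_adjoint (gauss_bargmann f)) - l2_inner gauss d (\<lambda>\<xi>. s * f \<xi>)"
    by (simp only:)
  also have "\<dots> = 0"
    using A \<open>?P (\<lambda>\<xi>. s * f \<xi>)\<close> d by simp
  finally have "l2_inner gauss d d = 0" .
  then have "l2_norm gauss d = 0" by (simp add: l2_inner_self)
  from l2_norm_zero_imp_AE[OF d this]
  show "AE \<xi> in lborel. gauss_bargmann_adjoint (gauss_bargmann f) \<xi> = of_real (sqrt pi ^ CARD('n)) * f \<xi>"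
    unfolding AE_gauss_iff by eventually_elim (simp add: d_def s_def)
qed


section \<open>Operators commuting with the translations\<close>

lemma modulation_in_L2_gauss:
  assumes f: "f \<in> L2 gauss"
  shows "(\<lambda>\<xi>. f \<xi> * expf (\<i> *s cvec a) \<xi>) \<in> L2 gauss"
proof -
  have "cmod (expf (\<i> *s cvec a) \<xi>) = 1" for \<xi>
  proof -
    have "Re ((\<i> *s cvec a) \<bullet>\<^sub>c cvec \<xi>) = 0"
      by (simp add: cdot_def cvec_def Re_sum)
    then show ?thesis by (simp add: expf_def norm_exp_eq_Re)
  qed
  then show ?thesis using f
    by (auto simp: L2_def measurable_gauss_iff norm_mult intro!: borel_measurable_times expf_measurable)
qed

text \<open>
  The exponential factors of \<open>\<rho>(a)\<close> cancel the difference of \<open>(z + a)\<^sup>2 / 4\<close> and \<open>z\<^sup>2 / 4\<close>, so under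
  \<open>G\<close> the translation by \<open>a\<close> becomes the multiplication by a character.
\<close>

lemma rho_gauss_bargmann:
  assumes f: "f \<in> L2 gauss"
  shows "rho a (gauss_bargmann f) = gauss_bargmann (\<lambda>\<xi>. f \<xi> * expf (\<i> *s cvec a) \<xi>)"
proof
  fix z
  define J where "J = (LINT \<xi>|gauss. f \<xi> * expf (\<i> *s cvec a) \<xi> * expf (\<i> *s z) \<xi>)"
  have J: "(LINT \<xi>|gauss. f \<xi> * expf (\<i> *s (z + cvec a)) \<xi>) = J"
  proof -
    have "\<i> *s (z + cvec a) = \<i> *s cvec a + \<i> *s z" by (simp add: vec_eq_iff algebra_simps)
    then show ?thesis unfolding J_def by (simp only: expf_add mult.assoc)
  qed
  have "rho a (gauss_bargmann f) z = (exp ((1/4) * ((z + cvec a) \<bullet>\<^sub>c (z + cvec a))) *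
      exp (- (1/2) * (cvec a \<bullet>\<^sub>c z)) * exp (- (1/4) * of_real ((norm a)\<^sup>2))) * J"
    unfolding rho_def gauss_bargmann_expf_integral[OF f] J by (simp only: mult_ac)
  also have "exp ((1/4) * ((z + cvec a) \<bullet>\<^sub>c (z + cvec a))) *
      exp (- (1/2) * (cvec a \<bullet>\<^sub>c z)) * exp (- (1/4) * of_real ((norm a)\<^sup>2)) = exp ((1/4) * (z \<bullet>\<^sub>c z))"
    unfolding exp_add[symmetric] cdot_cvec_self[symmetric] cdot_add_left cdot_add_right cdot_commute[of z "cvec a"]
    by (intro arg_cong[of _ _ exp]) (simp add: algebra_simps)
  also have "\<dots> * J = gauss_bargmann (\<lambda>\<xi>. f \<xi> * expf (\<i> *s cvec a) \<xi>) z"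
    unfolding J_def by (rule gauss_bargmann_expf_integral[OF modulation_in_L2_gauss[OF f], symmetric])
  finally show "rho a (gauss_bargmann f) z = gauss_bargmann (\<lambda>\<xi>. f \<xi> * expf (\<i> *s cvec a) \<xi>) z" .
qed

lemma gauss_bargmann_cong_AE:
  assumes "f \<in> L2 gauss" "g \<in> L2 gauss" "AE \<xi> in lborel. f \<xi> = g \<xi>"
  shows "gauss_bargmann f = gauss_bargmann g"
proof
  fix z
  have "l2_inner gauss f (expf (vcnj (\<i> *s z))) = l2_inner gauss g (expf (vcnj (\<i> *s z)))"
    unfolding l2_inner_def
  proof (rule integral_cong_AE)
    show "AE \<xi> in gauss. f \<xi> * cnj (expf (vcnj (\<i> *s z)) \<xi>) = g \<xi> * cnj (expf (vcnj (\<i> *s z)) \<xi>)"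
      unfolding AE_gauss_iff using assms(3) by eventually_elim simp
  qed (rule borel_measurable_integrable, rule L2_inner_integrable[OF _ expf_in_L2_gauss], rule assms)+
  then show "gauss_bargmann f z = gauss_bargmann g z"
    by (simp add: gauss_bargmann_inner assms)
qed

lemma Linfty_mult_L2:
  assumes m: "m \<in> Linfty" and f: "f \<in> L2 gauss"
  shows "(\<lambda>\<xi>. m \<xi> * f \<xi>) \<in> L2 gauss"
proof -
  obtain C where C: "AE \<xi> in lborel. cmod (m \<xi>) \<le> C" using m by (auto simp: Linfty_def)
  have mm: "m \<in> borel_measurable gauss" "f \<in> borel_measurable gauss"
    using m L2_measurable[OF f] by (auto simp: Linfty_def measurable_gauss_iff)
  have "integrable gauss (\<lambda>\<xi>. (cmod (m \<xi> * f \<xi>))\<^sup>2)"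
  proof (rule Bochner_Integration.integrable_bound)
    show "integrable gauss (\<lambda>\<xi>. C\<^sup>2 * (cmod (f \<xi>))\<^sup>2)"
      by (intro integrable_mult_right L2_integrable f)
    show "AE \<xi> in gauss. norm ((cmod (m \<xi> * f \<xi>))\<^sup>2) \<le> norm (C\<^sup>2 * (cmod (f \<xi>))\<^sup>2)"
      unfolding AE_gauss_iff using C
      by eventually_elim (auto simp: norm_mult power_mult_distrib intro!: mult_right_mono power_mono)
  qed (use mm in measurable)
  then show ?thesis using mm by (simp add: L2_def)
qed

text \<open>
  Test the bound on the indicator of the set where \<open>\<bar>m\<bar> > C\<close>.
\<close>

lemma multiplier_bounded:
  fixes m :: "real ^ 'n \<Rightarrow> complex"
  assumes m: "m \<in> L2 gauss" and C: "0 \<le> C"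
    and bound: "\<And>f. f \<in> L2 gauss \<Longrightarrow> (\<lambda>\<xi>. m \<xi> * f \<xi>) \<in> L2 gauss \<and>
      l2_norm gauss (\<lambda>\<xi>. m \<xi> * f \<xi>) \<le> C * l2_norm gauss f"
  shows "AE \<xi> in lborel. cmod (m \<xi>) \<le> C"
proof -
  have mm: "m \<in> borel_measurable borel" using L2_measurable[OF m] by (simp add: measurable_gauss_iff)
  define A where "A = {\<xi>. C < cmod (m \<xi>)}"
  have A [measurable]: "A \<in> sets borel" unfolding A_def using mm by measurable
  define f where "f \<xi> = (indicator A \<xi> :: complex)" for \<xi>
  have "f \<in> borel_measurable borel" unfolding f_def by measurable
  then have f: "f \<in> L2 gauss"
    by (intro exp_growth_in_L2_gauss[where r=0]) (auto simp: f_def indicator_def)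
  define h where "h \<xi> = (cmod (m \<xi> * f \<xi>))\<^sup>2 - C\<^sup>2 * (cmod (f \<xi>))\<^sup>2" for \<xi>
  have mf: "(\<lambda>\<xi>. m \<xi> * f \<xi>) \<in> L2 gauss" using bound[OF f] by blast
  have h: "integrable gauss h"
    unfolding h_def[abs_def]
    by (intro Bochner_Integration.integrable_diff integrable_mult_right L2_integrable f mf)
  have h_pos: "0 \<le> h \<xi>" for \<xi>
    using C by (auto simp: h_def f_def A_def indicator_def intro!: power_mono)
  have "(l2_norm gauss (\<lambda>\<xi>. m \<xi> * f \<xi>))\<^sup>2 \<le> (C * l2_norm gauss f)\<^sup>2"
    using bound[OF f] l2_norm_nonneg by (intro power_mono) auto
  then have "(LINT \<xi>|gauss. h \<xi>) \<le> 0"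
    unfolding h_def using L2_integrable[OF f] L2_integrable[OF mf]
    by (simp add: l2_norm_sq power_mult_distrib)
  moreover have "0 \<le> (LINT \<xi>|gauss. h \<xi>)" by (rule integral_nonneg_AE) (simp add: h_pos)
  ultimately have "(LINT \<xi>|gauss. h \<xi>) = 0" by (rule antisym)
  then have "AE \<xi> in gauss. h \<xi> = 0"
    using integral_nonneg_eq_0_iff_AE[OF h] h_pos by simp
  then show ?thesis
    unfolding AE_gauss_iff
  proof eventually_elim
    case (elim \<xi>)
    show ?case
    proof (rule ccontr)
      assume "\<not> cmod (m \<xi>) \<le> C"
      then have "C\<^sup>2 < (cmod (m \<xi>))\<^sup>2" "\<xi> \<in> A" using C by (auto simp: A_def intro!: power_strict_mono)
      then show False using elim by (simp add: h_def f_def)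
    qed
  qed
qed

lemma fock_eval_zero_bound:
  assumes "F \<in> fock_space"
  shows "cmod (F 0) \<le> fock_norm (coherent 0 :: complex ^ 'n \<Rightarrow> complex) * fock_norm (F :: complex ^ 'n \<Rightarrow> complex)"
  using l2_cauchy_schwarz[OF fock_spaceD(1)[OF assms] fock_spaceD(1)[OF coherent_in_fock_space[of 0]]]
  by (simp only: fock_norm_eq fock_reproducing[OF assms, symmetric] fock_inner_eq mult.commute)

text \<open>
  The multiplier is read off at the origin: it represents the functional \<open>f \<mapsto> S(Gf)(0)\<close>. Commutation
  with \<open>\<rho>(a)\<close> moves this information to all real points, where it is a Fourier transform. At first
  \<open>m\<close> is only known to be square integrable, so \<open>m f\<close> is merely integrable and \<open>G(m f)\<close> is not yet
  meaningful; therefore \<open>m f\<close> is compared with the preimage \<open>h\<close> of \<open>S(Gf)\<close>, and it inherits square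
  integrability from \<open>h\<close>.
\<close>

lemma commuting_imp_multiplier:
  fixes S :: "(complex ^ 'n \<Rightarrow> complex) \<Rightarrow> (complex ^ 'n \<Rightarrow> complex)"
  assumes S: "fock_bounded_linear S"
    and comm: "\<And>a F. F \<in> fock_space \<Longrightarrow> S (rho a F) = rho a (S F)"
  shows "\<exists>m\<in>Linfty. \<forall>f\<in>L2 gauss. S (gauss_bargmann f) = gauss_bargmann (\<lambda>\<xi>. m \<xi> * f \<xi>)"
proof -
  define s where "s = sqrt (sqrt pi ^ CARD('n))"
  have s: "s > 0" by (simp add: s_def)
  note G_fock = gauss_bargmann_in_fock_space
  have S_fock: "\<And>F. F \<in> fock_space \<Longrightarrow> S F \<in> fock_space"
    and S_add: "\<And>F H. F \<in> fock_space \<Longrightarrow> H \<in> fock_space \<Longrightarrow> S (\<lambda>z. F z + H z) = (\<lambda>z. S F z + S H z)"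
    and S_cmult: "\<And>c F. F \<in> fock_space \<Longrightarrow> S (\<lambda>z. c * F z) = (\<lambda>z. c * S F z)"
    using S unfolding fock_bounded_linear_def by blast+
  obtain C0 where C0: "\<And>F. F \<in> fock_space \<Longrightarrow> fock_norm (S F) \<le> C0 * fock_norm F"
    using S unfolding fock_bounded_linear_def by blast
  define C where "C = max 0 C0"
  have C: "0 \<le> C" by (simp add: C_def)
  have S_norm: "fock_norm (S F) \<le> C * fock_norm F" if "F \<in> fock_space" for F
  proof -
    have "C0 * fock_norm F \<le> C * fock_norm F"
      by (intro mult_right_mono) (auto simp: C_def fock_norm_eq l2_norm_nonneg)
    with C0[OF that] show ?thesis by linarith
  qed
  have "\<exists>g\<in>L2 gauss. \<forall>f\<in>L2 gauss. S (gauss_bargmann f) 0 = l2_inner gauss f g"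
  proof (rule gauss.L2_riesz_representation)
    fix f :: "real ^ 'n \<Rightarrow> complex" assume f: "f \<in> L2 gauss"
    show "S (gauss_bargmann (\<lambda>\<xi>. f \<xi> + g \<xi>)) 0 = S (gauss_bargmann f) 0 + S (gauss_bargmann g) 0"
      if "g \<in> L2 gauss" for g
      by (simp add: gauss_bargmann_add f that S_add G_fock)
    show "S (gauss_bargmann (\<lambda>\<xi>. c * f \<xi>)) 0 = c * S (gauss_bargmann f) 0" for c
      by (simp add: gauss_bargmann_cmult f S_cmult G_fock)
    let ?k = "fock_norm (coherent 0 :: complex ^ 'n \<Rightarrow> complex)"
    have k: "0 \<le> ?k" by (simp add: fock_norm_eq l2_norm_nonneg)
    have "cmod (S (gauss_bargmann f) 0) \<le> ?k * fock_norm (S (gauss_bargmann f))"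
      by (intro fock_eval_zero_bound S_fock G_fock f)
    also have "\<dots> \<le> ?k * (C * (s * l2_norm gauss f))"
      using S_norm[OF G_fock[OF f]] gauss_bargmann_norm[OF f] k by (intro mult_left_mono) (auto simp: s_def)
    finally show "cmod (S (gauss_bargmann f) 0) \<le> (?k * C * s) * l2_norm gauss f"
      by (simp only: mult.assoc)
  qed
  then obtain g where g: "g \<in> L2 gauss"
    and rep: "\<And>f. f \<in> L2 gauss \<Longrightarrow> S (gauss_bargmann f) 0 = l2_inner gauss f g" by blast
  define m where "m \<xi> = cnj (g \<xi>)" for \<xi>
  have m: "m \<in> L2 gauss" unfolding m_def[abs_def] by (rule L2_cnj[OF g])
  have key: "\<exists>h\<in>L2 gauss. S (gauss_bargmann f) = gauss_bargmann h \<and> (AE \<xi> in lborel. h \<xi> = m \<xi> * f \<xi>)"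
    if f: "f \<in> L2 gauss" for f
  proof -
    obtain h where h: "h \<in> L2 gauss" and Gh: "gauss_bargmann h = S (gauss_bargmann f)"
      using gauss_bargmann_surjective[OF S_fock[OF G_fock[OF f]]] by blast
    have mf: "integrable gauss (\<lambda>\<xi>. m \<xi> * f \<xi>)" by (rule L2_prod_integrable[OF m f])
    have "AE \<xi> in lborel. h \<xi> - m \<xi> * f \<xi> = 0"
    proof (rule gauss_fourier_injective)
      show "integrable gauss (\<lambda>\<xi>. h \<xi> - m \<xi> * f \<xi>)"
        using mf gauss.L2_imp_integrable[OF h] by simp
      fix a :: "real ^ 'n"
      let ?e = "expf (\<i> *s cvec a)"
      have fe: "(\<lambda>\<xi>. f \<xi> * ?e \<xi>) \<in> L2 gauss" by (rule modulation_in_L2_gauss[OF f])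
      have "(LINT \<xi>|gauss. h \<xi> * ?e \<xi>) = rho a (gauss_bargmann h) 0"
        unfolding rho_gauss_bargmann[OF h] gauss_bargmann_expf_integral[OF modulation_in_L2_gauss[OF h]]
        by (simp add: expf_def)
      also have "\<dots> = S (rho a (gauss_bargmann f)) 0"
        unfolding Gh comm[OF G_fock[OF f]] ..
      also have "\<dots> = l2_inner gauss (\<lambda>\<xi>. f \<xi> * ?e \<xi>) g"
        unfolding rho_gauss_bargmann[OF f] by (rule rep[OF fe])
      also have "\<dots> = (LINT \<xi>|gauss. m \<xi> * f \<xi> * ?e \<xi>)"
        unfolding l2_inner_def m_def by (simp only: mult_ac)
      finally have eq: "(LINT \<xi>|gauss. h \<xi> * ?e \<xi>) = (LINT \<xi>|gauss. m \<xi> * f \<xi> * ?e \<xi>)" .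
      have "integrable gauss (\<lambda>\<xi>. m \<xi> * f \<xi> * ?e \<xi>)"
        using L2_prod_integrable[OF m fe] by (simp only: mult.assoc)
      with L2_prod_integrable[OF h expf_in_L2_gauss] eq
      show "(LINT \<xi>|gauss. (h \<xi> - m \<xi> * f \<xi>) * ?e \<xi>) = 0"
        by (simp add: left_diff_distrib)
    qed
    then have "AE \<xi> in lborel. h \<xi> = m \<xi> * f \<xi>" by eventually_elim simp
    with h Gh show ?thesis by metis
  qed
  have mult: "(\<lambda>\<xi>. m \<xi> * f \<xi>) \<in> L2 gauss \<and> S (gauss_bargmann f) = gauss_bargmann (\<lambda>\<xi>. m \<xi> * f \<xi>)"
    if f: "f \<in> L2 gauss" for f
  proof -
    obtain h where h: "h \<in> L2 gauss" "S (gauss_bargmann f) = gauss_bargmann h"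
      and ae: "AE \<xi> in lborel. h \<xi> = m \<xi> * f \<xi>" using key[OF f] by blast
    have mm: "(\<lambda>\<xi>. m \<xi> * f \<xi>) \<in> borel_measurable gauss"
      by (intro borel_measurable_times L2_measurable m f)
    have ae': "AE \<xi> in gauss. (cmod (h \<xi>))\<^sup>2 = (cmod (m \<xi> * f \<xi>))\<^sup>2"
      unfolding AE_gauss_iff using ae by eventually_elim simp
    have "(\<lambda>\<xi>. (cmod (m \<xi> * f \<xi>))\<^sup>2) \<in> borel_measurable gauss"
      by (rule borel_measurable_power[OF measurable_compose[OF mm borel_measurable_norm]])
    from integrable_cong_AE_imp[OF L2_integrable[OF h(1)] this]
    have "integrable gauss (\<lambda>\<xi>. (cmod (m \<xi> * f \<xi>))\<^sup>2)" using ae' by (simp add: eq_commute)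
    then have mf: "(\<lambda>\<xi>. m \<xi> * f \<xi>) \<in> L2 gauss" using mm by (simp add: L2_def)
    with gauss_bargmann_cong_AE[OF h(1) mf ae] h(2) show ?thesis by simp
  qed
  have "AE \<xi> in lborel. cmod (m \<xi>) \<le> C"
  proof (rule multiplier_bounded[OF m C])
    fix f :: "real ^ 'n \<Rightarrow> complex" assume f: "f \<in> L2 gauss"
    have "s * l2_norm gauss (\<lambda>\<xi>. m \<xi> * f \<xi>) = fock_norm (S (gauss_bargmann f))"
      using mult[OF f] gauss_bargmann_norm[of "\<lambda>\<xi>. m \<xi> * f \<xi>"] by (simp add: s_def)
    also have "\<dots> \<le> C * (s * l2_norm gauss f)"
      using S_norm[OF G_fock[OF f]] gauss_bargmann_norm[OF f] by (simp add: s_def)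
    finally show "(\<lambda>\<xi>. m \<xi> * f \<xi>) \<in> L2 gauss \<and> l2_norm gauss (\<lambda>\<xi>. m \<xi> * f \<xi>) \<le> C * l2_norm gauss f"
      using mult[OF f] s by (simp add: mult.left_commute[of C])
  qed
  then have "m \<in> Linfty"
    using L2_measurable[OF m] by (auto simp: Linfty_def measurable_gauss_iff)
  with mult show ?thesis by blast
qed

text \<open>
  The right-hand side of the theorem is \<open>G(m G\<^sup>* F)\<close>, and \<open>G\<^sup>* G\<close> multiplies by \<open>\<pi>\<^sup>n\<^sup>/\<^sup>2\<close>.
\<close>

lemma multiplier_integral_eq:
  fixes m f :: "real ^ 'n \<Rightarrow> complex"
  assumes m: "m \<in> Linfty" and f: "f \<in> L2 gauss"
  shows "exp ((1/4) * (z \<bullet>\<^sub>c z)) * (LINT \<xi>|gauss. m \<xi> * gauss_bargmann_adjoint (gauss_bargmann f) \<xi> * exp (\<i> * (z \<bullet>\<^sub>c cvec \<xi>)))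
    = gauss_bargmann (\<lambda>\<xi>. of_real (sqrt pi ^ CARD('n)) * m \<xi> * f \<xi>) z"
proof -
  define k where "k = complex_of_real (sqrt pi ^ CARD('n))"
  have km: "(\<lambda>\<xi>. k * m \<xi> * f \<xi>) \<in> L2 gauss"
    using L2_cmult[OF Linfty_mult_L2[OF m f], of k] by (simp only: mult.assoc)
  have mm: "m \<in> borel_measurable gauss" using m by (simp add: Linfty_def measurable_gauss_iff)
  have ae: "AE \<xi> in gauss. m \<xi> * gauss_bargmann_adjoint (gauss_bargmann f) \<xi> * expf (\<i> *s z) \<xi>
      = k * m \<xi> * f \<xi> * expf (\<i> *s z) \<xi>"
    unfolding AE_gauss_iff using gauss_bargmann_adjoint_gauss_bargmann[OF f]
    by eventually_elim (simp add: k_def)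
  have "(LINT \<xi>|gauss. m \<xi> * gauss_bargmann_adjoint (gauss_bargmann f) \<xi> * expf (\<i> *s z) \<xi>)
      = (LINT \<xi>|gauss. k * m \<xi> * f \<xi> * expf (\<i> *s z) \<xi>)"
  proof (rule integral_cong_AE[OF _ _ ae])
    show "(\<lambda>\<xi>. m \<xi> * gauss_bargmann_adjoint (gauss_bargmann f) \<xi> * expf (\<i> *s z) \<xi>) \<in> borel_measurable gauss"
      by (intro borel_measurable_times mm L2_measurable gauss_bargmann_adjoint_in_L2 f expf_in_L2_gauss)
    show "(\<lambda>\<xi>. k * m \<xi> * f \<xi> * expf (\<i> *s z) \<xi>) \<in> borel_measurable gauss"
      by (intro borel_measurable_times L2_measurable[OF km] L2_measurable[OF expf_in_L2_gauss])
  qed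
  then show ?thesis
    using gauss_bargmann_expf_integral[OF km, of z] by (simp add: k_def expf_def cdot_smult_left)
qed

theorem theorem1p2:
  fixes S :: "(complex ^ 'n \<Rightarrow> complex) \<Rightarrow> (complex ^ 'n \<Rightarrow> complex)"
  assumes "fock_bounded_linear S"
  shows "(\<forall>a :: real ^ 'n. \<forall>F\<in>fock_space. S (rho a F) = rho a (S F)) \<longleftrightarrow>
    (\<exists>m\<in>Linfty. \<forall>F\<in>fock_space. \<forall>z.
      S F z = exp ((1/4) * (z \<bullet>\<^sub>c z)) *
        (LINT \<xi>|gauss. m \<xi> * gauss_bargmann_adjoint F \<xi> * exp (\<i> * (z \<bullet>\<^sub>c cvec \<xi>))))"
    (is "?comm \<longleftrightarrow> ?mult")
proof
  assume comm: ?comm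
  define k where "k = complex_of_real (sqrt pi ^ CARD('n))"
  have k: "k \<noteq> 0" by (simp add: k_def)
  obtain m where m: "m \<in> Linfty"
    and Sm: "\<And>f. f \<in> L2 gauss \<Longrightarrow> S (gauss_bargmann f) = gauss_bargmann (\<lambda>\<xi>. m \<xi> * f \<xi>)"
    using commuting_imp_multiplier[OF assms] comm by blast
  obtain C where "AE \<xi> in lborel. cmod (m \<xi>) \<le> C" using m by (auto simp: Linfty_def)
  then have "AE \<xi> in lborel. cmod (m \<xi> / k) \<le> C / cmod k"
    by eventually_elim (simp add: norm_divide divide_right_mono)
  then have mk: "(\<lambda>\<xi>. m \<xi> / k) \<in> Linfty"
    using m by (auto simp: Linfty_def)
  show ?mult
  proof (intro bexI[OF _ mk] ballI allI)
    fix F :: "complex ^ 'n \<Rightarrow> complex" and z assume "F \<in> fock_space"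
    then obtain f where f: "f \<in> L2 gauss" and F: "gauss_bargmann f = F"
      using gauss_bargmann_surjective by blast
    have "k * (m \<xi> / k) = m \<xi>" for \<xi> using k by simp
    then show "S F z = exp ((1/4) * (z \<bullet>\<^sub>c z)) *
        (LINT \<xi>|gauss. m \<xi> / k * gauss_bargmann_adjoint F \<xi> * exp (\<i> * (z \<bullet>\<^sub>c cvec \<xi>)))"
      using multiplier_integral_eq[OF mk f, of z] unfolding F[symmetric] Sm[OF f]
      by (simp only: k_def)
  qed
next
  assume ?mult
  then obtain m where m: "m \<in> Linfty" and SF: "\<And>F z. F \<in> fock_space \<Longrightarrow>
      S F z = exp ((1/4) * (z \<bullet>\<^sub>c z)) *
        (LINT \<xi>|gauss. m \<xi> * gauss_bargmann_adjoint F \<xi> * exp (\<i> * (z \<bullet>\<^sub>c cvec \<xi>)))" by blast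
  define k where "k = complex_of_real (sqrt pi ^ CARD('n))"
  have S: "S (gauss_bargmann f) = gauss_bargmann (\<lambda>\<xi>. k * m \<xi> * f \<xi>)" if f: "f \<in> L2 gauss" for f
    unfolding k_def
    by (rule ext) (simp only: SF[OF gauss_bargmann_in_fock_space[OF f]] multiplier_integral_eq[OF m f])
  show ?comm
  proof (intro allI ballI)
    fix a :: "real ^ 'n" and F :: "complex ^ 'n \<Rightarrow> complex" assume "F \<in> fock_space"
    then obtain f where f: "f \<in> L2 gauss" and F: "gauss_bargmann f = F"
      using gauss_bargmann_surjective by blast
    have kmf: "(\<lambda>\<xi>. k * m \<xi> * f \<xi>) \<in> L2 gauss"
      using L2_cmult[OF Linfty_mult_L2[OF m f], of k] by (simp only: mult.assoc)
    show "S (rho a F) = rho a (S F)"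
      unfolding F[symmetric] rho_gauss_bargmann[OF f] S[OF f] rho_gauss_bargmann[OF kmf]
        S[OF modulation_in_L2_gauss[OF f]] by (simp only: mult.assoc)
  qed
qed

end
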